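(* Let $\mathbb F$ be a field of characteristic $p>0$ and let $A$ be a divided power algebra over $\mathbb F$. There is an equivalence of categories $$\ker:\mathsf{DBun}_A\rightleftarrows U(A)_{\mathsf{Mod}}:A\ltimes_p-$$ between the category $\mathsf{DBun}_A$ of differential bundles over $A$ in the algebraic tangent structure on divided power algebras and the category $U(A)_{\mathsf{Mod}}$ of modules over the underlying commutative algebra $U(A)$ of $A$.
   Context: Divided power algebras. A divided power algebra over $\mathbb F$ is a commutative associative non-unital $\mathbb F$-algebra $(A,* )$ (product also written by concatenation) with functions $a\mapsto a^{[n]}$, $A\to A$, for all integers $n\ge1$, such that for all $a,b\in A$, $\lambda\in\mathbb F$: $(\lambda a)^{[n]}=\lambda^na^{[n]}$; $a^{[m]}*a^{[n]}=\binom{m+n}{m}a^{[m+n]}$; $(a+b)^{[n]}=a^{[n]}+\sum_{l=1}^{n-1}a^{[l]}*b^{[n-l]}+b^{[n]}$; $a^{[1]}=a$; $(a*b)^{[n]}=n!\,a^{[n]}*b^{[n]}=a^{*n}*b^{[n]}=a^{[n]}*b^{*n}$; $(a^{[n]})^{[m]}=\frac{(mn)!}{m!(n!)^m}a^{[mn]}$. Morphisms are algebra morphisms commuting with all $(-)^{[n]}$; the category is $\Gamma_{\mathrm{alg}}$. $U(A)$ is the underlying commutative (non-unital) algebra of $A$; modules over it are in the non-unital sense. In characteristic $p>0$, a divided power structure is determined by its $p$-th operation. Semidirect product. For a $U(A)$-module $M$, $A\ltimes_pM$ is the divided power algebra on $A\oplus M$ with product $(a,m)*(b,n)=(ab,a\cdot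 n+b\cdot m)$ and $(a,m)^{[p]}=(a^{[p]},-a^{p-1}\cdot m)$ (i.e. $M$ carries the trivial $p$-map). Algebraic tangent structure on $\Gamma_{\mathrm{alg}}$: $\mathsf TA=A\ltimes_pA$, $\mathsf T(f)=f\times f$; $p_A(a,b)=a$; $\mathsf T_2A=\mathsf TA\times_A\mathsf TA$ with elements $(a,b,c)$ corresponding to $((a,b),(a,c))$; $s_A(a,b,c)=(a,b+c)$; $z_A(a)=(a,0)$; $l_A(a,b)=(a,0,0,b)$; $c_A(a,b,c,d)=(a,c,b,d)$; $n_A(a,b)=(a,-b)$, where $(a,b,c,d)=((a,b),(c,d))\in\mathsf T^2A$. This is a (Rosický) tangent structure. Differential bundles. In a tangent category $(\mathbb X,\mathsf T,p,s,z,l,c)$, a differential bundle over $A$ is a morphism $q:E\to A$ with morphisms $\sigma:E_2=E\times_AE\to E$, $\zeta:A\to E$, $\lambda:E\to\mathsf TE$ such that: the $n$-fold pullbacks $E_n$ of $q$ exist and are preserved by all $\mathsf T^m$; $(q,\sigma,\zeta)$ is a commutative monoid in $\mathbb X/A$; with $\pi_1,\pi_2:E_2\to E$ the projections, $\mathsf T(q)\lambda=z_Aq$, $\lambda\sigma=\mathsf T(\sigma)\langle\lambda\pi_1,\lambda\pi_2\rangle$, $\lambda\zeta=\mathsf T(\zeta)z_A$; $p_E\lambda=\zeta q$, $\lambda\sigma=s_E\langle\lambda\pi_1,\lambda\pi_2\rangle$, $\lambda\zeta=z_E\zeta$; $l_E\lambda=\mathsf T(\lambda)\lambda$; and the morphism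 $\mathsf T(\sigma)\langle\lambda\pi_1,z_E\pi_2\rangle:E_2\to\mathsf TE$ together with $q\pi_1=q\pi_2:E_2\to A$ exhibits $E_2$ as the pullback of $\mathsf T(q):\mathsf TE\to\mathsf TA$ along $z_A:A\to\mathsf TA$, this pullback being preserved by all $\mathsf T^m$. Morphisms $(q,\lambda)\to(q',\lambda')$ of differential bundles over $A$ are morphisms $f:E\to E'$ with $q'f=q$ and $\mathsf T(f)\lambda=\lambda'f$. The functors. $\ker$ sends a differential bundle $(q:E\to A,\sigma,\zeta,\lambda)$ to $\ker(q)\subseteq E$ with $U(A)$-action $a\cdot e=\zeta(a)*e$, and a morphism to its restriction. $A\ltimes_p-$ sends a $U(A)$-module $M$ to the projection $A\ltimes_pM\to A$, with $\sigma(a,m,m')=(a,m+m')$, $\zeta(a)=(a,0)$ and $\lambda(a,m)=(a,0,0,m)$, and sends $g$ to $\mathrm{id}_A\times g$. *)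

theory Defs
  imports "HOL-Algebra.Module" "HOL-Library.FuncSet" "HOL-Library.Infinite_Typeclass"
begin

section \<open>Categories, functors and equivalences\<close>

record ('o, 'a) category =
  Obj :: "'o set"
  Arr :: "'a set"
  Dom :: "'a \<Rightarrow> 'o"
  Cod :: "'a \<Rightarrow> 'o"
  Id :: "'o \<Rightarrow> 'a"
  Comp :: "'a \<Rightarrow> 'a \<Rightarrow> 'a"  (infixl \<open>\<bullet>\<index>\<close> 70)

definition hom_set :: "('o, 'a, 'z) category_scheme \<Rightarrow> 'o \<Rightarrow> 'o \<Rightarrow> 'a set" where
  "hom_set C X Y = {f \<in> Arr C. Dom C f = X \<and> Cod C f = Y}"

locale category =
  fixes C :: "('o, 'a, 'z) category_scheme" (structure)
  assumes Dom_Obj: "f \<in> Arr C \<Longrightarrow> Dom C f \<in> Obj C"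
    and Cod_Obj: "f \<in> Arr C \<Longrightarrow> Cod C f \<in> Obj C"
    and Id_hom: "X \<in> Obj C \<Longrightarrow> Id C X \<in> hom_set C X X"
    and Comp_hom: "\<lbrakk>f \<in> hom_set C X Y; g \<in> hom_set C Y Z\<rbrakk> \<Longrightarrow> g \<bullet> f \<in> hom_set C X Z"
    and Comp_Id: "f \<in> hom_set C X Y \<Longrightarrow> f \<bullet> Id C X = f"
    and Id_Comp: "f \<in> hom_set C X Y \<Longrightarrow> Id C Y \<bullet> f = f"
    and Comp_assoc: "\<lbrakk>f \<in> hom_set C W X; g \<in> hom_set C X Y; h \<in> hom_set C Y Z\<rbrakk>
      \<Longrightarrow> h \<bullet> (g \<bullet> f) = h \<bullet> g \<bullet> f"

locale cat_functor = C: category C + D: category D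
  for C :: "('o, 'a, 'z) category_scheme" and D :: "('p, 'b, 'y) category_scheme" +
  fixes Fo :: "'o \<Rightarrow> 'p" and Fa :: "'a \<Rightarrow> 'b"
  assumes Fo_Obj: "X \<in> Obj C \<Longrightarrow> Fo X \<in> Obj D"
    and Fa_hom: "f \<in> hom_set C X Y \<Longrightarrow> Fa f \<in> hom_set D (Fo X) (Fo Y)"
    and Fa_Id: "X \<in> Obj C \<Longrightarrow> Fa (Id C X) = Id D (Fo X)"
    and Fa_Comp: "\<lbrakk>f \<in> hom_set C X Y; g \<in> hom_set C Y Z\<rbrakk>
      \<Longrightarrow> Fa (g \<bullet>\<^bsub>C\<^esub> f) = Fa g \<bullet>\<^bsub>D\<^esub> Fa f"

definition is_iso :: "('o, 'a, 'z) category_scheme \<Rightarrow> 'a \<Rightarrow> bool" where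
  "is_iso C f \<longleftrightarrow> f \<in> Arr C \<and> (\<exists>g \<in> hom_set C (Cod C f) (Dom C f).
     g \<bullet>\<^bsub>C\<^esub> f = Id C (Dom C f) \<and> f \<bullet>\<^bsub>C\<^esub> g = Id C (Cod C f))"

definition natural_iso ::
  "('o, 'a, 'z) category_scheme \<Rightarrow> ('p, 'b, 'y) category_scheme \<Rightarrow>
   ('o \<Rightarrow> 'p) \<Rightarrow> ('a \<Rightarrow> 'b) \<Rightarrow> ('o \<Rightarrow> 'p) \<Rightarrow> ('a \<Rightarrow> 'b) \<Rightarrow> ('o \<Rightarrow> 'b) \<Rightarrow> bool" where
  "natural_iso C D Fo Fa Go Ga \<eta> \<longleftrightarrow>
     (\<forall>X \<in> Obj C. \<eta> X \<in> hom_set D (Fo X) (Go X) \<and> is_iso D (\<eta> X)) \<and>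
     (\<forall>f \<in> Arr C. \<eta> (Cod C f) \<bullet>\<^bsub>D\<^esub> Fa f = Ga f \<bullet>\<^bsub>D\<^esub> \<eta> (Dom C f))"

locale equivalence_of_categories =
  F: cat_functor C D Fo Fa + G: cat_functor D C Go Ga
  for C :: "('o, 'a, 'z) category_scheme" and D :: "('p, 'b, 'y) category_scheme"
    and Fo :: "'o \<Rightarrow> 'p" and Fa :: "'a \<Rightarrow> 'b" and Go :: "'p \<Rightarrow> 'o" and Ga :: "'b \<Rightarrow> 'a" +
  assumes unit_iso: "\<exists>\<eta>. natural_iso C C id id (Go \<circ> Fo) (Ga \<circ> Fa) \<eta>"
    and counit_iso: "\<exists>\<epsilon>. natural_iso D D (Fo \<circ> Go) (Fa \<circ> Ga) id id \<epsilon>"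

text \<open>The square with sides \<open>h : P \<rightarrow> X\<close>, \<open>k : P \<rightarrow> Y\<close> over \<open>f : X \<rightarrow> Z\<close>, \<open>g : Y \<rightarrow> Z\<close>
  is a pullback.\<close>

definition is_pullback ::
  "('o, 'a, 'z) category_scheme \<Rightarrow> 'a \<Rightarrow> 'a \<Rightarrow> 'a \<Rightarrow> 'a \<Rightarrow> bool" where
  "is_pullback C f g h k \<longleftrightarrow>
     f \<in> Arr C \<and> g \<in> Arr C \<and> Cod C f = Cod C g \<and>
     h \<in> hom_set C (Dom C h) (Dom C f) \<and> k \<in> hom_set C (Dom C h) (Dom C g) \<and>
     f \<bullet>\<^bsub>C\<^esub> h = g \<bullet>\<^bsub>C\<^esub> k \<and>
     (\<forall>W \<in> Obj C. \<forall>u \<in> hom_set C W (Dom C f). \<forall>v \<in> hom_set C W (Dom C g).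
        f \<bullet>\<^bsub>C\<^esub> u = g \<bullet>\<^bsub>C\<^esub> v \<longrightarrow>
        (\<exists>!w. w \<in> hom_set C W (Dom C h) \<and> h \<bullet>\<^bsub>C\<^esub> w = u \<and> k \<bullet>\<^bsub>C\<^esub> w = v))"

text \<open>The arrow \<open>\<langle>u, v\<rangle>\<close> into a pullback with projections \<open>h\<close>, \<open>k\<close>.\<close>

definition pairing ::
  "('o, 'a, 'z) category_scheme \<Rightarrow> 'a \<Rightarrow> 'a \<Rightarrow> 'a \<Rightarrow> 'a \<Rightarrow> 'a" where
  "pairing C h k u v =
     (THE w. w \<in> hom_set C (Dom C u) (Dom C h) \<and> h \<bullet>\<^bsub>C\<^esub> w = u \<and> k \<bullet>\<^bsub>C\<^esub> w = v)"

text \<open>The \<open>n\<close>-fold pullback of \<open>q : E \<rightarrow> A\<close>, with leg \<open>r\<close> to \<open>A\<close> and projections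
  \<open>\<pi> 0, \<dots>, \<pi> (n - 1)\<close> to \<open>E\<close>.\<close>

definition is_fold_pullback ::
  "('o, 'a, 'z) category_scheme \<Rightarrow> nat \<Rightarrow> 'a \<Rightarrow> 'a \<Rightarrow> (nat \<Rightarrow> 'a) \<Rightarrow> bool" where
  "is_fold_pullback C n q r \<pi> \<longleftrightarrow>
     q \<in> Arr C \<and> r \<in> hom_set C (Dom C r) (Cod C q) \<and>
     (\<forall>i<n. \<pi> i \<in> hom_set C (Dom C r) (Dom C q) \<and> q \<bullet>\<^bsub>C\<^esub> \<pi> i = r) \<and>
     (\<forall>W \<in> Obj C. \<forall>s \<in> hom_set C W (Cod C q). \<forall>u.
        (\<forall>i<n. u i \<in> hom_set C W (Dom C q) \<and> q \<bullet>\<^bsub>C\<^esub> u i = s) \<longrightarrow>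
        (\<exists>!w. w \<in> hom_set C W (Dom C r) \<and> r \<bullet>\<^bsub>C\<^esub> w = s \<and> (\<forall>i<n. \<pi> i \<bullet>\<^bsub>C\<^esub> w = u i)))"


section \<open>Tangent structures and differential bundles\<close>

text \<open>\<open>T2_fst\<close> and \<open>T2_snd\<close> are the projections \<open>T\<^sub>2 A \<rightarrow> T A\<close> of the pullback of \<open>p\<^sub>A\<close>
  along itself; \<open>T\<^sub>2 A\<close> is their domain.\<close>

record ('o, 'a) tangent_category = "('o, 'a) category" +
  T_obj :: "'o \<Rightarrow> 'o"
  T_arr :: "'a \<Rightarrow> 'a"
  tan_p :: "'o \<Rightarrow> 'a"
  T2_fst :: "'o \<Rightarrow> 'a"
  T2_snd :: "'o \<Rightarrow> 'a"
  tan_s :: "'o \<Rightarrow> 'a"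
  tan_z :: "'o \<Rightarrow> 'a"
  tan_l :: "'o \<Rightarrow> 'a"
  tan_c :: "'o \<Rightarrow> 'a"
  tan_n :: "'o \<Rightarrow> 'a"

text \<open>A bundle carries its pullback \<open>E\<^sub>2\<close>, through the projections \<open>\<pi>\<^sub>1, \<pi>\<^sub>2 : E\<^sub>2 \<rightarrow> E\<close>,
  as part of the data, since it is the domain of \<open>\<sigma>\<close>; morphisms of bundles do not
  refer to it.\<close>

record 'a bundle_data =
  bun_q :: 'a
  bun_fst :: 'a
  bun_snd :: 'a
  bun_sigma :: 'a
  bun_zeta :: 'a
  bun_lambda :: 'a

locale differential_bundle =
  fixes X :: "('o, 'a) tangent_category" (structure)
    and A :: 'o
    and q \<pi>\<^sub>1 \<pi>\<^sub>2 \<sigma> \<zeta> lam :: 'a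
  assumes base: "A \<in> Obj X"
    and q_hom: "q \<in> hom_set X (Dom X q) A"
    and E2_pullback: "is_pullback X q q \<pi>\<^sub>1 \<pi>\<^sub>2"
    and sigma_hom: "\<sigma> \<in> hom_set X (Dom X \<pi>\<^sub>1) (Dom X q)"
    and zeta_hom: "\<zeta> \<in> hom_set X A (Dom X q)"
    and lambda_hom: "lam \<in> hom_set X (Dom X q) (T_obj X (Dom X q))"
    and fold_pullbacks: "\<And>n. \<exists>r \<pi>. is_fold_pullback X n q r \<pi> \<and>
      (\<forall>m. is_fold_pullback X n ((T_arr X ^^ m) q) ((T_arr X ^^ m) r) (\<lambda>i. (T_arr X ^^ m) (\<pi> i)))"
    and sigma_over: "q \<bullet> \<sigma> = q \<bullet> \<pi>\<^sub>1"
    and zeta_over: "q \<bullet> \<zeta> = Id X A"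
    and sigma_assoc: "\<And>r \<pi>. is_fold_pullback X 3 q r \<pi> \<Longrightarrow>
      \<sigma> \<bullet> pairing X \<pi>\<^sub>1 \<pi>\<^sub>2 (\<sigma> \<bullet> pairing X \<pi>\<^sub>1 \<pi>\<^sub>2 (\<pi> 0) (\<pi> 1)) (\<pi> 2) =
      \<sigma> \<bullet> pairing X \<pi>\<^sub>1 \<pi>\<^sub>2 (\<pi> 0) (\<sigma> \<bullet> pairing X \<pi>\<^sub>1 \<pi>\<^sub>2 (\<pi> 1) (\<pi> 2))"
    and sigma_unit_left: "\<sigma> \<bullet> pairing X \<pi>\<^sub>1 \<pi>\<^sub>2 (\<zeta> \<bullet> q) (Id X (Dom X q)) = Id X (Dom X q)"
    and sigma_unit_right: "\<sigma> \<bullet> pairing X \<pi>\<^sub>1 \<pi>\<^sub>2 (Id X (Dom X q)) (\<zeta> \<bullet> q) = Id X (Dom X q)"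
    and sigma_comm: "\<sigma> \<bullet> pairing X \<pi>\<^sub>1 \<pi>\<^sub>2 \<pi>\<^sub>2 \<pi>\<^sub>1 = \<sigma>"
    and T_q_lambda: "T_arr X q \<bullet> lam = tan_z X A \<bullet> q"
    and lambda_sigma_T: "lam \<bullet> \<sigma> =
      T_arr X \<sigma> \<bullet> pairing X (T_arr X \<pi>\<^sub>1) (T_arr X \<pi>\<^sub>2) (lam \<bullet> \<pi>\<^sub>1) (lam \<bullet> \<pi>\<^sub>2)"
    and lambda_zeta_T: "lam \<bullet> \<zeta> = T_arr X \<zeta> \<bullet> tan_z X A"
    and p_lambda: "tan_p X (Dom X q) \<bullet> lam = \<zeta> \<bullet> q"
    and lambda_sigma_s: "lam \<bullet> \<sigma> = tan_s X (Dom X q) \<bullet>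
      pairing X (T2_fst X (Dom X q)) (T2_snd X (Dom X q)) (lam \<bullet> \<pi>\<^sub>1) (lam \<bullet> \<pi>\<^sub>2)"
    and lambda_zeta_z: "lam \<bullet> \<zeta> = tan_z X (Dom X q) \<bullet> \<zeta>"
    and l_lambda: "tan_l X (Dom X q) \<bullet> lam = T_arr X lam \<bullet> lam"
    \<comment> \<open>universality of the lift; \<open>m = 0\<close> is the pullback itself\<close>
    and lift_universal: "\<And>m. is_pullback X
      ((T_arr X ^^ m) (T_arr X q)) ((T_arr X ^^ m) (tan_z X A))
      ((T_arr X ^^ m) (T_arr X \<sigma> \<bullet>
         pairing X (T_arr X \<pi>\<^sub>1) (T_arr X \<pi>\<^sub>2) (lam \<bullet> \<pi>\<^sub>1) (tan_z X (Dom X q) \<bullet> \<pi>\<^sub>2)))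
      ((T_arr X ^^ m) (q \<bullet> \<pi>\<^sub>1))"

datatype ('o, 'm) arrow = Arrow (src: 'o) (mor: 'm) (tgt: 'o)

definition DBun ::
  "('o, 'a) tangent_category \<Rightarrow> 'o \<Rightarrow> ('a bundle_data, ('a bundle_data, 'a) arrow) category" where
  "DBun X A = (let
      bundles = {B. differential_bundle X A (bun_q B) (bun_fst B) (bun_snd B)
                      (bun_sigma B) (bun_zeta B) (bun_lambda B)}
    in \<lparr> Obj = bundles,
      Arr = {Arrow B f B' | B f B'. B \<in> bundles \<and> B' \<in> bundles \<and>
        f \<in> hom_set X (Dom X (bun_q B)) (Dom X (bun_q B')) \<and>
        bun_q B' \<bullet>\<^bsub>X\<^esub> f = bun_q B \<and>
        T_arr X f \<bullet>\<^bsub>X\<^esub> bun_lambda B = bun_lambda B' \<bullet>\<^bsub>X\<^esub> f},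
      Dom = src, Cod = tgt,
      Id = (\<lambda>B. Arrow B (Id X (Dom X (bun_q B))) B),
      Comp = (\<lambda>g f. Arrow (src f) (mor g \<bullet>\<^bsub>X\<^esub> mor f) (tgt g)) \<rparr>)"


section \<open>Non-unital algebras, their modules, and divided power algebras\<close>

text \<open>A structure of type \<open>module\<close> inherits a field \<open>one\<close> from the ring record. The
  algebras here are non-unital, and this field is never referred to. In particular
  the library's \<open>[^]\<close> cannot be used for powers. In records of modules both \<open>mult\<close>
  and \<open>one\<close> are unused.\<close>

locale nonunital_comm_algebra = Module.module F A
  for F :: "'f ring" and A :: "('f, 'u, 'z) module_scheme" (structure) +
  assumes mult_closed: "\<lbrakk>x \<in> carrier A; y \<in> carrier A\<rbrakk> \<Longrightarrow> x \<otimes> y \<in> carrier A"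
    and mult_assoc: "\<lbrakk>x \<in> carrier A; y \<in> carrier A; z \<in> carrier A\<rbrakk>
      \<Longrightarrow> (x \<otimes> y) \<otimes> z = x \<otimes> (y \<otimes> z)"
    and mult_comm: "\<lbrakk>x \<in> carrier A; y \<in> carrier A\<rbrakk> \<Longrightarrow> x \<otimes> y = y \<otimes> x"
    and mult_distrib: "\<lbrakk>x \<in> carrier A; y \<in> carrier A; z \<in> carrier A\<rbrakk>
      \<Longrightarrow> (x \<oplus> y) \<otimes> z = x \<otimes> z \<oplus> y \<otimes> z"
    and mult_smult: "\<lbrakk>c \<in> carrier F; x \<in> carrier A; y \<in> carrier A\<rbrakk>
      \<Longrightarrow> (c \<odot> x) \<otimes> y = c \<odot> (x \<otimes> y)"

text \<open>The power \<open>a\<^sup>n = a * \<dots> * a\<close>, meaningful for \<open>n \<ge> 1\<close> only.\<close>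

definition nu_pow :: "('f, 'u, 'z) module_scheme \<Rightarrow> 'u \<Rightarrow> nat \<Rightarrow> 'u" where
  "nu_pow A a n = ((\<lambda>x. x \<otimes>\<^bsub>A\<^esub> a) ^^ (n - 1)) a"

record ('f, 'u) act_module = "('f, 'u) module" +
  act :: "'u \<Rightarrow> 'u \<Rightarrow> 'u"

locale nonunital_module = Module.module F M
  for F :: "'f ring" and A :: "('f, 'u) module" and M :: "('f, 'u) act_module" (structure) +
  assumes act_closed: "\<lbrakk>a \<in> carrier A; x \<in> carrier M\<rbrakk> \<Longrightarrow> act M a x \<in> carrier M"
    and act_add_left: "\<lbrakk>a \<in> carrier A; b \<in> carrier A; x \<in> carrier M\<rbrakk>
      \<Longrightarrow> act M (a \<oplus>\<^bsub>A\<^esub> b) x = act M a x \<oplus> act M b x"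
    and act_add_right: "\<lbrakk>a \<in> carrier A; x \<in> carrier M; y \<in> carrier M\<rbrakk>
      \<Longrightarrow> act M a (x \<oplus> y) = act M a x \<oplus> act M a y"
    and act_smult_left: "\<lbrakk>c \<in> carrier F; a \<in> carrier A; x \<in> carrier M\<rbrakk>
      \<Longrightarrow> act M (c \<odot>\<^bsub>A\<^esub> a) x = c \<odot> act M a x"
    and act_smult_right: "\<lbrakk>c \<in> carrier F; a \<in> carrier A; x \<in> carrier M\<rbrakk>
      \<Longrightarrow> act M a (c \<odot> x) = c \<odot> act M a x"
    and act_mult: "\<lbrakk>a \<in> carrier A; b \<in> carrier A; x \<in> carrier M\<rbrakk>
      \<Longrightarrow> act M (a \<otimes>\<^bsub>A\<^esub> b) x = act M a (act M b x)"

record ('f, 'u) dp_algebra = "('f, 'u) module" +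
  dpow :: "nat \<Rightarrow> 'u \<Rightarrow> 'u"

text \<open>Values of \<open>dpow A n\<close> for \<open>n = 0\<close> or outside the carrier are irrelevant.\<close>

locale divided_power_algebra = nonunital_comm_algebra F A
  for F :: "'f ring" and A :: "('f, 'u) dp_algebra" (structure) +
  assumes dpow_closed: "\<lbrakk>1 \<le> n; a \<in> carrier A\<rbrakk> \<Longrightarrow> dpow A n a \<in> carrier A"
    and dpow_smult: "\<lbrakk>1 \<le> n; c \<in> carrier F; a \<in> carrier A\<rbrakk>
      \<Longrightarrow> dpow A n (c \<odot> a) = (c [^]\<^bsub>F\<^esub> n) \<odot> dpow A n a"
    and dpow_mult_dpow: "\<lbrakk>1 \<le> m; 1 \<le> n; a \<in> carrier A\<rbrakk>
      \<Longrightarrow> dpow A m a \<otimes> dpow A n a = [((m + n) choose m)] \<cdot> dpow A (m + n) a"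
    and dpow_add: "\<lbrakk>1 \<le> n; a \<in> carrier A; b \<in> carrier A\<rbrakk>
      \<Longrightarrow> dpow A n (a \<oplus> b) =
        dpow A n a \<oplus> (\<Oplus>l\<in>{1..n-1}. dpow A l a \<otimes> dpow A (n - l) b) \<oplus> dpow A n b"
    and dpow_1: "a \<in> carrier A \<Longrightarrow> dpow A 1 a = a"
    and dpow_mult_fact: "\<lbrakk>1 \<le> n; a \<in> carrier A; b \<in> carrier A\<rbrakk>
      \<Longrightarrow> dpow A n (a \<otimes> b) = [(fact n :: nat)] \<cdot> (dpow A n a \<otimes> dpow A n b)"
    and dpow_mult_left: "\<lbrakk>1 \<le> n; a \<in> carrier A; b \<in> carrier A\<rbrakk>
      \<Longrightarrow> dpow A n (a \<otimes> b) = nu_pow A a n \<otimes> dpow A n b"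
    and dpow_mult_right: "\<lbrakk>1 \<le> n; a \<in> carrier A; b \<in> carrier A\<rbrakk>
      \<Longrightarrow> dpow A n (a \<otimes> b) = dpow A n a \<otimes> nu_pow A b n"
    and dpow_dpow: "\<lbrakk>1 \<le> m; 1 \<le> n; a \<in> carrier A\<rbrakk>
      \<Longrightarrow> dpow A m (dpow A n a) =
        [(fact (m * n) div (fact m * fact n ^ m) :: nat)] \<cdot> dpow A (m * n) a"

definition is_characteristic :: "'f ring \<Rightarrow> nat \<Rightarrow> bool" where
  "is_characteristic F p \<longleftrightarrow> (\<forall>k::nat. [k] \<cdot>\<^bsub>F\<^esub> \<one>\<^bsub>F\<^esub> = \<zero>\<^bsub>F\<^esub> \<longleftrightarrow> p dvd k)"


section \<open>The categories of divided power algebras and of modules\<close>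

text \<open>All structures have carriers contained in one infinite type \<open>'u\<close>, which plays the
  role of the universe. Arrows are structure-preserving maps, extensional outside the
  carrier of the source.\<close>

definition concrete_category ::
  "'o set \<Rightarrow> ('o \<Rightarrow> 'u set) \<Rightarrow> ('o \<Rightarrow> 'o \<Rightarrow> ('u \<Rightarrow> 'u) \<Rightarrow> bool) \<Rightarrow>
   ('o, ('o, 'u \<Rightarrow> 'u) arrow) category" where
  "concrete_category Ob U H = \<lparr>
     Obj = Ob,
     Arr = {Arrow A f B | A f B. A \<in> Ob \<and> B \<in> Ob \<and> f \<in> U A \<rightarrow>\<^sub>E U B \<and> H A B f},
     Dom = src, Cod = tgt,
     Id = (\<lambda>A. Arrow A (\<lambda>x\<in>U A. x) A),
     Comp = (\<lambda>g f. Arrow (src f) (compose (U (src f)) (mor g) (mor f)) (tgt g)) \<rparr>"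

definition linear_hom ::
  "'f ring \<Rightarrow> ('f, 'u, 'z) module_scheme \<Rightarrow> ('f, 'u, 'z) module_scheme \<Rightarrow> ('u \<Rightarrow> 'u) \<Rightarrow> bool" where
  "linear_hom F A B f \<longleftrightarrow>
     (\<forall>x\<in>carrier A. \<forall>y\<in>carrier A. f (x \<oplus>\<^bsub>A\<^esub> y) = f x \<oplus>\<^bsub>B\<^esub> f y) \<and>
     (\<forall>c\<in>carrier F. \<forall>x\<in>carrier A. f (c \<odot>\<^bsub>A\<^esub> x) = c \<odot>\<^bsub>B\<^esub> f x)"

definition dp_hom ::
  "'f ring \<Rightarrow> ('f, 'u) dp_algebra \<Rightarrow> ('f, 'u) dp_algebra \<Rightarrow> ('u \<Rightarrow> 'u) \<Rightarrow> bool" where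
  "dp_hom F A B f \<longleftrightarrow> linear_hom F A B f \<and>
     (\<forall>x\<in>carrier A. \<forall>y\<in>carrier A. f (x \<otimes>\<^bsub>A\<^esub> y) = f x \<otimes>\<^bsub>B\<^esub> f y) \<and>
     (\<forall>n\<ge>1. \<forall>x\<in>carrier A. f (dpow A n x) = dpow B n (f x))"

definition Gamma_alg ::
  "'f ring \<Rightarrow> (('f, 'u) dp_algebra, (('f, 'u) dp_algebra, 'u \<Rightarrow> 'u) arrow) category" where
  "Gamma_alg F = concrete_category {A. divided_power_algebra F A} carrier (dp_hom F)"

definition underlying :: "('f, 'u) dp_algebra \<Rightarrow> ('f, 'u) module" where
  "underlying A = Module.module.truncate A"

definition Mod_cat ::
  "'f ring \<Rightarrow> ('f, 'u) module \<Rightarrow>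
   (('f, 'u) act_module, (('f, 'u) act_module, 'u \<Rightarrow> 'u) arrow) category" where
  "Mod_cat F A = concrete_category {M. nonunital_module F A M} carrier
     (\<lambda>M N f. linear_hom F M N f \<and>
        (\<forall>a\<in>carrier A. \<forall>x\<in>carrier M. f (act M a x) = act N a (f x)))"


section \<open>Semidirect products and the algebraic tangent structure\<close>

text \<open>Ordered pairs inside the universe: an arbitrary injection of \<open>'u \<times> 'u\<close> into the
  infinite type \<open>'u\<close>.\<close>

definition upair :: "'u::infinite \<Rightarrow> 'u \<Rightarrow> 'u" where
  "upair = curry (SOME f. inj f)"

lemma inj_upair: "inj (case_prod (upair :: 'u::infinite \<Rightarrow> 'u \<Rightarrow> 'u))"
proof -
  include cardinal_syntax
  have "|UNIV \<times> UNIV :: ('u \<times> 'u) set| =o |UNIV :: 'u set|"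
    by (rule card_of_Times_same_infinite) (rule infinite_UNIV)
  then obtain f :: "'u \<times> 'u \<Rightarrow> 'u" where "bij_betw f (UNIV \<times> UNIV) UNIV"
    using card_of_ordIso by blast
  then have "inj f" by (simp add: bij_betw_def)
  then show ?thesis
    unfolding upair_def by (simp add: someI[of inj f])
qed

definition ufst :: "'u::infinite \<Rightarrow> 'u" where
  "ufst x = fst (inv_into UNIV (case_prod upair) x)"

definition usnd :: "'u::infinite \<Rightarrow> 'u" where
  "usnd x = snd (inv_into UNIV (case_prod upair) x)"

lemma ufst_upair [simp]: "ufst (upair a b) = a"
  using inv_f_f[OF inj_upair, of "(a, b)"] by (simp add: ufst_def)

lemma usnd_upair [simp]: "usnd (upair a b) = b"
  using inv_f_f[OF inj_upair, of "(a, b)"] by (simp add: usnd_def)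

definition ltimes_with ::
  "('f, 'u::infinite) dp_algebra \<Rightarrow> ('f, 'u) act_module \<Rightarrow> (nat \<Rightarrow> 'u \<Rightarrow> 'u) \<Rightarrow> ('f, 'u) dp_algebra"
  where
  "ltimes_with A M d = \<lparr>
     carrier = {upair a m | a m. a \<in> carrier A \<and> m \<in> carrier M},
     monoid.mult = (\<lambda>x y. upair (ufst x \<otimes>\<^bsub>A\<^esub> ufst y)
        (act M (ufst x) (usnd y) \<oplus>\<^bsub>M\<^esub> act M (ufst y) (usnd x))),
     one = undefined,
     zero = upair \<zero>\<^bsub>A\<^esub> \<zero>\<^bsub>M\<^esub>,
     add = (\<lambda>x y. upair (ufst x \<oplus>\<^bsub>A\<^esub> ufst y) (usnd x \<oplus>\<^bsub>M\<^esub> usnd y)),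
     smult = (\<lambda>c x. upair (c \<odot>\<^bsub>A\<^esub> ufst x) (c \<odot>\<^bsub>M\<^esub> usnd x)),
     dpow = d \<rparr>"

text \<open>In characteristic \<open>p\<close> a divided power structure is determined by its \<open>p\<close>-th operation,
  so the choice below is unique on the carrier and for exponents at least 1.\<close>

definition ltimes ::
  "'f ring \<Rightarrow> nat \<Rightarrow> ('f, 'u::infinite) dp_algebra \<Rightarrow> ('f, 'u) act_module \<Rightarrow> ('f, 'u) dp_algebra"
  where
  "ltimes F p A M = ltimes_with A M (SOME d.
     divided_power_algebra F (ltimes_with A M d) \<and>
     (\<forall>a\<in>carrier A. \<forall>m\<in>carrier M.
        d p (upair a m) = upair (dpow A p a) (\<ominus>\<^bsub>M\<^esub> act M (nu_pow A a (p - 1)) m)))"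

definition self_module :: "('f, 'u) dp_algebra \<Rightarrow> ('f, 'u) act_module" where
  "self_module A = Module.module.extend (underlying A) (act_module.fields (\<lambda>a b. a \<otimes>\<^bsub>A\<^esub> b))"

definition fun_arrow ::
  "('f, 'u) dp_algebra \<Rightarrow> ('u \<Rightarrow> 'u) \<Rightarrow> ('f, 'u) dp_algebra \<Rightarrow> (('f, 'u) dp_algebra, 'u \<Rightarrow> 'u) arrow"
  where
  "fun_arrow A f B = Arrow A (restrict f (carrier A)) B"

definition fibre_product ::
  "(('f, 'u::infinite) dp_algebra, 'u \<Rightarrow> 'u) arrow \<Rightarrow> (('f, 'u) dp_algebra, 'u \<Rightarrow> 'u) arrow \<Rightarrow>
   ('f, 'u) dp_algebra" where
  "fibre_product f g = (let B = src f; C = src g in \<lparr>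
     carrier = {upair b c | b c. b \<in> carrier B \<and> c \<in> carrier C \<and> mor f b = mor g c},
     monoid.mult = (\<lambda>x y. upair (ufst x \<otimes>\<^bsub>B\<^esub> ufst y) (usnd x \<otimes>\<^bsub>C\<^esub> usnd y)),
     one = undefined,
     zero = upair \<zero>\<^bsub>B\<^esub> \<zero>\<^bsub>C\<^esub>,
     add = (\<lambda>x y. upair (ufst x \<oplus>\<^bsub>B\<^esub> ufst y) (usnd x \<oplus>\<^bsub>C\<^esub> usnd y)),
     smult = (\<lambda>c x. upair (c \<odot>\<^bsub>B\<^esub> ufst x) (c \<odot>\<^bsub>C\<^esub> usnd x)),
     dpow = (\<lambda>n x. upair (dpow B n (ufst x)) (dpow C n (usnd x))) \<rparr>)"

definition T_alg ::
  "'f ring \<Rightarrow> nat \<Rightarrow> ('f, 'u::infinite) dp_algebra \<Rightarrow> ('f, 'u) dp_algebra" where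
  "T_alg F p A = ltimes F p A (self_module A)"

definition T_hom ::
  "'f ring \<Rightarrow> nat \<Rightarrow> (('f, 'u::infinite) dp_algebra, 'u \<Rightarrow> 'u) arrow \<Rightarrow>
   (('f, 'u) dp_algebra, 'u \<Rightarrow> 'u) arrow" where
  "T_hom F p f = fun_arrow (T_alg F p (src f))
     (\<lambda>x. upair (mor f (ufst x)) (mor f (usnd x))) (T_alg F p (tgt f))"

definition p_alg ::
  "'f ring \<Rightarrow> nat \<Rightarrow> ('f, 'u::infinite) dp_algebra \<Rightarrow> (('f, 'u) dp_algebra, 'u \<Rightarrow> 'u) arrow" where
  "p_alg F p A = fun_arrow (T_alg F p A) ufst A"

definition T2_alg ::
  "'f ring \<Rightarrow> nat \<Rightarrow> ('f, 'u::infinite) dp_algebra \<Rightarrow> ('f, 'u) dp_algebra" where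
  "T2_alg F p A = fibre_product (p_alg F p A) (p_alg F p A)"

text \<open>Elements \<open>(a, b, c)\<close> of \<open>T\<^sub>2 A\<close> are represented as \<open>((a, b), (a, c))\<close>, and
  elements \<open>(a, b, c, d)\<close> of \<open>T\<^sup>2 A\<close> as \<open>((a, b), (c, d))\<close>.\<close>

definition algebraic_tangent ::
  "'f ring \<Rightarrow> nat \<Rightarrow>
   (('f, 'u::infinite) dp_algebra, (('f, 'u) dp_algebra, 'u \<Rightarrow> 'u) arrow) tangent_category" where
  "algebraic_tangent F p = (let C = Gamma_alg F; T = T_alg F p in \<lparr>
     Obj = Obj C, Arr = Arr C, Dom = Dom C, Cod = Cod C, Id = Id C, Comp = Comp C,
     T_obj = T,
     T_arr = T_hom F p,
     tan_p = p_alg F p,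
     T2_fst = (\<lambda>A. fun_arrow (T2_alg F p A) ufst (T A)),
     T2_snd = (\<lambda>A. fun_arrow (T2_alg F p A) usnd (T A)),
     tan_s = (\<lambda>A. fun_arrow (T2_alg F p A)
        (\<lambda>x. upair (ufst (ufst x)) (usnd (ufst x) \<oplus>\<^bsub>A\<^esub> usnd (usnd x))) (T A)),
     tan_z = (\<lambda>A. fun_arrow A (\<lambda>a. upair a \<zero>\<^bsub>A\<^esub>) (T A)),
     tan_l = (\<lambda>A. fun_arrow (T A)
        (\<lambda>x. upair (upair (ufst x) \<zero>\<^bsub>A\<^esub>) (upair \<zero>\<^bsub>A\<^esub> (usnd x))) (T (T A))),
     tan_c = (\<lambda>A. fun_arrow (T (T A))
        (\<lambda>x. upair (upair (ufst (ufst x)) (ufst (usnd x)))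
                   (upair (usnd (ufst x)) (usnd (usnd x)))) (T (T A))),
     tan_n = (\<lambda>A. fun_arrow (T A) (\<lambda>x. upair (ufst x) (\<ominus>\<^bsub>A\<^esub> usnd x)) (T A)) \<rparr>)"


section \<open>The two functors\<close>

type_synonym ('f, 'u) dp_arrow = "(('f, 'u) dp_algebra, 'u \<Rightarrow> 'u) arrow"
type_synonym ('f, 'u) dp_bundle = "('f, 'u) dp_arrow bundle_data"

definition ker_obj :: "('f, 'u) dp_bundle \<Rightarrow> ('f, 'u) act_module" where
  "ker_obj B = (let q = bun_q B; E = src q in
     Module.module.extend
       ((underlying E) \<lparr>carrier := {e \<in> carrier E. mor q e = \<zero>\<^bsub>tgt q\<^esub>}\<rparr>)
       (act_module.fields (\<lambda>a e. mor (bun_zeta B) a \<otimes>\<^bsub>E\<^esub> e)))"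

definition ker_arr ::
  "(('f, 'u) dp_bundle, ('f, 'u) dp_arrow) arrow \<Rightarrow> (('f, 'u) act_module, 'u \<Rightarrow> 'u) arrow" where
  "ker_arr f = Arrow (ker_obj (src f))
     (restrict (mor (mor f)) (carrier (ker_obj (src f)))) (ker_obj (tgt f))"

definition ltimes_obj ::
  "'f ring \<Rightarrow> nat \<Rightarrow> ('f, 'u::infinite) dp_algebra \<Rightarrow> ('f, 'u) act_module \<Rightarrow> ('f, 'u) dp_bundle"
  where
  "ltimes_obj F p A M = (let E = ltimes F p A M; q = fun_arrow E ufst A; E2 = fibre_product q q in
     \<lparr> bun_q = q,
       bun_fst = fun_arrow E2 ufst E,
       bun_snd = fun_arrow E2 usnd E,
       bun_sigma = fun_arrow E2
         (\<lambda>x. upair (ufst (ufst x)) (usnd (ufst x) \<oplus>\<^bsub>M\<^esub> usnd (usnd x))) E,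
       bun_zeta = fun_arrow A (\<lambda>a. upair a \<zero>\<^bsub>M\<^esub>) E,
       bun_lambda = fun_arrow E
         (\<lambda>x. upair (upair (ufst x) \<zero>\<^bsub>M\<^esub>) (upair \<zero>\<^bsub>A\<^esub> (usnd x))) (T_alg F p E) \<rparr>)"

definition ltimes_arr ::
  "'f ring \<Rightarrow> nat \<Rightarrow> ('f, 'u::infinite) dp_algebra \<Rightarrow>
   (('f, 'u) act_module, 'u \<Rightarrow> 'u) arrow \<Rightarrow> (('f, 'u) dp_bundle, ('f, 'u) dp_arrow) arrow" where
  "ltimes_arr F p A g = Arrow (ltimes_obj F p A (src g))
     (fun_arrow (ltimes F p A (src g))
        (\<lambda>x. upair (ufst x) (mor g (usnd x))) (ltimes F p A (tgt g)))
     (ltimes_obj F p A (tgt g))"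

end

theory Submission
  imports Defs "HOL-Number_Theory.Residues"
begin

text \<open>On \<open>A \<oplus> M\<close> the divided powers are \<open>(a, m)\<^sup>[\<^sup>n\<^sup>] = (a\<^sup>[\<^sup>n\<^sup>], a\<^sup>[\<^sup>n\<^sup>-\<^sup>1\<^sup>] \<cdot> m)\<close>, so all operations of
  \<open>A \<ltimes>\<^sub>p M\<close> are explicit. A square of divided power algebras is a pullback iff it is one on
  carriers, and such squares are visibly preserved by \<open>T\<close>; this makes \<open>A \<ltimes>\<^sub>p M\<close> a differential
  bundle. Conversely, let \<open>q : E \<rightarrow> A\<close> be a differential bundle and write \<open>\<lambda>(e) = (\<zeta>(q(e)), D(e))\<close>.
  The axiom \<open>l \<lambda> = T(\<lambda>) \<lambda>\<close> gives \<open>D(D(k)) = D(k)\<close> for \<open>k\<close> in the kernel of \<open>q\<close>, and universality of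
  the lift makes \<open>D\<close> injective there, so \<open>\<lambda>(\<zeta>(a) + k) = (\<zeta>(a), k)\<close>. As \<open>\<lambda>\<close> is a morphism into \<open>T E\<close>,
  products and higher divided powers of kernel elements vanish, and \<open>(a, k) \<mapsto> \<zeta>(a) + k\<close> is an
  isomorphism of bundles from \<open>A \<ltimes>\<^sub>p ker q\<close> to \<open>E\<close>.\<close>

section \<open>Divided power algebras and their modules\<close>

text \<open>Two arbitrary choices shape the proof. \<open>ltimes\<close> selects its divided powers
  by a choice operator that prescribes only the p-th operation, so the explicit formula needs a
  uniqueness theorem: in characteristic p a linear, multiplicative map that respects p-th powers
  respects all of them. The quotient (mn)!/(m! n!^m) enters through its product form, which for n =
  p is prime to p. A bundle, in turn, comes with an arbitrary pullback E_2 and with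
  \<open>pairing\<close> given by a definite description; nothing can be evaluated until abstract
  pullbacks are known to be elementwise. They are compared with the explicit fibre product, which
  exists in the same category since pairs are coded inside the universe type. Finally, arrows of
  bundles are only required to commute with q and the lift; that they respect the zero section, and
  hence are A-linear on kernels, has to be derived.\<close>

lemma underlying_simps [simp]:
  "carrier (underlying A) = carrier A" "monoid.mult (underlying A) = monoid.mult A"
  "zero (underlying A) = zero A" "add (underlying A) = add A" "smult (underlying A) = smult A"
  by (simp_all add: underlying_def Module.module.truncate_def)

text \<open>Structures such as \<open>self_module A\<close> and \<open>ker_obj B\<close> share their
  linear operations with a known module but differ from it in other record fields; the axioms are
  transported along the equality of these operations.\<close>

lemma module_cong:
  assumes "Module.module F M" "carrier N = carrier M" "zero N = zero M" "add N = add M" "smult N = smult M"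
  shows "Module.module F N"
proof -
  interpret Module.module F M by fact
  have "abelian_group N"
    by (rule abelian_groupI) (use assms in \<open>auto simp: M.a_ac intro: M.l_neg\<close>)
  then show ?thesis
    by (intro moduleI R.cring_axioms)
      (use assms in \<open>auto simp: smult_l_distr smult_r_distr smult_assoc1\<close>)
qed

lemma finsum_single:
  assumes "abelian_monoid G" "finite S" "i \<in> S" "f i \<in> carrier G" "\<And>j. j \<in> S \<Longrightarrow> j \<noteq> i \<Longrightarrow> f j = \<zero>\<^bsub>G\<^esub>"
  shows "finsum G f S = f i"
proof -
  interpret abelian_monoid G by fact
  have "finsum G f S = finsum G (\<lambda>j. if i = j then f i else \<zero>\<^bsub>G\<^esub>) S"
    by (rule finsum_cong') (use assms in auto)
  then show ?thesis using finsum_singleton[OF assms(3,2), of "\<lambda>_. f i"] assms(4) by simp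
qed

text \<open>The addition axiom sums over 1..n-1 and lists its two end terms separately. Splitting
  0..n in the same way lets it be read as one convolution once index 0 has a meaning.\<close>

lemma (in abelian_monoid) finsum_split_ends:
  assumes "0 < (n::nat)" "g \<in> {0..n} \<rightarrow> carrier G"
  shows "finsum G g {0..n} = g 0 \<oplus> (g n \<oplus> finsum G g {1..n-1})"
proof -
  have "{0..n} = insert 0 (insert n {1..n-1})" using assms by auto
  moreover have "finsum G g {1..n-1} \<in> carrier G"
    using assms by (intro finsum_closed) auto
  moreover have "g i \<in> carrier G" if "i \<le> n" for i using assms that by auto
  ultimately show ?thesis using assms by (simp add: finsum_insert Pi_iff)
qed

section \<open>Arithmetic in algebras without unit\<close>

context nonunital_comm_algebra
begin

lemma mult_distrib_right:
  "\<lbrakk>x \<in> carrier A; y \<in> carrier A; z \<in> carrier A\<rbrakk> \<Longrightarrow> z \<otimes> (x \<oplus> y) = z \<otimes> x \<oplus> z \<otimes> y"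
  by (simp add: mult_comm[of z] mult_distrib)

lemma mult_smult_right:
  "\<lbrakk>c \<in> carrier F; x \<in> carrier A; y \<in> carrier A\<rbrakk> \<Longrightarrow> x \<otimes> (c \<odot> y) = c \<odot> (x \<otimes> y)"
  by (simp add: mult_comm[of x] mult_smult)

lemma zero_mult: "x \<in> carrier A \<Longrightarrow> \<zero> \<otimes> x = \<zero>"
  using mult_smult[of "\<zero>\<^bsub>F\<^esub>" \<zero> x] by (simp add: mult_closed)

lemma mult_zero: "x \<in> carrier A \<Longrightarrow> x \<otimes> \<zero> = \<zero>"
  by (simp add: mult_comm[of x] zero_mult)

lemma mult_lcomm:
  "\<lbrakk>x \<in> carrier A; y \<in> carrier A; z \<in> carrier A\<rbrakk> \<Longrightarrow> x \<otimes> (y \<otimes> z) = y \<otimes> (x \<otimes> z)"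
  by (metis mult_assoc mult_comm)

lemma add_pow_mult:
  "\<lbrakk>x \<in> carrier A; y \<in> carrier A\<rbrakk> \<Longrightarrow> ([(n::nat)] \<cdot> x) \<otimes> y = [n] \<cdot> (x \<otimes> y)"
  by (induction n) (simp_all add: zero_mult mult_distrib mult_closed)

lemma nu_pow_1: "nu_pow A a (Suc 0) = a"
  by (simp add: nu_pow_def)

lemma nu_pow_Suc: "n > 0 \<Longrightarrow> nu_pow A a (Suc n) = nu_pow A a n \<otimes> a"
  by (cases n) (simp_all add: nu_pow_def)

lemma nu_pow_closed: "a \<in> carrier A \<Longrightarrow> nu_pow A a n \<in> carrier A"
proof -
  assume a: "a \<in> carrier A"
  have "((\<lambda>x. x \<otimes> a) ^^ k) a \<in> carrier A" for k
    by (induction k) (use a in \<open>auto intro: mult_closed\<close>)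
  then show ?thesis by (simp add: nu_pow_def)
qed

end

text \<open>Turns integer multiples, in which the divided power axioms are phrased, into scalars of
  F, where the characteristic can act.\<close>

lemma (in Module.module) add_pow_eq_smult:
  "x \<in> carrier M \<Longrightarrow> [(n::nat)] \<cdot>\<^bsub>M\<^esub> x = ([n] \<cdot> \<one>) \<odot>\<^bsub>M\<^esub> x"
  by (induction n) (simp_all add: smult_l_distr)

lemma (in divided_power_algebra) dpow_zero:
  "1 \<le> n \<Longrightarrow> dpow A n \<zero> = \<zero>"
  using dpow_smult[of n "\<zero>\<^bsub>F\<^esub>" \<zero>] dpow_closed[of n \<zero>]
  by (cases n) auto

text \<open>The convention is that a^[0] acts as the identity. A non-unital algebra has no element
  a^[0], yet the module component a^[n-1] m of an n-th power requires it at n = 1.\<close>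

definition dpow_act ::
  "('f, 'u) dp_algebra \<Rightarrow> ('f, 'u) act_module \<Rightarrow> nat \<Rightarrow> 'u \<Rightarrow> 'u \<Rightarrow> 'u" where
  "dpow_act A M k a x = (if k = 0 then x else act M (dpow A k a) x)"

text \<open>The same convention for ordinary powers, used in the Leibniz formula for powers in the
  semidirect product.\<close>

definition nu_pow_act ::
  "('f, 'u) dp_algebra \<Rightarrow> ('f, 'u) act_module \<Rightarrow> nat \<Rightarrow> 'u \<Rightarrow> 'u \<Rightarrow> 'u" where
  "nu_pow_act A M k a x = (if k = 0 then x else act M (nu_pow A a k) x)"

section \<open>Modules over a divided power algebra and the action of a^[k]\<close>

locale dp_module = divided_power_algebra F A + N: nonunital_module F "underlying A" M
  for F :: "'f ring" and A :: "('f, 'u) dp_algebra" (structure) and M :: "('f, 'u) act_module"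
begin

lemmas act_closed = N.act_closed[simplified]
lemmas act_add_left = N.act_add_left[simplified]
lemmas act_add_right = N.act_add_right[simplified]
lemmas act_smult_left = N.act_smult_left[simplified]
lemmas act_smult_right = N.act_smult_right[simplified]
lemmas act_mult = N.act_mult[simplified]

lemma act_zero_left: "x \<in> carrier M \<Longrightarrow> act M \<zero> x = \<zero>\<^bsub>M\<^esub>"
  using act_smult_left[of "\<zero>\<^bsub>F\<^esub>" \<zero> x] by (simp add: act_closed)

lemma act_zero_right: "a \<in> carrier A \<Longrightarrow> act M a \<zero>\<^bsub>M\<^esub> = \<zero>\<^bsub>M\<^esub>"
  using act_smult_right[of "\<zero>\<^bsub>F\<^esub>" a "\<zero>\<^bsub>M\<^esub>"] by (simp add: act_closed)

lemma act_commute: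
  "\<lbrakk>a \<in> carrier A; b \<in> carrier A; x \<in> carrier M\<rbrakk> \<Longrightarrow> act M a (act M b x) = act M b (act M a x)"
  by (metis act_mult mult_comm)

lemma act_add_pow_left:
  "\<lbrakk>a \<in> carrier A; x \<in> carrier M\<rbrakk> \<Longrightarrow> act M ([(n::nat)] \<cdot> a) x = [n] \<cdot>\<^bsub>M\<^esub> act M a x"
  by (induction n) (simp_all add: act_zero_left act_add_left act_closed)

lemma act_add_pow_right:
  "\<lbrakk>a \<in> carrier A; x \<in> carrier M\<rbrakk> \<Longrightarrow> act M a ([(n::nat)] \<cdot>\<^bsub>M\<^esub> x) = [n] \<cdot>\<^bsub>M\<^esub> act M a x"
  by (induction n) (simp_all add: act_zero_right act_add_right act_closed)

lemma act_finsum_left: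
  "\<lbrakk>finite S; f \<in> S \<rightarrow> carrier A; x \<in> carrier M\<rbrakk>
    \<Longrightarrow> act M (finsum A f S) x = (\<Oplus>\<^bsub>M\<^esub>i\<in>S. act M (f i) x)"
proof (induction S rule: finite_induct)
  case empty then show ?case by (simp add: act_zero_left)
next
  case (insert i S)
  then have "finsum A f S \<in> carrier A" by (auto intro!: M.finsum_closed)
  then show ?case using insert
    by (simp add: Pi_iff act_add_left act_closed M.finsum_insert N.M.finsum_insert)
qed

lemma dpow_act_0: "dpow_act A M 0 a x = x"
  by (simp add: dpow_act_def)

lemma dpow_act_pos: "n > 0 \<Longrightarrow> dpow_act A M n a x = act M (dpow A n a) x"
  by (simp add: dpow_act_def)

lemma dpow_act_closed:
  "\<lbrakk>a \<in> carrier A; x \<in> carrier M\<rbrakk> \<Longrightarrow> dpow_act A M k a x \<in> carrier M"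
  by (simp add: dpow_act_def act_closed dpow_closed)

lemma dpow_act_add_right:
  "\<lbrakk>a \<in> carrier A; x \<in> carrier M; y \<in> carrier M\<rbrakk>
    \<Longrightarrow> dpow_act A M k a (x \<oplus>\<^bsub>M\<^esub> y) = dpow_act A M k a x \<oplus>\<^bsub>M\<^esub> dpow_act A M k a y"
  by (simp add: dpow_act_def act_add_right dpow_closed)

lemma dpow_act_add_pow_right:
  "\<lbrakk>a \<in> carrier A; x \<in> carrier M\<rbrakk>
    \<Longrightarrow> dpow_act A M k a ([(n::nat)] \<cdot>\<^bsub>M\<^esub> x) = [n] \<cdot>\<^bsub>M\<^esub> dpow_act A M k a x"
  by (simp add: dpow_act_def act_add_pow_right dpow_closed)

lemma dpow_act_smult:
  "\<lbrakk>c \<in> carrier F; a \<in> carrier A; x \<in> carrier M\<rbrakk>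
    \<Longrightarrow> dpow_act A M k (c \<odot> a) (c \<odot>\<^bsub>M\<^esub> x) = c [^]\<^bsub>F\<^esub> Suc k \<odot>\<^bsub>M\<^esub> dpow_act A M k a x"
  by (auto simp: dpow_act_def act_smult_right act_smult_left dpow_smult dpow_closed act_closed
      R.m_comm simp flip: N.smult_assoc1)

text \<open>The product rule for divided powers survives the convention at index 0, where the
  binomial coefficient is 1. Exponents lowered by one therefore cause no case distinctions
  later.\<close>

lemma dpow_act_dpow_act:
  "\<lbrakk>a \<in> carrier A; x \<in> carrier M\<rbrakk> \<Longrightarrow>
    dpow_act A M k a (dpow_act A M l a x) = [((k + l) choose k)] \<cdot>\<^bsub>M\<^esub> dpow_act A M (k + l) a x"
  using dpow_mult_dpow[of k l a]
  by (auto simp: dpow_act_def act_closed dpow_closed act_add_pow_left simp flip: act_mult)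

lemma act_dpow_act_commute:
  "\<lbrakk>a \<in> carrier A; b \<in> carrier A; x \<in> carrier M\<rbrakk> \<Longrightarrow>
    act M a (dpow_act A M k b x) = dpow_act A M k b (act M a x)"
  by (auto simp: dpow_act_def dpow_closed act_commute)

lemma dpow_act_commute:
  "\<lbrakk>a \<in> carrier A; b \<in> carrier A; x \<in> carrier M\<rbrakk> \<Longrightarrow>
    dpow_act A M k a (dpow_act A M l b x) = dpow_act A M l b (dpow_act A M k a x)"
  by (auto simp: dpow_act_def dpow_closed act_commute)

lemma dpow_act_act:
  assumes "a \<in> carrier A" "x \<in> carrier M"
  shows "dpow_act A M k a (act M a x) = [Suc k] \<cdot>\<^bsub>M\<^esub> dpow_act A M (Suc k) a x"
  using dpow_act_dpow_act[OF assms, of k 1] assms(1) by (simp add: dpow_act_def dpow_1[simplified])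

text \<open>With index 0 acting as the identity, the addition axiom becomes a full convolution; its
  two isolated terms are those for l = 0 and l = n.\<close>

lemma dpow_act_add_left:
  assumes "a \<in> carrier A" "b \<in> carrier A" "x \<in> carrier M"
  shows "dpow_act A M n (a \<oplus> b) x = (\<Oplus>\<^bsub>M\<^esub>l\<in>{0..n}. dpow_act A M l a (dpow_act A M (n - l) b x))"
proof (cases "n = 0")
  case True
  then show ?thesis using assms by (simp add: dpow_act_def)
next
  case False
  let ?g = "\<lambda>l. dpow_act A M l a (dpow_act A M (n - l) b x)"
  have g: "?g l \<in> carrier M" for l by (simp add: assms dpow_act_closed)
  have "(\<Oplus>\<^bsub>M\<^esub>l\<in>{0..n}. ?g l) = ?g 0 \<oplus>\<^bsub>M\<^esub> (?g n \<oplus>\<^bsub>M\<^esub> (\<Oplus>\<^bsub>M\<^esub>l\<in>{1..n-1}. ?g l))"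
    by (rule N.M.finsum_split_ends) (use False g in auto)
  also have "(\<Oplus>\<^bsub>M\<^esub>l\<in>{1..n-1}. ?g l) = (\<Oplus>\<^bsub>M\<^esub>l\<in>{1..n-1}. act M (dpow A l a \<otimes> dpow A (n - l) b) x)"
    by (rule N.M.finsum_cong')
      (use assms in \<open>auto simp: dpow_act_def act_mult dpow_closed intro!: act_closed mult_closed\<close>)
  also have "\<dots> = act M (\<Oplus>l\<in>{1..n-1}. dpow A l a \<otimes> dpow A (n - l) b) x"
    by (rule act_finsum_left[symmetric]) (use assms in \<open>auto intro!: mult_closed dpow_closed\<close>)
  finally have **: "(\<Oplus>\<^bsub>M\<^esub>l\<in>{0..n}. ?g l) = ?g 0 \<oplus>\<^bsub>M\<^esub> (?g n \<oplus>\<^bsub>M\<^esub> act M (\<Oplus>l\<in>{1..n-1}. dpow A l a \<otimes> dpow A (n - l) b) x)" .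
  have s: "(\<Oplus>l\<in>{1..n-1}. dpow A l a \<otimes> dpow A (n - l) b) \<in> carrier A"
    using assms by (auto intro!: M.finsum_closed mult_closed dpow_closed)
  show ?thesis unfolding ** using False s assms
    by (simp add: dpow_act_def dpow_add act_add_left dpow_closed act_closed N.M.a_ac)
qed

lemma nu_pow_act_closed:
  "\<lbrakk>a \<in> carrier A; x \<in> carrier M\<rbrakk> \<Longrightarrow> nu_pow_act A M k a x \<in> carrier M"
  by (simp add: nu_pow_act_def act_closed nu_pow_closed)

lemma nu_pow_act_Suc:
  "\<lbrakk>a \<in> carrier A; x \<in> carrier M\<rbrakk> \<Longrightarrow> nu_pow_act A M (Suc k) a x = nu_pow_act A M k a (act M a x)"
  by (cases "k = 0") (simp_all add: nu_pow_act_def nu_pow_1 nu_pow_Suc act_mult nu_pow_closed)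

lemma act_nu_pow_act_commute:
  "\<lbrakk>a \<in> carrier A; b \<in> carrier A; x \<in> carrier M\<rbrakk>
    \<Longrightarrow> act M a (nu_pow_act A M k b x) = nu_pow_act A M k b (act M a x)"
  by (auto simp: nu_pow_act_def nu_pow_closed act_commute)

lemma dpow_act_mult_left:
  "\<lbrakk>a \<in> carrier A; b \<in> carrier A; x \<in> carrier M\<rbrakk>
    \<Longrightarrow> dpow_act A M k (a \<otimes> b) x = nu_pow_act A M k a (dpow_act A M k b x)"
  by (auto simp: dpow_act_def nu_pow_act_def dpow_mult_left act_mult nu_pow_closed dpow_closed)

lemma dpow_act_mult_fact:
  "\<lbrakk>a \<in> carrier A; b \<in> carrier A; x \<in> carrier M\<rbrakk>
    \<Longrightarrow> dpow_act A M k (a \<otimes> b) x = [(fact k :: nat)] \<cdot>\<^bsub>M\<^esub> dpow_act A M k a (dpow_act A M k b x)"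
  by (auto simp: dpow_act_def dpow_mult_fact act_mult dpow_closed mult_closed act_add_pow_left act_closed)

end

lemma upair_inject [simp]: "upair a b = upair c d \<longleftrightarrow> a = c \<and> b = d"
  by (metis ufst_upair usnd_upair)

text \<open>The quotient (mn)!/(m! n!^m) counts partitions of mn points into m blocks of size n: the
  block of a marked point is completed by n-1 of the other points, and the factor with index i
  belongs to the stage with (i+1)n points left. The product form gives exact divisibility, a
  recursion in m, and control modulo a prime.\<close>

lemma fact_mult_eq_prod:
  assumes "n > 0"
  shows "fact (m * n) = fact m * fact n ^ m * (\<Prod>i<m. (i * n + (n - 1)) choose (n - 1) :: nat)"
proof (induction m)
  case (Suc m)
  obtain k where n: "n = Suc k" using assms by (cases n) auto
  let ?P = "\<Prod>i<m. (i * n + (n - 1)) choose (n - 1) :: nat"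
  have "fact k * fact (m * n) * ((m * n + k) choose k) = (fact (m * n + k) :: nat)"
    using binomial_fact_lemma[of k "m * n + k"] by simp
  moreover have "fact (Suc m * n) = (Suc (m * n + k) * fact (m * n + k) :: nat)"
    using fact_Suc[of "m * n + k", where 'a = nat] by (simp add: n algebra_simps del: fact_Suc)
  moreover have "Suc (m * n + k) = Suc m * n" by (simp add: n)
  ultimately have "fact (Suc m * n) = Suc m * n * (fact k * fact (m * n) * ((m * n + k) choose k))"
    by simp
  also have "\<dots> = fact (Suc m) * fact n ^ Suc m * (?P * ((m * n + (n - 1)) choose (n - 1)))"
    unfolding Suc.IH by (simp add: n algebra_simps)
  finally show ?case by simp
qed simp

lemma fact_mult_quotient:
  assumes "n > 0"
  shows "fact (m * n) div (fact m * fact n ^ m) = (\<Prod>i<m. (i * n + (n - 1)) choose (n - 1) :: nat)"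
  unfolding fact_mult_eq_prod[OF assms] by simp

section \<open>Iterated divided powers acting on a module\<close>

lemma (in dp_module) dpow_act_dpow:
  assumes "n > 0" "a \<in> carrier A" "x \<in> carrier M"
  shows "dpow_act A M k (dpow A n a) x =
    [(fact (k * n) div (fact k * fact n ^ k) :: nat)] \<cdot>\<^bsub>M\<^esub> dpow_act A M (k * n) a x"
  using assms dpow_dpow[of k n a]
  by (auto simp: dpow_act_def dpow_closed act_add_pow_left)

text \<open>This is the module component of the (k+1)-st power of (a, x)^[n]. Since kn + (n-1) =
  (k+1)n - 1, the product rule contributes exactly the next binomial factor in the product form of
  the coefficient.\<close>

lemma (in dp_module) dpow_act_dpow_dpow_act:
  assumes "n > 0" "a \<in> carrier A" "x \<in> carrier M"
  shows "dpow_act A M k (dpow A n a) (dpow_act A M (n - 1) a x) =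
    [(fact (Suc k * n) div (fact (Suc k) * fact n ^ Suc k) :: nat)] \<cdot>\<^bsub>M\<^esub> dpow_act A M (Suc k * n - 1) a x"
proof -
  have "(k * n + (n - 1)) choose (k * n) = (k * n + (n - 1)) choose (n - 1)"
    using binomial_symmetric[of "k * n" "k * n + (n - 1)"] by simp
  moreover have "Suc k * n - 1 = k * n + (n - 1)" using assms by simp
  ultimately show ?thesis
    using assms fact_mult_quotient[of n k] fact_mult_quotient[of n "Suc k"]
    by (simp add: dpow_act_dpow dpow_act_closed dpow_act_dpow_act N.M.add.nat_pow_pow mult.commute
        del: fact_Suc power_Suc mult_Suc)
qed

section \<open>Pairs\<close>

text \<open>Semidirect products and fibre products both carry the componentwise linear structure on
  a set of coded pairs. Module axioms, multiples and finite sums are settled here once for both;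
  multiplication and divided powers differ and stay outside.\<close>

locale pair_module = B: Module.module F B + C: Module.module F C
  for F :: "'f ring" and B :: "('f, 'u::infinite, 'x) module_scheme"
    and C :: "('f, 'u, 'y) module_scheme" +
  fixes P :: "('f, 'u, 'z) module_scheme" (structure)
  assumes carrier_subset: "carrier P \<subseteq> {upair b c | b c. b \<in> carrier B \<and> c \<in> carrier C}"
    and zero_eq: "\<zero> = upair \<zero>\<^bsub>B\<^esub> \<zero>\<^bsub>C\<^esub>"
    and add_eq: "\<And>x y. x \<oplus> y = upair (ufst x \<oplus>\<^bsub>B\<^esub> ufst y) (usnd x \<oplus>\<^bsub>C\<^esub> usnd y)"
    and smult_eq: "\<And>c x. c \<odot> x = upair (c \<odot>\<^bsub>B\<^esub> ufst x) (c \<odot>\<^bsub>C\<^esub> usnd x)"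
    and zero_closed: "\<zero> \<in> carrier P"
    and add_closed: "\<lbrakk>x \<in> carrier P; y \<in> carrier P\<rbrakk> \<Longrightarrow> x \<oplus> y \<in> carrier P"
    and smult_closed: "\<lbrakk>c \<in> carrier F; x \<in> carrier P\<rbrakk> \<Longrightarrow> c \<odot> x \<in> carrier P"
begin

lemma carrierD:
  assumes "x \<in> carrier P"
  shows "ufst x \<in> carrier B" "usnd x \<in> carrier C" "upair (ufst x) (usnd x) = x"
  using assms carrier_subset by auto

lemma module: "Module.module F P"
proof (intro moduleI abelian_groupI B.R.cring_axioms)
  fix x assume x: "x \<in> carrier P"
  \<comment> \<open>The inverse of x is (-1) x, which lies in the carrier by closure under
    scalars.\<close>
  show "\<exists>y\<in>carrier P. y \<oplus> x = \<zero>"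
    by (rule bexI[of _ "(\<ominus>\<^bsub>F\<^esub> \<one>\<^bsub>F\<^esub>) \<odot> x"])
      (use x smult_closed[of "\<ominus>\<^bsub>F\<^esub> \<one>\<^bsub>F\<^esub>" x] in \<open>simp_all add: smult_eq add_eq zero_eq carrierD
         B.smult_l_minus C.smult_l_minus B.M.l_neg C.M.l_neg\<close>)
qed (simp_all add: zero_closed add_closed smult_closed,
    simp_all add: add_eq zero_eq smult_eq carrierD B.M.a_ac C.M.a_ac
    B.smult_l_distr B.smult_r_distr B.smult_assoc1 C.smult_l_distr C.smult_r_distr C.smult_assoc1)

lemma add_pow_eq:
  "x \<in> carrier P \<Longrightarrow> [(n::nat)] \<cdot> x = upair ([n] \<cdot>\<^bsub>B\<^esub> ufst x) ([n] \<cdot>\<^bsub>C\<^esub> usnd x)"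
proof (induction n)
  interpret P: Module.module F P by (rule module)
  case 0 show ?case by (simp add: zero_eq)
next
  interpret P: Module.module F P by (rule module)
  case (Suc n) then show ?case by (simp add: add_eq)
qed

lemma finsum_eq:
  assumes "finite S" "f \<in> S \<rightarrow> carrier P"
  shows "finsum P f S = upair (\<Oplus>\<^bsub>B\<^esub>i\<in>S. ufst (f i)) (\<Oplus>\<^bsub>C\<^esub>i\<in>S. usnd (f i))"
proof -
  interpret P: Module.module F P by (rule module)
  show ?thesis using assms
    by (induction S rule: finite_induct) (auto simp: zero_eq add_eq Pi_iff carrierD)
qed

end

section \<open>Semidirect products\<close>

lemma ltimes_with_simps [simp]:
  "carrier (ltimes_with A M d) = {upair a m | a m. a \<in> carrier A \<and> m \<in> carrier M}"
  "x \<otimes>\<^bsub>ltimes_with A M d\<^esub> y = upair (ufst x \<otimes>\<^bsub>A\<^esub> ufst y)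
     (act M (ufst x) (usnd y) \<oplus>\<^bsub>M\<^esub> act M (ufst y) (usnd x))"
  "zero (ltimes_with A M d) = upair \<zero>\<^bsub>A\<^esub> \<zero>\<^bsub>M\<^esub>"
  "x \<oplus>\<^bsub>ltimes_with A M d\<^esub> y = upair (ufst x \<oplus>\<^bsub>A\<^esub> ufst y) (usnd x \<oplus>\<^bsub>M\<^esub> usnd y)"
  "c \<odot>\<^bsub>ltimes_with A M d\<^esub> x = upair (c \<odot>\<^bsub>A\<^esub> ufst x) (c \<odot>\<^bsub>M\<^esub> usnd x)"
  "dpow (ltimes_with A M d) = d"
  by (simp_all add: ltimes_with_def)

text \<open>The addition rule forces this formula, as \<open>(0, m)\<^sup>[\<^sup>n\<^sup>] = 0\<close> for \<open>n \<ge> 2\<close>; for \<open>n = p\<close> it is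
  the prescribed \<open>p\<close>-map by Wilson's theorem.\<close>

definition ltimes_dpow ::
  "('f, 'u::infinite) dp_algebra \<Rightarrow> ('f, 'u) act_module \<Rightarrow> nat \<Rightarrow> 'u \<Rightarrow> 'u" where
  "ltimes_dpow A M n x = upair (dpow A n (ufst x)) (dpow_act A M (n - 1) (ufst x) (usnd x))"

lemma pair_module_ltimes:
  assumes "dp_module F A M"
  shows "pair_module F A M (ltimes_with A M d)"
proof -
  interpret dp_module F A M by fact
  show ?thesis by unfold_locales auto
qed

lemma nonunital_comm_algebra_ltimes:
  assumes "dp_module F A M"
  shows "nonunital_comm_algebra F (ltimes_with A M d)"
proof -
  interpret dp_module F A M by fact
  interpret P: pair_module F A M "ltimes_with A M d" by (rule pair_module_ltimes) fact
  show ?thesis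
    by (intro nonunital_comm_algebra.intro P.module nonunital_comm_algebra_axioms.intro)
      (auto simp: mult_closed act_closed mult_assoc mult_comm mult_lcomm mult_distrib mult_distrib_right mult_smult
        mult_smult_right act_add_left
        act_add_right act_smult_left act_smult_right act_mult act_commute N.M.a_ac N.smult_r_distr)
qed

text \<open>Leibniz rule: M is a square-zero ideal, so the module part of the (n+1)-st power of (a,
  x) is (n+1) a^n x. The exponent is a successor because \<open>nu_pow\<close> is meaningful from 1
  on only.\<close>

lemma nu_pow_ltimes:
  assumes "dp_module F A M" "a \<in> carrier A" "x \<in> carrier M"
  shows "nu_pow (ltimes_with A M d) (upair a x) (Suc n) =
    upair (nu_pow A a (Suc n)) ([Suc n] \<cdot>\<^bsub>M\<^esub> nu_pow_act A M n a x)"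
proof -
  interpret dp_module F A M by fact
  interpret L: nonunital_comm_algebra F "ltimes_with A M d"
    by (rule nonunital_comm_algebra_ltimes) fact
  show ?thesis
  proof (induction n)
    case 0 then show ?case using assms by (simp add: nu_pow_1 L.nu_pow_1 nu_pow_act_def)
  next
    case (Suc n)
    have "act M (nu_pow A a (Suc n)) x = nu_pow_act A M (Suc n) a x"
      by (simp add: nu_pow_act_def)
    moreover have "nu_pow_act A M (Suc n) a x = nu_pow_act A M n a (act M a x)"
      using assms by (simp add: nu_pow_act_Suc)
    ultimately show ?case using assms Suc
      by (simp add: nu_pow_Suc[of "Suc n"] L.nu_pow_Suc[of "Suc n"] act_add_pow_right act_add_right nu_pow_act_closed
          act_nu_pow_act_commute act_closed N.M.a_ac del: nu_pow_Suc)
  qed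
qed

text \<open>The module component of the addition law. Expanding (a+b)^[m] on x+y gives convolutions
  over 0..m for x and for y; the semidirect product groups the same terms into two pure ones and
  mixed products indexed by 1..m, which match after shifting the index of the x-sum by one.\<close>

lemma (in dp_module) dpow_act_add_sum:
  assumes "a \<in> carrier A" "b \<in> carrier A" "x \<in> carrier M" "y \<in> carrier M"
  shows "dpow_act A M m (a \<oplus> b) (x \<oplus>\<^bsub>M\<^esub> y) =
    dpow_act A M m a x \<oplus>\<^bsub>M\<^esub>
    (\<Oplus>\<^bsub>M\<^esub>l\<in>{1..m}. act M (dpow A l a) (dpow_act A M (m - l) b y) \<oplus>\<^bsub>M\<^esub>
       act M (dpow A (Suc m - l) b) (dpow_act A M (l - 1) a x)) \<oplus>\<^bsub>M\<^esub> dpow_act A M m b y"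
proof -
  define g where "g = (\<lambda>l. dpow_act A M l a (dpow_act A M (m - l) b y))"
  define h where "h = (\<lambda>l. dpow_act A M l a (dpow_act A M (m - l) b x))"
  have gh: "g l \<in> carrier M" "h l \<in> carrier M" for l
    by (simp_all add: g_def h_def assms dpow_act_closed)
  then have fin: "finsum M g S \<in> carrier M" "finsum M h S \<in> carrier M" for S :: "nat set"
    by (auto intro!: N.M.finsum_closed)
  \<comment> \<open>The pure term of y sits at l = 0 and the pure term of x at l = m, so the two
    sums lose opposite ends.\<close>
  have "{0..m} = insert 0 {1..m}" by auto
  then have 1: "finsum M g {0..m} = g 0 \<oplus>\<^bsub>M\<^esub> finsum M g {1..m}"
    using gh by (simp add: N.M.finsum_insert)
  have "{0..m} = insert m {0..<m}" by auto
  then have 2: "finsum M h {0..m} = h m \<oplus>\<^bsub>M\<^esub> finsum M h {0..<m}"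
    using gh by (simp add: N.M.finsum_insert)
  have "{1..m} = Suc ` {0..<m}"
    by (simp add: image_Suc_atLeastLessThan atLeastLessThanSuc_atLeastAtMost)
  then have 3: "finsum M h {0..<m} = finsum M (\<lambda>l. h (l - 1)) {1..m}"
    using N.M.finsum_reindex[of "\<lambda>l. h (l - 1)" Suc "{0..<m}"] gh by simp
  have "(\<Oplus>\<^bsub>M\<^esub>l\<in>{1..m}. act M (dpow A l a) (dpow_act A M (m - l) b y) \<oplus>\<^bsub>M\<^esub>
       act M (dpow A (Suc m - l) b) (dpow_act A M (l - 1) a x)) = (\<Oplus>\<^bsub>M\<^esub>l\<in>{1..m}. g l \<oplus>\<^bsub>M\<^esub> h (l - 1))"
    by (rule N.M.finsum_cong')
      (use assms gh in \<open>auto simp: g_def h_def dpow_act_def dpow_closed act_closed act_commute Suc_diff_le\<close>)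
  also have "\<dots> = finsum M g {1..m} \<oplus>\<^bsub>M\<^esub> finsum M h {0..<m}"
    unfolding 3 by (rule N.M.finsum_addf) (use gh in auto)
  finally have 4: "(\<Oplus>\<^bsub>M\<^esub>l\<in>{1..m}. act M (dpow A l a) (dpow_act A M (m - l) b y) \<oplus>\<^bsub>M\<^esub>
       act M (dpow A (Suc m - l) b) (dpow_act A M (l - 1) a x)) =
       finsum M g {1..m} \<oplus>\<^bsub>M\<^esub> finsum M h {0..<m}" .
  have 5: "g 0 = dpow_act A M m b y" "h m = dpow_act A M m a x"
    by (simp_all add: g_def h_def dpow_act_0)
  have "dpow_act A M m (a \<oplus> b) (x \<oplus>\<^bsub>M\<^esub> y) = finsum M h {0..m} \<oplus>\<^bsub>M\<^esub> finsum M g {0..m}"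
    by (simp add: assms dpow_act_add_right dpow_act_add_left g_def h_def)
  also have "\<dots> = h m \<oplus>\<^bsub>M\<^esub> (finsum M g {1..m} \<oplus>\<^bsub>M\<^esub> finsum M h {0..<m}) \<oplus>\<^bsub>M\<^esub> g 0"
    unfolding 1 2 using gh fin by (simp add: N.M.a_ac)
  finally show ?thesis unfolding 4 5 .
qed

text \<open>Every axiom splits into the axiom of A in the first component and an identity for the
  action in the second, where exponents are one lower.\<close>

lemma divided_power_algebra_ltimes_dpow:
  assumes "dp_module F A M"
  shows "divided_power_algebra F (ltimes_with A M (ltimes_dpow A M))"
proof -
  interpret dp_module F A M by fact
  let ?L = "ltimes_with A M (ltimes_dpow A M)"
  interpret P: pair_module F A M ?L by (rule pair_module_ltimes) fact
  interpret L: nonunital_comm_algebra F ?L by (rule nonunital_comm_algebra_ltimes) fact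
  have car: "\<exists>b m. x = upair b m \<and> b \<in> carrier A \<and> m \<in> carrier M" if "x \<in> carrier ?L" for x
    using that by auto
  have closed: "dpow ?L n x \<in> carrier ?L" if "1 \<le> n" "x \<in> carrier ?L" for n x
    using that by (auto simp: ltimes_dpow_def dpow_closed dpow_act_closed)
  note cl = act_closed dpow_closed dpow_act_closed mult_closed nu_pow_closed nu_pow_act_closed
  show ?thesis
  proof (intro divided_power_algebra.intro L.nonunital_comm_algebra_axioms
      divided_power_algebra_axioms.intro)
    fix n :: nat and x assume n: "1 \<le> n" and x: "x \<in> carrier ?L"
    show "dpow ?L n x \<in> carrier ?L" using n x by (rule closed)
    obtain a u where a: "x = upair a u" "a \<in> carrier A" "u \<in> carrier M" using car x by blast
    \<comment> \<open>The successor form removes the truncated subtraction from the exponent n - 1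
      of the module part.\<close>
    obtain k where k: "n = Suc k" using n by (cases n) auto
    have pw: "[j] \<cdot>\<^bsub>?L\<^esub> dpow ?L i x = upair ([j] \<cdot>\<^bsub>A\<^esub> dpow A i a) ([j] \<cdot>\<^bsub>M\<^esub> dpow_act A M (i - 1) a u)"
      if "1 \<le> i" for i j :: nat
      using P.add_pow_eq[OF closed[OF that x]] by (simp add: ltimes_dpow_def a)
    show "dpow ?L n (c \<odot>\<^bsub>?L\<^esub> x) = (c [^]\<^bsub>F\<^esub> n) \<odot>\<^bsub>?L\<^esub> dpow ?L n x" if "c \<in> carrier F" for c
      using a k that by (simp add: ltimes_dpow_def dpow_smult dpow_act_smult)
    show "dpow ?L m x \<otimes>\<^bsub>?L\<^esub> dpow ?L n x = [((m + n) choose m)] \<cdot>\<^bsub>?L\<^esub> dpow ?L (m + n) x"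
      if m: "1 \<le> m" for m
    proof -
      obtain l where l: "m = Suc l" using m by (cases m) auto
      define z where "z = dpow_act A M (m + n - 1) a u"
      have z: "z \<in> carrier M" using a by (simp add: z_def dpow_act_closed)
      have mk: "m + k = m + n - 1" "n + l = m + n - 1" by (simp_all add: k l)
      have 1: "act M (dpow A m a) (dpow_act A M k a u) = [((m + k) choose m)] \<cdot>\<^bsub>M\<^esub> z"
        unfolding z_def mk(1)[symmetric] using dpow_act_dpow_act[of a u m k] a m by (simp add: dpow_act_pos)
      have 2: "act M (dpow A n a) (dpow_act A M l a u) = [((n + l) choose n)] \<cdot>\<^bsub>M\<^esub> z"
        unfolding z_def mk(2)[symmetric] using dpow_act_dpow_act[of a u n l] a n by (simp add: dpow_act_pos)
      \<comment> \<open>Pascal's rule: both coefficients on the right have upper index m+n-1, and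
        the second one is reflected.\<close>
      have "(m + n) choose m = ((m + k) choose m) + ((n + l) choose n)"
        using binomial_symmetric[of n "n + l"] by (simp add: k l add.commute)
      then have "act M (dpow A m a) (dpow_act A M k a u) \<oplus>\<^bsub>M\<^esub> act M (dpow A n a) (dpow_act A M l a u)
          = [((m + n) choose m)] \<cdot>\<^bsub>M\<^esub> z"
        unfolding 1 2 using z by (simp add: N.M.add.nat_pow_mult)
      then show ?thesis
        using dpow_mult_dpow[OF m n a(2)] pw[of "m + n"] n a
        by (simp add: ltimes_dpow_def k l z_def)
    qed
    show "dpow ?L m (dpow ?L n x) = [(fact (m * n) div (fact m * fact n ^ m) :: nat)] \<cdot>\<^bsub>?L\<^esub> dpow ?L (m * n) x"
      if m: "1 \<le> m" for m
    proof -
      obtain l where l: "m = Suc l" using m by (cases m) auto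
      have mn: "1 \<le> m * n" using m n by simp
      define c :: nat where "c = fact (m * n) div (fact m * fact n ^ m)"
      have "dpow A m (dpow A n a) = [c] \<cdot>\<^bsub>A\<^esub> dpow A (m * n) a"
        unfolding c_def by (rule dpow_dpow) (use m n a in auto)
      moreover have "dpow_act A M (m - 1) (dpow A n a) (dpow_act A M (n - 1) a u) =
          [c] \<cdot>\<^bsub>M\<^esub> dpow_act A M (m * n - 1) a u"
        using dpow_act_dpow_dpow_act[of n a u l] a unfolding c_def l diff_Suc_1 by (simp only: k zero_less_Suc)
      ultimately show ?thesis
        unfolding c_def[symmetric] pw[OF mn] by (simp add: ltimes_dpow_def a(1))
    qed
    fix y assume y: "y \<in> carrier ?L"
    obtain b v where b: "y = upair b v" "b \<in> carrier A" "v \<in> carrier M" using car y by blast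
    have sum: "(\<Oplus>\<^bsub>?L\<^esub>l\<in>{1..k}. dpow ?L l x \<otimes>\<^bsub>?L\<^esub> dpow ?L (n - l) y) =
      upair (\<Oplus>\<^bsub>A\<^esub>l\<in>{1..k}. ufst (dpow ?L l x \<otimes>\<^bsub>?L\<^esub> dpow ?L (n - l) y))
        (\<Oplus>\<^bsub>M\<^esub>l\<in>{1..k}. usnd (dpow ?L l x \<otimes>\<^bsub>?L\<^esub> dpow ?L (n - l) y))"
      by (rule P.finsum_eq) (use x y k in \<open>auto intro!: L.mult_closed closed simp del: ltimes_with_simps\<close>)
    show "dpow ?L n (x \<oplus>\<^bsub>?L\<^esub> y) = dpow ?L n x \<oplus>\<^bsub>?L\<^esub>
        (\<Oplus>\<^bsub>?L\<^esub>l\<in>{1..n-1}. dpow ?L l x \<otimes>\<^bsub>?L\<^esub> dpow ?L (n - l) y) \<oplus>\<^bsub>?L\<^esub> dpow ?L n y"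
      using a b n sum dpow_add[of n a b] dpow_act_add_sum[of a b u v k]
      by (simp add: ltimes_dpow_def k)
    show "dpow ?L n (x \<otimes>\<^bsub>?L\<^esub> y) = [(fact n :: nat)] \<cdot>\<^bsub>?L\<^esub> (dpow ?L n x \<otimes>\<^bsub>?L\<^esub> dpow ?L n y)"
    proof -
      \<comment> \<open>One factor n of n! comes from a^[k] a = n a^[n], the remaining k! from the
        product axiom for (ab)^[k].\<close>
      have 1: "dpow_act A M k (a \<otimes>\<^bsub>A\<^esub> b) (act M a v) = [(fact n :: nat)] \<cdot>\<^bsub>M\<^esub> act M (dpow A n a) (dpow_act A M k b v)"
        if "a \<in> carrier A" "b \<in> carrier A" "v \<in> carrier M" for a b v
      proof -
        have "dpow_act A M k (a \<otimes>\<^bsub>A\<^esub> b) (act M a v)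
            = [(fact k :: nat)] \<cdot>\<^bsub>M\<^esub> dpow_act A M k b (dpow_act A M k a (act M a v))"
          using that by (simp add: dpow_act_mult_fact cl dpow_act_commute)
        also have "\<dots> = [(fact k * Suc k)] \<cdot>\<^bsub>M\<^esub> dpow_act A M k b (dpow_act A M (Suc k) a v)"
          using that by (simp add: dpow_act_act dpow_act_add_pow_right cl N.M.add.nat_pow_pow mult.commute
            del: N.M.add.nat_pow_Suc)
        finally show ?thesis using that
          by (simp add: k dpow_act_pos act_dpow_act_commute cl mult.commute del: N.M.add.nat_pow_Suc)
      qed
      have "dpow_act A M k (a \<otimes>\<^bsub>A\<^esub> b) (act M b u) = [(fact n :: nat)] \<cdot>\<^bsub>M\<^esub> act M (dpow A n b) (dpow_act A M k a u)"
        using 1[of b a u] a b by (simp add: mult_comm)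
      then show ?thesis
        using a b n 1[of a b v] x y P.add_pow_eq[OF L.mult_closed[OF closed[OF n x] closed[OF n y]], of "fact n"]
        by (simp add: ltimes_dpow_def k dpow_act_add_right cl dpow_mult_fact N.M.add.nat_pow_distrib del: fact_Suc)
    qed
    \<comment> \<open>Stated for arbitrary elements so that the symmetric axiom follows by
      exchanging x and y and using commutativity.\<close>
    have left: "dpow ?L n (x \<otimes>\<^bsub>?L\<^esub> y) = nu_pow ?L x n \<otimes>\<^bsub>?L\<^esub> dpow ?L n y"
      if "x = upair a u" "a \<in> carrier A" "u \<in> carrier M" "y = upair b v" "b \<in> carrier A" "v \<in> carrier M"
      for x a u y b v
    proof -
      have "dpow_act A M k (a \<otimes>\<^bsub>A\<^esub> b) (act M a v) = act M (nu_pow A a n) (dpow_act A M k b v)"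
      proof -
        have "dpow_act A M k (a \<otimes>\<^bsub>A\<^esub> b) (act M a v) = nu_pow_act A M k a (act M a (dpow_act A M k b v))"
          using that by (simp add: dpow_act_mult_left cl act_dpow_act_commute)
        also have "\<dots> = nu_pow_act A M n a (dpow_act A M k b v)"
          using that by (simp add: k nu_pow_act_Suc cl)
        finally show ?thesis by (simp add: nu_pow_act_def k)
      qed
      \<comment> \<open>The identity b^[k] b = n b^[n] produces the multiple n that the Leibniz rule
        yields for the n-th power of (a, u).\<close>
      moreover have "dpow_act A M k (a \<otimes>\<^bsub>A\<^esub> b) (act M b u) =
        act M (dpow A n b) ([n] \<cdot>\<^bsub>M\<^esub> nu_pow_act A M k a u)"
      proof -
        have "dpow_act A M k (a \<otimes>\<^bsub>A\<^esub> b) (act M b u) = nu_pow_act A M k a (dpow_act A M k b (act M b u))"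
          using that by (simp add: dpow_act_mult_left cl)
        also have "dpow_act A M k b (act M b u) = [n] \<cdot>\<^bsub>M\<^esub> act M (dpow A n b) u"
          using that by (simp add: dpow_act_act k dpow_act_pos)
        also have "\<dots> = act M (dpow A n b) ([n] \<cdot>\<^bsub>M\<^esub> u)"
          using that n by (simp add: act_add_pow_right cl)
        also have "nu_pow_act A M k a \<dots> = act M (dpow A n b) (nu_pow_act A M k a ([n] \<cdot>\<^bsub>M\<^esub> u))"
          using that n by (simp add: act_nu_pow_act_commute cl)
        also have "nu_pow_act A M k a ([n] \<cdot>\<^bsub>M\<^esub> u) = [n] \<cdot>\<^bsub>M\<^esub> nu_pow_act A M k a u"
          using that by (simp add: nu_pow_act_def act_add_pow_right cl)
        finally show ?thesis .
      qed
      ultimately show ?thesis using that nu_pow_ltimes[OF assms that(2,3), of _ k] n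
        by (simp add: ltimes_dpow_def k dpow_act_add_right cl dpow_mult_left del: N.M.add.nat_pow_Suc)
    qed
    show "dpow ?L n (x \<otimes>\<^bsub>?L\<^esub> y) = nu_pow ?L x n \<otimes>\<^bsub>?L\<^esub> dpow ?L n y"
      by (rule left[OF a b])
    have "dpow ?L n (y \<otimes>\<^bsub>?L\<^esub> x) = nu_pow ?L y n \<otimes>\<^bsub>?L\<^esub> dpow ?L n x"
      by (rule left[OF b a])
    then show "dpow ?L n (x \<otimes>\<^bsub>?L\<^esub> y) = dpow ?L n x \<otimes>\<^bsub>?L\<^esub> nu_pow ?L y n"
      using L.mult_comm[OF x y] L.mult_comm[OF L.nu_pow_closed[OF y] closed[OF n x]] by simp
  next
    fix x assume "x \<in> carrier ?L"
    then show "dpow ?L 1 x = x"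
      using dpow_1 by (auto simp: ltimes_dpow_def dpow_act_def)
  qed
qed

section \<open>Characteristic p\<close>

text \<open>An instance of Lucas' theorem: the coefficient is 1 modulo p. The induction only tracks
  divisibility, through (r+1) C(ip+r+1, r+1) = (ip+r+1) C(ip+r, r), whose factor ip+r+1 is prime to
  p as long as r+1 < p.\<close>

lemma prime_not_dvd_binomial:
  assumes "prime (p::nat)" "r < p"
  shows "\<not> p dvd (i * p + r) choose r"
  using assms(2)
proof (induction r)
  case 0 then show ?case using assms(1) by (simp add: prime_nat_iff)
next
  case (Suc r)
  have "\<not> p dvd (i * p + Suc r)"
    using Suc.prems by (metis dvd_add_right_iff dvd_triv_right nat_dvd_not_less zero_less_Suc)
  moreover have "Suc r * ((i * p + Suc r) choose Suc r) = (i * p + Suc r) * ((i * p + r) choose r)"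
    using Suc_times_binomial_eq[of "i * p + r" r] by (simp add: mult.commute)
  ultimately show ?case using Suc assms(1)
    by (metis Suc_lessD dvd_mult prime_dvd_mult_iff)
qed

text \<open>All factors of the product form have the shape C(ip+r, r) with r = p-1.\<close>

lemma prime_not_dvd_quotient:
  assumes "prime (p::nat)"
  shows "\<not> p dvd fact (m * p) div (fact m * fact p ^ m)"
proof -
  have p: "p > 0" using assms by (simp add: prime_gt_0_nat)
  have "\<not> p dvd (\<Prod>i<m. (i * p + (p - 1)) choose (p - 1))"
    using prime_not_dvd_binomial[OF assms, of "p - 1"] p
    by (auto simp: prime_dvd_prod_iff[OF _ assms])
  then show ?thesis by (simp add: fact_mult_quotient[OF p])
qed

section \<open>Consequences of characteristic p: primality, cancellation, Wilson's theorem\<close>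

locale char_p_field = field F for F :: "'f ring" (structure) +
  fixes p :: nat
  assumes char: "is_characteristic F p" and p_pos: "p > 0"
begin

lemma nat_eq_zero_iff: "[(k::nat)] \<cdot> \<one> = \<zero> \<longleftrightarrow> p dvd k"
  using char unfolding is_characteristic_def by blast

text \<open>\<open>is_characteristic\<close> only says which multiples of 1 vanish; p is prime
  because F has no zero divisors.\<close>

lemma prime_p: "prime p"
proof -
  have "p dvd a \<or> p dvd b" if "p dvd a * b" for a b
  proof -
    have "[a] \<cdot> \<one> \<otimes> [b] \<cdot> \<one> = [(a * b)] \<cdot> \<one>"
      by (simp add: add_pow_ldistr add.nat_pow_pow mult.commute)
    then show ?thesis using that integral[of "[a] \<cdot> \<one>" "[b] \<cdot> \<one>"]
      by (simp flip: nat_eq_zero_iff)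
  qed
  moreover have "\<not> p dvd 1" using nat_eq_zero_iff[of 1] by simp
  ultimately have "prime_elem p" using p_pos by (intro prime_elemI) blast+
  then show ?thesis by simp
qed

text \<open>The scalar k 1 is a unit of F as soon as p does not divide k.\<close>

lemma add_pow_cancel:
  assumes "Module.module F M" "\<not> p dvd k" "x \<in> carrier M" "y \<in> carrier M"
    "[k] \<cdot>\<^bsub>M\<^esub> x = [k] \<cdot>\<^bsub>M\<^esub> y"
  shows "x = y"
proof -
  interpret M: Module.module F M by fact
  have "[k] \<cdot> \<one> \<in> Units F" using assms(2) by (simp add: field_Units nat_eq_zero_iff)
  then have u: "inv ([k] \<cdot> \<one>) \<in> carrier F" "inv ([k] \<cdot> \<one>) \<otimes> ([k] \<cdot> \<one>) = \<one>" by simp_all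
  have "z = inv ([k] \<cdot> \<one>) \<odot>\<^bsub>M\<^esub> ([k] \<cdot>\<^bsub>M\<^esub> z)" if "z \<in> carrier M" for z
    using that u by (simp add: M.add_pow_eq_smult[of z] flip: M.smult_assoc1)
  then show ?thesis using assms by metis
qed

text \<open>By Wilson's theorem (p-1)! is -1 modulo p. This is the source of the sign in the p-map
  of the semidirect product, as a^(p-1) = (p-1)! a^[p-1].\<close>

lemma add_pow_fact:
  assumes "Module.module F M" "x \<in> carrier M"
  shows "[(fact (p - 1) :: nat)] \<cdot>\<^bsub>M\<^esub> x = \<ominus>\<^bsub>M\<^esub> x"
proof -
  interpret M: Module.module F M by fact
  have "[fact (p - 1) = - 1] (mod (int p))" using wilson_theorem[OF prime_p] .
  then have "int p dvd int (fact (p - 1) + 1)" by (simp add: cong_iff_dvd_diff add.commute)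
  then have "p dvd fact (p - 1) + 1" by (simp only: int_dvd_int_iff)
  then have "[(fact (p - 1) + 1 :: nat)] \<cdot>\<^bsub>M\<^esub> x = \<zero>\<^bsub>M\<^esub>"
    unfolding M.add_pow_eq_smult[OF assms(2)] nat_eq_zero_iff[symmetric] using assms by simp
  then have "[(fact (p - 1) :: nat)] \<cdot>\<^bsub>M\<^esub> x \<oplus>\<^bsub>M\<^esub> x = \<zero>\<^bsub>M\<^esub>" using assms by simp
  then show ?thesis using assms by (simp add: M.M.minus_equality)
qed

end

section \<open>Linear maps\<close>

lemma linear_hom_zero:
  assumes "linear_hom F B C f" "f \<in> carrier B \<rightarrow> carrier C" "Module.module F B" "Module.module F C"
  shows "f \<zero>\<^bsub>B\<^esub> = \<zero>\<^bsub>C\<^esub>"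
proof -
  interpret B: Module.module F B by fact
  interpret C: Module.module F C by fact
  have "f (\<zero>\<^bsub>F\<^esub> \<odot>\<^bsub>B\<^esub> \<zero>\<^bsub>B\<^esub>) = \<zero>\<^bsub>F\<^esub> \<odot>\<^bsub>C\<^esub> f \<zero>\<^bsub>B\<^esub>"
    using assms(1) by (simp add: linear_hom_def del: B.smult_l_null B.smult_r_null C.smult_l_null)
  moreover have "f \<zero>\<^bsub>B\<^esub> \<in> carrier C" using assms(2) by auto
  ultimately show ?thesis by simp
qed

lemma linear_hom_add_pow:
  assumes "linear_hom F B C f" "f \<in> carrier B \<rightarrow> carrier C" "Module.module F B" "Module.module F C"
    "x \<in> carrier B"
  shows "f ([(n::nat)] \<cdot>\<^bsub>B\<^esub> x) = [n] \<cdot>\<^bsub>C\<^esub> f x"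
proof -
  interpret B: Module.module F B by fact
  interpret C: Module.module F C by fact
  have "f x \<in> carrier C" using assms by auto
  then show ?thesis using assms(1,5)
    by (simp add: B.add_pow_eq_smult C.add_pow_eq_smult linear_hom_def)
qed

lemma linear_hom_minus:
  assumes "linear_hom F B C f" "f \<in> carrier B \<rightarrow> carrier C" "Module.module F B" "Module.module F C"
    "x \<in> carrier B"
  shows "f (\<ominus>\<^bsub>B\<^esub> x) = \<ominus>\<^bsub>C\<^esub> f x"
proof -
  interpret B: Module.module F B by fact
  interpret C: Module.module F C by fact
  have "f x \<in> carrier C" using assms by auto
  moreover have "f ((\<ominus>\<^bsub>F\<^esub> \<one>\<^bsub>F\<^esub>) \<odot>\<^bsub>B\<^esub> x) = (\<ominus>\<^bsub>F\<^esub> \<one>\<^bsub>F\<^esub>) \<odot>\<^bsub>C\<^esub> f x"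
    using assms(1,5) by (simp add: linear_hom_def del: B.smult_l_minus C.smult_l_minus)
  ultimately show ?thesis using assms(5) by (simp add: B.smult_l_minus C.smult_l_minus)
qed

section \<open>Uniqueness of divided powers\<close>

lemma (in nonunital_comm_algebra) module: "Module.module F A" ..

context char_p_field
begin

text \<open>Induction on \<open>n\<close>: either \<open>p\<close> does not divide \<open>n\<close> and \<open>a\<^sup>[\<^sup>n\<^sup>-\<^sup>1\<^sup>] * a = n a\<^sup>[\<^sup>n\<^sup>]\<close>, or
  \<open>n = j p\<close> and the coefficient of \<open>a\<^sup>[\<^sup>n\<^sup>]\<close> in \<open>(a\<^sup>[\<^sup>p\<^sup>])\<^sup>[\<^sup>j\<^sup>]\<close> is prime to \<open>p\<close>.\<close>

lemma dpow_hom_from_p: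
  assumes A: "divided_power_algebra F A" and B: "divided_power_algebra F B"
    and f: "f \<in> carrier A \<rightarrow> carrier B" "linear_hom F A B f"
    and mult: "\<And>x y. \<lbrakk>x \<in> carrier A; y \<in> carrier A\<rbrakk> \<Longrightarrow> f (x \<otimes>\<^bsub>A\<^esub> y) = f x \<otimes>\<^bsub>B\<^esub> f y"
    and pth: "\<And>x. x \<in> carrier A \<Longrightarrow> f (dpow A p x) = dpow B p (f x)"
  shows "\<lbrakk>1 \<le> n; x \<in> carrier A\<rbrakk> \<Longrightarrow> f (dpow A n x) = dpow B n (f x)"
proof (induction n arbitrary: x rule: less_induct)
  case (less n)
  interpret A: divided_power_algebra F A by fact
  interpret B: divided_power_algebra F B by fact
  have fx: "f y \<in> carrier B" if "y \<in> carrier A" for y using f that by auto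
  note pow = linear_hom_add_pow[OF f(2,1) A.module B.module]
  consider "n = 1" | "n > 1" "\<not> p dvd n" | j where "n = j * p" "1 \<le> j" "j < n"
    using less.prems prime_gt_1_nat[OF prime_p]
    by (cases "n = 1"; cases "p dvd n") (auto elim!: dvdE simp: mult.commute)
  then show ?case
  proof cases
    case 1 then show ?thesis using less.prems fx A.dpow_1 B.dpow_1 by simp
  next
    case 2
    have "[n] \<cdot>\<^bsub>B\<^esub> f (dpow A n x) = f ([(((n - 1) + 1) choose (n - 1))] \<cdot>\<^bsub>A\<^esub> dpow A ((n - 1) + 1) x)"
      using 2 less.prems pow[of "dpow A n x" n] A.dpow_closed[of n x] binomial_symmetric[of 1 n] by simp
    also have "\<dots> = f (dpow A (n - 1) x \<otimes>\<^bsub>A\<^esub> dpow A 1 x)"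
      using 2 less.prems A.dpow_mult_dpow[of "n - 1" 1 x] by simp
    also have "\<dots> = dpow B (n - 1) (f x) \<otimes>\<^bsub>B\<^esub> dpow B 1 (f x)"
      using 2 less.prems less.IH[of "n - 1" x] A.dpow_closed[of "n - 1" x] A.dpow_1 B.dpow_1 mult fx by simp
    also have "\<dots> = [(((n - 1) + 1) choose (n - 1))] \<cdot>\<^bsub>B\<^esub> dpow B ((n - 1) + 1) (f x)"
      using 2 less.prems B.dpow_mult_dpow[of "n - 1" 1 "f x"] fx by simp
    also have "\<dots> = [n] \<cdot>\<^bsub>B\<^esub> dpow B n (f x)"
      using 2 binomial_symmetric[of 1 n] by simp
    finally have eq: "[n] \<cdot>\<^bsub>B\<^esub> f (dpow A n x) = [n] \<cdot>\<^bsub>B\<^esub> dpow B n (f x)" .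
    show ?thesis
      by (rule add_pow_cancel[OF B.module 2(2) _ _ eq]) (use less.prems fx A.dpow_closed B.dpow_closed in blast)+
  next
    case 3
    define c :: nat where "c = fact (j * p) div (fact j * fact p ^ j)"
    have p: "1 \<le> p" using p_pos by simp
    have "[c] \<cdot>\<^bsub>B\<^esub> f (dpow A n x) = f (dpow A j (dpow A p x))"
      using 3 less.prems A.dpow_dpow[OF 3(2) p] pow A.dpow_closed by (simp add: c_def)
    \<comment> \<open>The induction hypothesis is applied to the element x^[p] with exponent j < n,
      which is why the induction leaves x arbitrary.\<close>
    also have "\<dots> = dpow B j (dpow B p (f x))"
      using less.IH[OF 3(3,2) A.dpow_closed[OF p less.prems(2)]] pth less.prems by simp
    also have "\<dots> = [c] \<cdot>\<^bsub>B\<^esub> dpow B n (f x)"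
      using 3 less.prems B.dpow_dpow[OF 3(2) p] fx by (simp add: c_def)
    finally have eq: "[c] \<cdot>\<^bsub>B\<^esub> f (dpow A n x) = [c] \<cdot>\<^bsub>B\<^esub> dpow B n (f x)" .
    have "\<not> p dvd c" unfolding c_def by (rule prime_not_dvd_quotient[OF prime_p])
    from add_pow_cancel[OF B.module this _ _ eq] show ?thesis
      using less.prems fx A.dpow_closed B.dpow_closed by blast
  qed
qed

end

text \<open>Repeated use of a^[n] a = (n+1) a^[n+1]. It translates the ordinary power in the
  prescribed p-map into a divided power.\<close>

lemma (in divided_power_algebra) nu_pow_eq_dpow:
  assumes "a \<in> carrier A" "1 \<le> n"
  shows "nu_pow A a n = [(fact n :: nat)] \<cdot> dpow A n a"
  using assms(2)
proof (induction n rule: nat_induct_at_least)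
  case base then show ?case using assms(1) dpow_1 by (simp add: nu_pow_1)
next
  case (Suc n)
  have "dpow A n a \<otimes> a = [Suc n] \<cdot> dpow A (Suc n) a"
    using Suc assms(1) dpow_mult_dpow[of n 1 a] dpow_1 binomial_symmetric[of 1 "Suc n"] by simp
  then have "nu_pow A a (Suc n) = [(fact n :: nat)] \<cdot> ([Suc n] \<cdot> dpow A (Suc n) a)"
    using Suc assms(1) by (simp add: nu_pow_Suc add_pow_mult dpow_closed del: M.add.nat_pow_Suc)
  also have "\<dots> = [(Suc n * fact n)] \<cdot> dpow A (Suc n) a"
    using assms(1) by (simp only: M.add.nat_pow_pow dpow_closed)
  finally show ?case by simp
qed

section \<open>Identification of the chosen structure on the semidirect product\<close>

context char_p_field
begin

text \<open>The explicit structure meets the specification, so the choice in \<open>ltimes\<close>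
  is not vacuous. The chosen structure has the same p-th operation and therefore agrees with the
  explicit one on the carrier for all n \<ge> 1.\<close>

lemma
  fixes A :: "('f, 'u::infinite) dp_algebra"
  assumes "dp_module F A M"
  shows divided_power_algebra_ltimes: "divided_power_algebra F (ltimes F p A M)"
    and dpow_ltimes: "\<lbrakk>1 \<le> n; a \<in> carrier A; x \<in> carrier M\<rbrakk> \<Longrightarrow>
      dpow (ltimes F p A M) n (upair a x) = upair (dpow A n a) (dpow_act A M (n - 1) a x)"
proof -
  interpret dp_module F A M by fact
  define P where "P = (\<lambda>d. divided_power_algebra F (ltimes_with A M d) \<and>
     (\<forall>a\<in>carrier A. \<forall>m\<in>carrier M.
        d p (upair a m) = upair (dpow A p a) (\<ominus>\<^bsub>M\<^esub> act M (nu_pow A a (p - 1)) m)))"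
  have p1: "1 \<le> p - 1" using prime_gt_1_nat[OF prime_p] by simp
  have "P (ltimes_dpow A M)"
  proof -
    \<comment> \<open>The signs match because a^(p-1) = (p-1)! a^[p-1] = - a^[p-1]; since p-1 is
      positive, the convention at index 0 does not interfere.\<close>
    have "dpow_act A M (p - 1) a m = \<ominus>\<^bsub>M\<^esub> act M (nu_pow A a (p - 1)) m"
      if "a \<in> carrier A" "m \<in> carrier M" for a m
      using that p1 add_pow_fact[OF N.module_axioms, of "act M (dpow A (p - 1) a) m"]
      by (simp add: nu_pow_eq_dpow act_add_pow_left dpow_closed act_closed dpow_act_pos)
    then show ?thesis
      unfolding P_def using divided_power_algebra_ltimes_dpow[OF assms] by (auto simp: ltimes_dpow_def)
  qed
  then have P: "P (SOME d. P d)" by (rule someI[of P])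
  define d where "d = (SOME d. P d)"
  have eq: "ltimes F p A M = ltimes_with A M d" by (simp add: ltimes_def d_def P_def)
  have 1: "divided_power_algebra F (ltimes_with A M d)" using P by (simp add: P_def d_def)
  then show "divided_power_algebra F (ltimes F p A M)" by (simp add: eq)
  have 2: "divided_power_algebra F (ltimes_with A M (ltimes_dpow A M))"
    by (rule divided_power_algebra_ltimes_dpow) fact
  have pth: "d p y = ltimes_dpow A M p y" if "y \<in> carrier (ltimes_with A M d)" for y
    using that P \<open>P (ltimes_dpow A M)\<close> by (auto simp: P_def d_def)
  \<comment> \<open>The identity map from one structure to the other is linear and multiplicative,
    since the two differ in \<open>dpow\<close> alone.\<close>
  have "d n y = ltimes_dpow A M n y" if "1 \<le> n" "y \<in> carrier (ltimes_with A M d)" for n y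
    using dpow_hom_from_p[OF 1 2, of "\<lambda>x. x" n y] that pth by (simp add: linear_hom_def)
  then show "\<lbrakk>1 \<le> n; a \<in> carrier A; x \<in> carrier M\<rbrakk> \<Longrightarrow>
      dpow (ltimes F p A M) n (upair a x) = upair (dpow A n a) (dpow_act A M (n - 1) a x)"
    by (auto simp: eq ltimes_dpow_def)
qed

end

lemma ltimes_simps [simp]:
  "carrier (ltimes F p A M) = {upair a m | a m. a \<in> carrier A \<and> m \<in> carrier M}"
  "x \<otimes>\<^bsub>ltimes F p A M\<^esub> y = upair (ufst x \<otimes>\<^bsub>A\<^esub> ufst y)
     (act M (ufst x) (usnd y) \<oplus>\<^bsub>M\<^esub> act M (ufst y) (usnd x))"
  "zero (ltimes F p A M) = upair \<zero>\<^bsub>A\<^esub> \<zero>\<^bsub>M\<^esub>"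
  "x \<oplus>\<^bsub>ltimes F p A M\<^esub> y = upair (ufst x \<oplus>\<^bsub>A\<^esub> ufst y) (usnd x \<oplus>\<^bsub>M\<^esub> usnd y)"
  "c \<odot>\<^bsub>ltimes F p A M\<^esub> x = upair (c \<odot>\<^bsub>A\<^esub> ufst x) (c \<odot>\<^bsub>M\<^esub> usnd x)"
  by (simp_all only: ltimes_def ltimes_with_simps)

section \<open>Fibre products\<close>

lemma fibre_product_simps [simp]:
  "carrier (fibre_product f g) =
     {upair b c | b c. b \<in> carrier (src f) \<and> c \<in> carrier (src g) \<and> mor f b = mor g c}"
  "x \<otimes>\<^bsub>fibre_product f g\<^esub> y = upair (ufst x \<otimes>\<^bsub>src f\<^esub> ufst y) (usnd x \<otimes>\<^bsub>src g\<^esub> usnd y)"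
  "zero (fibre_product f g) = upair \<zero>\<^bsub>src f\<^esub> \<zero>\<^bsub>src g\<^esub>"
  "x \<oplus>\<^bsub>fibre_product f g\<^esub> y = upair (ufst x \<oplus>\<^bsub>src f\<^esub> ufst y) (usnd x \<oplus>\<^bsub>src g\<^esub> usnd y)"
  "c \<odot>\<^bsub>fibre_product f g\<^esub> x = upair (c \<odot>\<^bsub>src f\<^esub> ufst x) (c \<odot>\<^bsub>src g\<^esub> usnd x)"
  "dpow (fibre_product f g) n x = upair (dpow (src f) n (ufst x)) (dpow (src g) n (usnd x))"
  by (simp_all add: fibre_product_def Let_def)

text \<open>All operations are componentwise, so the axioms are those of the two factors; the
  homomorphism conditions keep the results inside the subset where the two images agree.\<close>

lemma divided_power_algebra_fibre_product:
  fixes f g :: "('f, 'u::infinite) dp_arrow"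
  assumes "divided_power_algebra F (src f)" "divided_power_algebra F (src g)" "divided_power_algebra F Z"
    and "mor f \<in> carrier (src f) \<rightarrow> carrier Z" "mor g \<in> carrier (src g) \<rightarrow> carrier Z"
    and f: "dp_hom F (src f) Z (mor f)" and g: "dp_hom F (src g) Z (mor g)"
  shows "divided_power_algebra F (fibre_product f g)"
proof -
  let ?B = "src f" and ?C = "src g" and ?P = "fibre_product f g"
  interpret B: divided_power_algebra F ?B by fact
  interpret C: divided_power_algebra F ?C by fact
  interpret Z: divided_power_algebra F Z by fact
  have zero: "mor f \<zero>\<^bsub>?B\<^esub> = mor g \<zero>\<^bsub>?C\<^esub>"
    using linear_hom_zero[OF _ assms(4) B.module Z.module] linear_hom_zero[OF _ assms(5) C.module Z.module] f g
    by (simp add: dp_hom_def)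
  have hom:
    "\<And>x y. \<lbrakk>x \<in> carrier ?B; y \<in> carrier ?B\<rbrakk> \<Longrightarrow> mor f (x \<oplus>\<^bsub>?B\<^esub> y) = mor f x \<oplus>\<^bsub>Z\<^esub> mor f y"
    "\<And>c x. \<lbrakk>c \<in> carrier F; x \<in> carrier ?B\<rbrakk> \<Longrightarrow> mor f (c \<odot>\<^bsub>?B\<^esub> x) = c \<odot>\<^bsub>Z\<^esub> mor f x"
    "\<And>x y. \<lbrakk>x \<in> carrier ?B; y \<in> carrier ?B\<rbrakk> \<Longrightarrow> mor f (x \<otimes>\<^bsub>?B\<^esub> y) = mor f x \<otimes>\<^bsub>Z\<^esub> mor f y"
    "\<And>n x. \<lbrakk>1 \<le> n; x \<in> carrier ?B\<rbrakk> \<Longrightarrow> mor f (dpow ?B n x) = dpow Z n (mor f x)"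
    "\<And>x y. \<lbrakk>x \<in> carrier ?C; y \<in> carrier ?C\<rbrakk> \<Longrightarrow> mor g (x \<oplus>\<^bsub>?C\<^esub> y) = mor g x \<oplus>\<^bsub>Z\<^esub> mor g y"
    "\<And>c x. \<lbrakk>c \<in> carrier F; x \<in> carrier ?C\<rbrakk> \<Longrightarrow> mor g (c \<odot>\<^bsub>?C\<^esub> x) = c \<odot>\<^bsub>Z\<^esub> mor g x"
    "\<And>x y. \<lbrakk>x \<in> carrier ?C; y \<in> carrier ?C\<rbrakk> \<Longrightarrow> mor g (x \<otimes>\<^bsub>?C\<^esub> y) = mor g x \<otimes>\<^bsub>Z\<^esub> mor g y"
    "\<And>n x. \<lbrakk>1 \<le> n; x \<in> carrier ?C\<rbrakk> \<Longrightarrow> mor g (dpow ?C n x) = dpow Z n (mor g x)"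
    using f g by (simp_all add: dp_hom_def linear_hom_def)
  interpret P: pair_module F ?B ?C ?P
    by unfold_locales (auto simp: zero hom)
  have car: "\<exists>b c. x = upair b c \<and> b \<in> carrier ?B \<and> c \<in> carrier ?C \<and> mor f b = mor g c" if "x \<in> carrier ?P" for x
    using that by auto
  interpret N: nonunital_comm_algebra F ?P
    by (intro nonunital_comm_algebra.intro P.module nonunital_comm_algebra_axioms.intro)
      (auto simp: hom B.mult_closed C.mult_closed B.mult_assoc C.mult_assoc B.mult_distrib
        C.mult_distrib B.mult_smult C.mult_smult intro: B.mult_comm C.mult_comm)
  have nu: "nu_pow ?P (upair b c) n = upair (nu_pow ?B b n) (nu_pow ?C c n)" for b c n
  proof -
    have "((\<lambda>y. y \<otimes>\<^bsub>?P\<^esub> upair b c) ^^ k) (upair b c) =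
       upair (((\<lambda>y. y \<otimes>\<^bsub>?B\<^esub> b) ^^ k) b) (((\<lambda>y. y \<otimes>\<^bsub>?C\<^esub> c) ^^ k) c)" for k
      by (induction k) auto
    then show ?thesis by (simp add: nu_pow_def)
  qed
  have closed: "dpow ?P n x \<in> carrier ?P" if "1 \<le> n" "x \<in> carrier ?P" for n x
    using that by (auto simp: hom B.dpow_closed C.dpow_closed)
  show ?thesis
  proof (intro divided_power_algebra.intro N.nonunital_comm_algebra_axioms
      divided_power_algebra_axioms.intro)
    fix n :: nat and x assume n: "1 \<le> n" and x: "x \<in> carrier ?P"
    show "dpow ?P n x \<in> carrier ?P" using n x by (rule closed)
    obtain b c where bc: "x = upair b c" "b \<in> carrier ?B" "c \<in> carrier ?C" using car x by blast
    have pw: "[j] \<cdot>\<^bsub>?P\<^esub> dpow ?P i x = upair ([j] \<cdot>\<^bsub>?B\<^esub> dpow ?B i b) ([j] \<cdot>\<^bsub>?C\<^esub> dpow ?C i c)"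
      if "1 \<le> i" for i j :: nat
      using P.add_pow_eq[OF closed[OF that x]] by (simp add: bc)
    show "dpow ?P n (k \<odot>\<^bsub>?P\<^esub> x) = (k [^]\<^bsub>F\<^esub> n) \<odot>\<^bsub>?P\<^esub> dpow ?P n x" if "k \<in> carrier F" for k
      using bc that n by (simp add: B.dpow_smult C.dpow_smult)
    show "dpow ?P m x \<otimes>\<^bsub>?P\<^esub> dpow ?P n x = [((m + n) choose m)] \<cdot>\<^bsub>?P\<^esub> dpow ?P (m + n) x"
      if m: "1 \<le> m" for m
      unfolding pw[OF trans_le_add1[OF m]] using bc m n by (simp add: B.dpow_mult_dpow C.dpow_mult_dpow)
    show "dpow ?P m (dpow ?P n x) = [(fact (m * n) div (fact m * fact n ^ m) :: nat)] \<cdot>\<^bsub>?P\<^esub> dpow ?P (m * n) x"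
      if m: "1 \<le> m" for m
    proof -
      have "1 \<le> m * n" using m n by simp
      from pw[OF this] show ?thesis using bc m n by (simp add: B.dpow_dpow C.dpow_dpow)
    qed
    fix y assume y: "y \<in> carrier ?P"
    obtain b' c' where bc': "y = upair b' c'" "b' \<in> carrier ?B" "c' \<in> carrier ?C" using car y by blast
    have sum: "(\<Oplus>\<^bsub>?P\<^esub>l\<in>{1..n-1}. dpow ?P l x \<otimes>\<^bsub>?P\<^esub> dpow ?P (n - l) y) =
      upair (\<Oplus>\<^bsub>?B\<^esub>l\<in>{1..n-1}. ufst (dpow ?P l x \<otimes>\<^bsub>?P\<^esub> dpow ?P (n - l) y))
        (\<Oplus>\<^bsub>?C\<^esub>l\<in>{1..n-1}. usnd (dpow ?P l x \<otimes>\<^bsub>?P\<^esub> dpow ?P (n - l) y))"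
      by (rule P.finsum_eq) (use x y n in \<open>auto intro!: N.mult_closed closed simp del: fibre_product_simps\<close>)
    show "dpow ?P n (x \<oplus>\<^bsub>?P\<^esub> y) = dpow ?P n x \<oplus>\<^bsub>?P\<^esub>
        (\<Oplus>\<^bsub>?P\<^esub>l\<in>{1..n-1}. dpow ?P l x \<otimes>\<^bsub>?P\<^esub> dpow ?P (n - l) y) \<oplus>\<^bsub>?P\<^esub> dpow ?P n y"
      unfolding sum using bc bc' n by (simp add: B.dpow_add C.dpow_add)
    show "dpow ?P n (x \<otimes>\<^bsub>?P\<^esub> y) = [(fact n :: nat)] \<cdot>\<^bsub>?P\<^esub> (dpow ?P n x \<otimes>\<^bsub>?P\<^esub> dpow ?P n y)"
      unfolding P.add_pow_eq[OF N.mult_closed[OF closed[OF n x] closed[OF n y]], of "fact n"]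
      using bc bc' n by (simp add: B.dpow_mult_fact C.dpow_mult_fact)
    show "dpow ?P n (x \<otimes>\<^bsub>?P\<^esub> y) = nu_pow ?P x n \<otimes>\<^bsub>?P\<^esub> dpow ?P n y"
      using bc bc' n by (simp add: nu B.dpow_mult_left C.dpow_mult_left)
    show "dpow ?P n (x \<otimes>\<^bsub>?P\<^esub> y) = dpow ?P n x \<otimes>\<^bsub>?P\<^esub> nu_pow ?P y n"
      using bc bc' n by (simp add: nu B.dpow_mult_right C.dpow_mult_right)
  next
    fix x assume "x \<in> carrier ?P"
    then show "dpow ?P 1 x = x"
      using B.dpow_1 C.dpow_1 by auto
  qed
qed

section \<open>Concrete categories\<close>

lemma concrete_category_simps [simp]:
  "Obj (concrete_category Ob U H) = Ob"
  "Dom (concrete_category Ob U H) = src"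
  "Cod (concrete_category Ob U H) = tgt"
  "Id (concrete_category Ob U H) B = Arrow B (\<lambda>x\<in>U B. x) B"
  "g \<bullet>\<^bsub>concrete_category Ob U H\<^esub> f = Arrow (src f) (compose (U (src f)) (mor g) (mor f)) (tgt g)"
  by (simp_all add: concrete_category_def)

lemma concrete_category_Arr:
  "f \<in> Arr (concrete_category Ob U H) \<longleftrightarrow>
    src f \<in> Ob \<and> tgt f \<in> Ob \<and> mor f \<in> U (src f) \<rightarrow>\<^sub>E U (tgt f) \<and> H (src f) (tgt f) (mor f)"
  by (cases f) (auto simp: concrete_category_def)

lemma concrete_category_hom_set:
  "f \<in> hom_set (concrete_category Ob U H) B C \<longleftrightarrow>
    src f = B \<and> tgt f = C \<and> B \<in> Ob \<and> C \<in> Ob \<and> mor f \<in> U B \<rightarrow>\<^sub>E U C \<and> H B C (mor f)"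
  by (auto simp: hom_set_def concrete_category_Arr)

lemma arrow_eqI: "\<lbrakk>src f = src g; tgt f = tgt g; mor f = mor g\<rbrakk> \<Longrightarrow> f = g"
  by (cases f; cases g) simp

lemma category_concrete_category:
  assumes "\<And>B. B \<in> Ob \<Longrightarrow> H B B (\<lambda>x\<in>U B. x)"
    and "\<And>B C D f g. \<lbrakk>B \<in> Ob; C \<in> Ob; D \<in> Ob; f \<in> U B \<rightarrow> U C; g \<in> U C \<rightarrow> U D; H B C f; H C D g\<rbrakk>
      \<Longrightarrow> H B D (compose (U B) g f)"
  shows "category (concrete_category Ob U H)"
proof (rule category.intro)
  let ?C = "concrete_category Ob U H"
  show "f \<bullet>\<^bsub>?C\<^esub> Id ?C B = f" if "f \<in> hom_set ?C B C" for f B C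
    using that by (intro arrow_eqI) (auto simp: concrete_category_hom_set compose_def PiE_iff extensional_def)
  show "Id ?C C \<bullet>\<^bsub>?C\<^esub> f = f" if "f \<in> hom_set ?C B C" for f B C
    using that by (intro arrow_eqI) (auto simp: concrete_category_hom_set compose_def PiE_iff extensional_def Pi_iff fun_eq_iff)
  show "g \<bullet>\<^bsub>?C\<^esub> f \<in> hom_set ?C B D" if "f \<in> hom_set ?C B C" "g \<in> hom_set ?C C D" for f g B C D
    using that assms(2)[of B C D "mor f" "mor g"]
    by (auto simp: concrete_category_hom_set compose_def PiE_iff Pi_iff)
  show "h \<bullet>\<^bsub>?C\<^esub> (g \<bullet>\<^bsub>?C\<^esub> f) = h \<bullet>\<^bsub>?C\<^esub> g \<bullet>\<^bsub>?C\<^esub> f"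
    if "f \<in> hom_set ?C B C" "g \<in> hom_set ?C C D" "h \<in> hom_set ?C D E" for f g h B C D E
    using that by (intro arrow_eqI) (auto simp: concrete_category_hom_set compose_def PiE_iff Pi_iff fun_eq_iff)
qed (use assms in \<open>auto simp: concrete_category_Arr concrete_category_hom_set\<close>)

abbreviation dp_homs ::
  "'f ring \<Rightarrow> ('f, 'u) dp_algebra \<Rightarrow> ('f, 'u) dp_algebra \<Rightarrow> ('f, 'u) dp_arrow set" where
  "dp_homs F \<equiv> hom_set (Gamma_alg F)"

lemma category_Gamma_alg:
  fixes F :: "'f ring"
  shows "category (Gamma_alg F :: (('f, 'u) dp_algebra, ('f, 'u) dp_arrow) category)"
  unfolding Gamma_alg_def
proof (rule category_concrete_category)
  fix B C D :: "('f, 'u) dp_algebra" and f g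
  show "dp_hom F B B (\<lambda>x\<in>carrier B. x)" if "B \<in> {A. divided_power_algebra F A}"
  proof -
    interpret divided_power_algebra F B using that by simp
    show ?thesis
      by (auto simp: dp_hom_def linear_hom_def mult_closed dpow_closed)
  qed
  show "dp_hom F B D (compose (carrier B) g f)"
    if "B \<in> {A. divided_power_algebra F A}" "f \<in> carrier B \<rightarrow> carrier C" "dp_hom F B C f" "dp_hom F C D g"
  proof -
    interpret divided_power_algebra F B using that by simp
    show ?thesis using that
      by (auto simp: dp_hom_def linear_hom_def mult_closed dpow_closed compose_def Pi_iff)
  qed
qed

lemma tangent_simps [simp]:
  "Obj (algebraic_tangent F p) = {A. divided_power_algebra F A}"
  "Arr (algebraic_tangent F p) = Arr (Gamma_alg F)"
  "Dom (algebraic_tangent F p) = src"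
  "Cod (algebraic_tangent F p) = tgt"
  "Id (algebraic_tangent F p) B = Arrow B (\<lambda>x\<in>carrier B. x) B"
  "g \<bullet>\<^bsub>algebraic_tangent F p\<^esub> f = Arrow (src f) (compose (carrier (src f)) (mor g) (mor f)) (tgt g)"
  "T_obj (algebraic_tangent F p) = T_alg F p"
  "T_arr (algebraic_tangent F p) = T_hom F p"
  "tan_p (algebraic_tangent F p) = p_alg F p"
  "T2_fst (algebraic_tangent F p) B = fun_arrow (T2_alg F p B) ufst (T_alg F p B)"
  "T2_snd (algebraic_tangent F p) B = fun_arrow (T2_alg F p B) usnd (T_alg F p B)"
  "tan_s (algebraic_tangent F p) B = fun_arrow (T2_alg F p B)
     (\<lambda>x. upair (ufst (ufst x)) (usnd (ufst x) \<oplus>\<^bsub>B\<^esub> usnd (usnd x))) (T_alg F p B)"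
  "tan_z (algebraic_tangent F p) B = fun_arrow B (\<lambda>a. upair a \<zero>\<^bsub>B\<^esub>) (T_alg F p B)"
  "tan_l (algebraic_tangent F p) B = fun_arrow (T_alg F p B)
     (\<lambda>x. upair (upair (ufst x) \<zero>\<^bsub>B\<^esub>) (upair \<zero>\<^bsub>B\<^esub> (usnd x))) (T_alg F p (T_alg F p B))"
  by (simp_all add: algebraic_tangent_def Let_def Gamma_alg_def)

lemma hom_set_tangent [simp]: "hom_set (algebraic_tangent F p) = dp_homs F"
  by (simp add: hom_set_def fun_eq_iff) (simp add: Gamma_alg_def)

lemma category_algebraic_tangent:
  fixes F :: "'f ring"
  shows "category (algebraic_tangent F p :: (('f, 'u::infinite) dp_algebra, ('f, 'u) dp_arrow) tangent_category)"
proof -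
  let ?X = "algebraic_tangent F p :: (('f, 'u) dp_algebra, ('f, 'u) dp_arrow) tangent_category"
  have "Id ?X = Id (Gamma_alg F)" "Comp ?X = Comp (Gamma_alg F)"
    "Obj ?X = Obj (Gamma_alg F)"
    "Dom ?X = Dom (Gamma_alg F)" "Cod ?X = Cod (Gamma_alg F)"
    by (simp_all add: algebraic_tangent_def Let_def)
  then show ?thesis
    using category_Gamma_alg[of F] by (simp add: category_def del: tangent_simps(1,3-6))
qed

lemma dp_homs_iff:
  "f \<in> dp_homs F B C \<longleftrightarrow> src f = B \<and> tgt f = C \<and> divided_power_algebra F B \<and> divided_power_algebra F C \<and>
     mor f \<in> carrier B \<rightarrow>\<^sub>E carrier C \<and> dp_hom F B C (mor f)"
  by (simp add: Gamma_alg_def concrete_category_hom_set)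

lemma Arr_Gamma_alg: "f \<in> Arr (Gamma_alg F) \<longleftrightarrow> f \<in> dp_homs F (src f) (tgt f)"
  by (simp add: hom_set_def Gamma_alg_def)

lemma
  assumes "f \<in> dp_homs F B C"
  shows dp_homs_src: "src f = B" and dp_homs_tgt: "tgt f = C"
    and dp_homs_dom: "divided_power_algebra F B" and dp_homs_cod: "divided_power_algebra F C"
    and dp_homs_closed: "\<And>x. x \<in> carrier B \<Longrightarrow> mor f x \<in> carrier C"
    and dp_homs_add: "\<And>x y. \<lbrakk>x \<in> carrier B; y \<in> carrier B\<rbrakk> \<Longrightarrow> mor f (x \<oplus>\<^bsub>B\<^esub> y) = mor f x \<oplus>\<^bsub>C\<^esub> mor f y"
    and dp_homs_smult: "\<And>c x. \<lbrakk>c \<in> carrier F; x \<in> carrier B\<rbrakk> \<Longrightarrow> mor f (c \<odot>\<^bsub>B\<^esub> x) = c \<odot>\<^bsub>C\<^esub> mor f x"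
    and dp_homs_mult: "\<And>x y. \<lbrakk>x \<in> carrier B; y \<in> carrier B\<rbrakk> \<Longrightarrow> mor f (x \<otimes>\<^bsub>B\<^esub> y) = mor f x \<otimes>\<^bsub>C\<^esub> mor f y"
    and dp_homs_dpow: "\<And>n x. \<lbrakk>1 \<le> n; x \<in> carrier B\<rbrakk> \<Longrightarrow> mor f (dpow B n x) = dpow C n (mor f x)"
  using assms by (auto simp: dp_homs_iff dp_hom_def linear_hom_def)

lemma
  assumes "f \<in> dp_homs F B C"
  shows dp_homs_zero: "mor f \<zero>\<^bsub>B\<^esub> = \<zero>\<^bsub>C\<^esub>"
    and dp_homs_minus: "\<And>x. x \<in> carrier B \<Longrightarrow> mor f (\<ominus>\<^bsub>B\<^esub> x) = \<ominus>\<^bsub>C\<^esub> mor f x"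
proof -
  interpret B: divided_power_algebra F B using assms by (rule dp_homs_dom)
  interpret C: divided_power_algebra F C using assms by (rule dp_homs_cod)
  have "linear_hom F B C (mor f)" "mor f \<in> carrier B \<rightarrow> carrier C"
    using assms by (auto simp: dp_homs_iff dp_hom_def)
  from linear_hom_zero[OF this B.module C.module] linear_hom_minus[OF this B.module C.module]
  show "mor f \<zero>\<^bsub>B\<^esub> = \<zero>\<^bsub>C\<^esub>" "\<And>x. x \<in> carrier B \<Longrightarrow> mor f (\<ominus>\<^bsub>B\<^esub> x) = \<ominus>\<^bsub>C\<^esub> mor f x" .
qed

lemma dp_homs_eqI:
  assumes "f \<in> dp_homs F B C" "g \<in> dp_homs F B C" "\<And>x. x \<in> carrier B \<Longrightarrow> mor f x = mor g x"
  shows "f = g"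
  using assms by (intro arrow_eqI) (auto simp: dp_homs_iff intro: PiE_ext)

lemma mor_fun_arrow [simp]: "x \<in> carrier B \<Longrightarrow> mor (fun_arrow B f C) x = f x"
  by (simp add: fun_arrow_def)

lemma fun_arrow_src_tgt [simp]: "src (fun_arrow B f C) = B" "tgt (fun_arrow B f C) = C"
  by (simp_all add: fun_arrow_def)

lemma fun_arrow_homs:
  assumes "divided_power_algebra F B" "divided_power_algebra F C"
    and "\<And>x. x \<in> carrier B \<Longrightarrow> f x \<in> carrier C"
    and "\<And>x y. \<lbrakk>x \<in> carrier B; y \<in> carrier B\<rbrakk> \<Longrightarrow> f (x \<oplus>\<^bsub>B\<^esub> y) = f x \<oplus>\<^bsub>C\<^esub> f y"
    and "\<And>c x. \<lbrakk>c \<in> carrier F; x \<in> carrier B\<rbrakk> \<Longrightarrow> f (c \<odot>\<^bsub>B\<^esub> x) = c \<odot>\<^bsub>C\<^esub> f x"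
    and "\<And>x y. \<lbrakk>x \<in> carrier B; y \<in> carrier B\<rbrakk> \<Longrightarrow> f (x \<otimes>\<^bsub>B\<^esub> y) = f x \<otimes>\<^bsub>C\<^esub> f y"
    and "\<And>n x. \<lbrakk>1 \<le> n; x \<in> carrier B\<rbrakk> \<Longrightarrow> f (dpow B n x) = dpow C n (f x)"
  shows "fun_arrow B f C \<in> dp_homs F B C"
proof -
  interpret divided_power_algebra F B by fact
  show ?thesis using assms
    by (auto simp: dp_homs_iff fun_arrow_def dp_hom_def linear_hom_def mult_closed dpow_closed)
qed

lemma comp_homs:
  "\<lbrakk>f \<in> dp_homs F B C; g \<in> dp_homs F C D\<rbrakk> \<Longrightarrow> g \<bullet>\<^bsub>algebraic_tangent F p\<^esub> f \<in> dp_homs F B D"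
  using category.Comp_hom[OF category_algebraic_tangent] by (metis hom_set_tangent)

lemma Id_homs: "divided_power_algebra F B \<Longrightarrow> Id (algebraic_tangent F p) B \<in> dp_homs F B B"
  using category.Id_hom[OF category_algebraic_tangent, of B F p] by simp

lemma comp_eqI:
  assumes "\<And>x. x \<in> carrier (src f) \<Longrightarrow> mor g (mor f x) = mor g' (mor f' x)" "src f = src f'" "tgt g = tgt g'"
  shows "g \<bullet>\<^bsub>algebraic_tangent F p\<^esub> f = g' \<bullet>\<^bsub>algebraic_tangent F p\<^esub> f'"
  using assms by (auto simp: compose_def)

lemma comp_eqD:
  assumes "g \<bullet>\<^bsub>algebraic_tangent F p\<^esub> f = g' \<bullet>\<^bsub>algebraic_tangent F p\<^esub> f'" "x \<in> carrier (src f)"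
  shows "mor g (mor f x) = mor g' (mor f' x)"
  using assms by (auto simp: compose_def fun_eq_iff) metis

section \<open>Pointwise pullbacks\<close>

text \<open>A unique solution for each element is enough: the resulting map respects every operation
  because both sides of each law solve the same equations. The index set is arbitrary, so that one
  statement covers pullbacks and n-fold pullbacks.\<close>

lemma factor_homs:
  assumes P: "divided_power_algebra F P" and W: "divided_power_algebra F W"
    and h: "\<And>i. i \<in> I \<Longrightarrow> h i \<in> dp_homs F P (B i)" and u: "\<And>i. i \<in> I \<Longrightarrow> u i \<in> dp_homs F W (B i)"
    and ex: "\<And>w. w \<in> carrier W \<Longrightarrow> \<exists>!z. z \<in> carrier P \<and> (\<forall>i\<in>I. mor (h i) z = mor (u i) w)"
  shows "\<exists>!w. w \<in> dp_homs F W P \<and> (\<forall>i\<in>I. h i \<bullet>\<^bsub>algebraic_tangent F p\<^esub> w = u i)"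
proof -
  interpret P: divided_power_algebra F P by fact
  interpret W: divided_power_algebra F W by fact
  define k where "k = (\<lambda>w. THE z. z \<in> carrier P \<and> (\<forall>i\<in>I. mor (h i) z = mor (u i) w))"
  have k: "k w \<in> carrier P" "i \<in> I \<Longrightarrow> mor (h i) (k w) = mor (u i) w" if "w \<in> carrier W" for w i
    using theI'[OF ex[OF that]] by (auto simp: k_def)
  have k_eq: "k w = z" if "w \<in> carrier W" "z \<in> carrier P" "\<And>i. i \<in> I \<Longrightarrow> mor (h i) z = mor (u i) w" for w z
    using ex[OF that(1)] k[OF that(1)] that by blast
  have mem: "fun_arrow W k P \<in> dp_homs F W P"
    by (rule fun_arrow_homs[OF W P])
      (auto intro!: k_eq P.mult_closed P.dpow_closed W.mult_closed W.dpow_closed simp: k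
        dp_homs_add[OF h] dp_homs_smult[OF h] dp_homs_mult[OF h] dp_homs_dpow[OF h]
        dp_homs_add[OF u] dp_homs_smult[OF u] dp_homs_mult[OF u] dp_homs_dpow[OF u])
  show ?thesis
  proof (rule ex1I[of _ "fun_arrow W k P"], intro conjI ballI mem)
    show "h i \<bullet>\<^bsub>algebraic_tangent F p\<^esub> fun_arrow W k P = u i" if "i \<in> I" for i
      by (rule dp_homs_eqI[OF comp_homs[OF mem h] u]) (use that k in \<open>auto simp: compose_def\<close>)
    fix w assume w: "w \<in> dp_homs F W P \<and> (\<forall>i\<in>I. h i \<bullet>\<^bsub>algebraic_tangent F p\<^esub> w = u i)"
    then have w1: "w \<in> dp_homs F W P" by simp
    have "mor (h i) (mor w x) = mor (u i) x" if "i \<in> I" "x \<in> carrier W" for i x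
    proof -
      have "mor (h i \<bullet>\<^bsub>algebraic_tangent F p\<^esub> w) x = mor (u i) x" using w that(1) by simp
      then show ?thesis using that(2) dp_homs_src[OF w1] by (simp add: compose_def)
    qed
    then show "w = fun_arrow W k P"
      by (intro dp_homs_eqI[OF w1 mem]) (auto intro!: k_eq[symmetric] dp_homs_closed[OF w1])
  qed
qed

text \<open>The square becomes a pullback of sets after forgetting the algebra structure. Unlike
  \<open>is_pullback\<close>, this involves no test objects, so it can be evaluated on elements and
  carried through T.\<close>

definition pointwise_pullback ::
  "'f ring \<Rightarrow> ('f, 'u) dp_arrow \<Rightarrow> ('f, 'u) dp_arrow \<Rightarrow> ('f, 'u) dp_arrow \<Rightarrow> ('f, 'u) dp_arrow \<Rightarrow> bool" where
  "pointwise_pullback F f g h k \<longleftrightarrow>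
     f \<in> dp_homs F (src f) (tgt f) \<and> g \<in> dp_homs F (src g) (tgt f) \<and>
     h \<in> dp_homs F (src h) (src f) \<and> k \<in> dp_homs F (src h) (src g) \<and>
     (\<forall>w\<in>carrier (src h). mor f (mor h w) = mor g (mor k w)) \<and>
     (\<forall>x\<in>carrier (src f). \<forall>y\<in>carrier (src g). mor f x = mor g y \<longrightarrow>
       (\<exists>!w. w \<in> carrier (src h) \<and> mor h w = x \<and> mor k w = y))"

lemma fibre_product_homs:
  fixes f g :: "('f, 'u::infinite) dp_arrow"
  assumes "f \<in> dp_homs F B Z" "g \<in> dp_homs F C Z"
  shows "divided_power_algebra F (fibre_product f g)"
    and "fun_arrow (fibre_product f g) ufst B \<in> dp_homs F (fibre_product f g) B"
    and "fun_arrow (fibre_product f g) usnd C \<in> dp_homs F (fibre_product f g) C"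
proof -
  have s: "src f = B" "src g = C" using assms by (auto simp: dp_homs_iff)
  show 1: "divided_power_algebra F (fibre_product f g)"
    by (rule divided_power_algebra_fibre_product[of _ _ _ Z]) (use assms in \<open>auto simp: dp_homs_iff\<close>)
  show "fun_arrow (fibre_product f g) ufst B \<in> dp_homs F (fibre_product f g) B"
    "fun_arrow (fibre_product f g) usnd C \<in> dp_homs F (fibre_product f g) C"
    by (rule fun_arrow_homs[OF 1]; use assms s in \<open>auto simp: dp_homs_iff\<close>)+
qed

lemma pointwise_pullback_fibre_product:
  fixes f g :: "('f, 'u::infinite) dp_arrow"
  assumes "f \<in> dp_homs F B Z" "g \<in> dp_homs F C Z"
  shows "pointwise_pullback F f g (fun_arrow (fibre_product f g) ufst B) (fun_arrow (fibre_product f g) usnd C)"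
proof -
  have s: "src f = B" "src g = C" "tgt f = Z" using assms by (auto simp: dp_homs_iff)
  show ?thesis
    unfolding pointwise_pullback_def fun_arrow_src_tgt s
  proof (intro conjI ballI impI assms fibre_product_homs[OF assms])
    show "mor f (mor (fun_arrow (fibre_product f g) ufst B) w) = mor g (mor (fun_arrow (fibre_product f g) usnd C) w)"
      if "w \<in> carrier (fibre_product f g)" for w
      using that by auto
    show "\<exists>!w. w \<in> carrier (fibre_product f g) \<and> mor (fun_arrow (fibre_product f g) ufst B) w = x \<and>
        mor (fun_arrow (fibre_product f g) usnd C) w = y"
      if "x \<in> carrier B" "y \<in> carrier C" "mor f x = mor g y" for x y
      by (rule ex1I[of _ "upair x y"]) (use that s in auto)
  qed
qed

lemma is_pullback_if_pointwise:
  assumes "pointwise_pullback F f g h k"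
  shows "is_pullback (algebraic_tangent F p) f g h k"
proof -
  let ?X = "algebraic_tangent F p"
  note pb = assms[unfolded pointwise_pullback_def]
  have comm: "f \<bullet>\<^bsub>?X\<^esub> h = g \<bullet>\<^bsub>?X\<^esub> k"
    using pb by (intro comp_eqI) (auto simp: dp_homs_iff)
  have univ: "\<forall>W\<in>{A. divided_power_algebra F A}. \<forall>u\<in>dp_homs F W (src f). \<forall>v\<in>dp_homs F W (src g).
      f \<bullet>\<^bsub>?X\<^esub> u = g \<bullet>\<^bsub>?X\<^esub> v \<longrightarrow>
      (\<exists>!w. w \<in> dp_homs F W (src h) \<and> h \<bullet>\<^bsub>?X\<^esub> w = u \<and> k \<bullet>\<^bsub>?X\<^esub> w = v)"
  proof (intro ballI impI)
    fix W u v assume "W \<in> {A. divided_power_algebra F A}"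
      and u: "u \<in> dp_homs F W (src f)" and v: "v \<in> dp_homs F W (src g)"
      and eq: "f \<bullet>\<^bsub>?X\<^esub> u = g \<bullet>\<^bsub>?X\<^esub> v"
    then have W: "divided_power_algebra F W" by simp
    have "mor f (mor u x) = mor g (mor v x)" if "x \<in> carrier W" for x
      using comp_eqD[OF eq] that dp_homs_src[OF u] by simp
    then have ex: "\<exists>!z. z \<in> carrier (src h) \<and> mor h z = mor u x \<and> mor k z = mor v x" if "x \<in> carrier W" for x
      using pb dp_homs_closed[OF u that] dp_homs_closed[OF v that] that by blast
    have P: "divided_power_algebra F (src h)" using pb by (auto simp: dp_homs_iff)
    \<comment> \<open>The two legs are treated as a family indexed by truth values.\<close>
    have "\<exists>!w. w \<in> dp_homs F W (src h) \<and> (\<forall>i\<in>UNIV. (if i then h else k) \<bullet>\<^bsub>?X\<^esub> w = (if i then u else v))"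
      by (rule factor_homs[OF P W, of _ _ "\<lambda>i. if i then src f else src g"])
        (use pb u v ex in \<open>auto simp: all_bool_eq\<close>)
    then show "\<exists>!w. w \<in> dp_homs F W (src h) \<and> h \<bullet>\<^bsub>?X\<^esub> w = u \<and> k \<bullet>\<^bsub>?X\<^esub> w = v"
      by (simp add: all_bool_eq)
  qed
  have f: "f \<in> dp_homs F (src f) (tgt f)" and g: "g \<in> dp_homs F (src g) (tgt g)"
    and eq: "tgt f = tgt g" and h: "h \<in> dp_homs F (src h) (src f)" and k: "k \<in> dp_homs F (src h) (src g)"
    using pb by (auto simp: dp_homs_iff)
  show ?thesis
    unfolding is_pullback_def tangent_simps(1-4) hom_set_tangent Arr_Gamma_alg
    by (intro conjI) fact+
qed

text \<open>The explicit fibre product P is itself a test object. The universal property gives w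
  from P to the abstract pullback, with h w and k w the projections of P; pairing h and k gives v
  back to P. Uniqueness of factorizations forces w v = id, so the abstract pullback is in bijection
  with P.\<close>

lemma pointwise_if_is_pullback:
  fixes f :: "('f, 'u::infinite) dp_arrow"
  assumes "is_pullback (algebraic_tangent F p) f g h k"
  shows "pointwise_pullback F f g h k"
proof -
  let ?X = "algebraic_tangent F p"
  have eq: "tgt f = tgt g" using assms by (simp add: is_pullback_def del: tangent_simps(6))
  have f: "f \<in> dp_homs F (src f) (tgt f)" and g: "g \<in> dp_homs F (src g) (tgt f)"
    and h: "h \<in> dp_homs F (src h) (src f)" and k: "k \<in> dp_homs F (src h) (src g)"
    and comm: "f \<bullet>\<^bsub>?X\<^esub> h = g \<bullet>\<^bsub>?X\<^esub> k"
    and univ: "\<And>W u v. \<lbrakk>divided_power_algebra F W; u \<in> dp_homs F W (src f); v \<in> dp_homs F W (src g);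
      f \<bullet>\<^bsub>?X\<^esub> u = g \<bullet>\<^bsub>?X\<^esub> v\<rbrakk> \<Longrightarrow> \<exists>!w. w \<in> dp_homs F W (src h) \<and> h \<bullet>\<^bsub>?X\<^esub> w = u \<and> k \<bullet>\<^bsub>?X\<^esub> w = v"
    using assms by (simp_all add: is_pullback_def Arr_Gamma_alg eq del: tangent_simps(6))
  have fghk: "mor f (mor h w) = mor g (mor k w)" if "w \<in> carrier (src h)" for w
    using comp_eqD[OF comm that] .
  let ?P = "fibre_product f g"
  define pr1 where "pr1 = fun_arrow ?P ufst (src f)"
  define pr2 where "pr2 = fun_arrow ?P usnd (src g)"
  note P = fibre_product_homs[OF f g, folded pr1_def pr2_def]
  have "f \<bullet>\<^bsub>?X\<^esub> pr1 = g \<bullet>\<^bsub>?X\<^esub> pr2"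
    by (rule comp_eqI) (auto simp: pr1_def pr2_def dp_homs_tgt[OF g])
  then obtain w where w: "w \<in> dp_homs F ?P (src h)" "h \<bullet>\<^bsub>?X\<^esub> w = pr1" "k \<bullet>\<^bsub>?X\<^esub> w = pr2"
    using univ[OF P] by blast
  have w_proj: "mor h (mor w (upair x y)) = x" "mor k (mor w (upair x y)) = y"
    if "x \<in> carrier (src f)" "y \<in> carrier (src g)" "mor f x = mor g y" for x y
  proof -
    have xy: "upair x y \<in> carrier ?P" using that by auto
    have "mor (h \<bullet>\<^bsub>?X\<^esub> w) (upair x y) = x" "mor (k \<bullet>\<^bsub>?X\<^esub> w) (upair x y) = y"
      unfolding w using xy by (simp_all add: pr1_def pr2_def del: fibre_product_simps)
    then show "mor h (mor w (upair x y)) = x" "mor k (mor w (upair x y)) = y"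
      using xy dp_homs_src[OF w(1)] by (simp_all add: compose_def del: fibre_product_simps)
  qed
  define v where "v = fun_arrow (src h) (\<lambda>z. upair (mor h z) (mor k z)) ?P"
  have v: "v \<in> dp_homs F (src h) ?P"
    unfolding v_def
    by (rule fun_arrow_homs[OF dp_homs_dom[OF h] P(1)])
      (auto simp: dp_homs_closed[OF h] dp_homs_closed[OF k] fghk dp_homs_add[OF h] dp_homs_add[OF k]
        dp_homs_smult[OF h] dp_homs_smult[OF k] dp_homs_mult[OF h] dp_homs_mult[OF k]
        dp_homs_dpow[OF h] dp_homs_dpow[OF k])
  have v_mor: "mor v z = upair (mor h z) (mor k z)" if "z \<in> carrier (src h)" for z
    using that by (simp add: v_def)
  have retract: "mor w (mor v z) = z" if "z \<in> carrier (src h)" for z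
  proof -
    \<comment> \<open>Both w v and the identity factor the pair (h, k) through the pullback.\<close>
    have "w \<bullet>\<^bsub>?X\<^esub> v = Id ?X (src h)"
    proof -
      have 1: "w \<bullet>\<^bsub>?X\<^esub> v \<in> dp_homs F (src h) (src h)" by (rule comp_homs[OF v w(1)])
      have 2: "Id ?X (src h) \<in> dp_homs F (src h) (src h)" by (rule Id_homs[OF dp_homs_dom[OF h]])
      have 3: "h \<bullet>\<^bsub>?X\<^esub> Id ?X (src h) = h" "k \<bullet>\<^bsub>?X\<^esub> Id ?X (src h) = k"
        using category.Comp_Id[OF category_algebraic_tangent] h k by (metis hom_set_tangent)+
      have 4: "h \<bullet>\<^bsub>?X\<^esub> (w \<bullet>\<^bsub>?X\<^esub> v) = h" "k \<bullet>\<^bsub>?X\<^esub> (w \<bullet>\<^bsub>?X\<^esub> v) = k"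
        by (rule dp_homs_eqI[OF comp_homs[OF 1 h] h] dp_homs_eqI[OF comp_homs[OF 1 k] k];
            use w_proj v_mor dp_homs_src[OF v] dp_homs_closed[OF h] dp_homs_closed[OF k] fghk in \<open>simp add: compose_def\<close>)+
      from univ[OF dp_homs_dom[OF h] h k comm] 1 2 3 4 show ?thesis by blast
    qed
    then have "mor (w \<bullet>\<^bsub>?X\<^esub> v) z = mor (Id ?X (src h)) z" by (simp only:)
    then show ?thesis using that dp_homs_src[OF v] by (simp add: compose_def)
  qed
  have "\<exists>!z. z \<in> carrier (src h) \<and> mor h z = x \<and> mor k z = y"
    if "x \<in> carrier (src f)" "y \<in> carrier (src g)" "mor f x = mor g y" for x y
  proof (rule ex1I[of _ "mor w (upair x y)"])
    show "mor w (upair x y) \<in> carrier (src h) \<and> mor h (mor w (upair x y)) = x \<and> mor k (mor w (upair x y)) = y"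
      using that w_proj[OF that] dp_homs_closed[OF w(1), of "upair x y"] by simp
    show "z = mor w (upair x y)" if "z \<in> carrier (src h) \<and> mor h z = x \<and> mor k z = y" for z
      using retract[of z] v_mor[of z] that by simp
  qed
  then have univ': "\<forall>x\<in>carrier (src f). \<forall>y\<in>carrier (src g). mor f x = mor g y \<longrightarrow>
       (\<exists>!w. w \<in> carrier (src h) \<and> mor h w = x \<and> mor k w = y)" by blast
  have fghk': "\<forall>w\<in>carrier (src h). mor f (mor h w) = mor g (mor k w)" using fghk by blast
  show ?thesis
    unfolding pointwise_pullback_def by (intro conjI) fact+
qed

text \<open>Replaces the definite description in \<open>pairing\<close> by its defining equations on
  elements. The arrows f and g do not occur in \<open>pairing\<close>; they supply the pullback that
  makes the description well defined.\<close>

lemma pairing_homs: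
  fixes f :: "('f, 'u::infinite) dp_arrow"
  assumes pb: "pointwise_pullback F f g h k" and u: "u \<in> dp_homs F W (src f)" and v: "v \<in> dp_homs F W (src g)"
    and eq: "\<forall>x\<in>carrier W. mor f (mor u x) = mor g (mor v x)"
  shows "pairing (algebraic_tangent F p) h k u v \<in> dp_homs F W (src h)"
    and "\<And>x. x \<in> carrier W \<Longrightarrow> mor h (mor (pairing (algebraic_tangent F p) h k u v) x) = mor u x"
    and "\<And>x. x \<in> carrier W \<Longrightarrow> mor k (mor (pairing (algebraic_tangent F p) h k u v) x) = mor v x"
proof -
  let ?X = "algebraic_tangent F p"
  have ip: "is_pullback ?X f g h k" using pb by (rule is_pullback_if_pointwise)
  have "f \<bullet>\<^bsub>?X\<^esub> u = g \<bullet>\<^bsub>?X\<^esub> v"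
    by (rule comp_eqI) (use eq dp_homs_src[OF u] dp_homs_src[OF v] pb in \<open>auto simp: pointwise_pullback_def dp_homs_iff\<close>)
  then have "\<exists>!w. w \<in> dp_homs F W (src h) \<and> h \<bullet>\<^bsub>?X\<^esub> w = u \<and> k \<bullet>\<^bsub>?X\<^esub> w = v"
    using ip u v dp_homs_dom[OF u] by (simp add: is_pullback_def del: tangent_simps(6))
  from theI'[OF this]
  have w: "pairing ?X h k u v \<in> dp_homs F W (src h)" "h \<bullet>\<^bsub>?X\<^esub> pairing ?X h k u v = u" "k \<bullet>\<^bsub>?X\<^esub> pairing ?X h k u v = v"
    unfolding pairing_def tangent_simps(3) hom_set_tangent dp_homs_src[OF u] by auto
  show "pairing ?X h k u v \<in> dp_homs F W (src h)" by fact
  fix x assume x: "x \<in> carrier W"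
  have "mor (h \<bullet>\<^bsub>?X\<^esub> pairing ?X h k u v) x = mor u x" "mor (k \<bullet>\<^bsub>?X\<^esub> pairing ?X h k u v) x = mor v x"
    unfolding w by simp_all
  then show "mor h (mor (pairing ?X h k u v) x) = mor u x" "mor k (mor (pairing ?X h k u v) x) = mor v x"
    using x dp_homs_src[OF w(1)] by (simp_all add: compose_def)
qed

text \<open>The leg r is kept apart from the projections so that n = 0 makes sense: the 0-fold
  pullback is then a copy of the base.\<close>

definition pointwise_fold_pullback ::
  "'f ring \<Rightarrow> nat \<Rightarrow> ('f, 'u) dp_arrow \<Rightarrow> ('f, 'u) dp_arrow \<Rightarrow> (nat \<Rightarrow> ('f, 'u) dp_arrow) \<Rightarrow> bool" where
  "pointwise_fold_pullback F n q r \<pi> \<longleftrightarrow>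
     q \<in> dp_homs F (src q) (tgt q) \<and> r \<in> dp_homs F (src r) (tgt q) \<and>
     (\<forall>i<n. \<pi> i \<in> dp_homs F (src r) (src q) \<and> (\<forall>w\<in>carrier (src r). mor q (mor (\<pi> i) w) = mor r w)) \<and>
     (\<forall>a\<in>carrier (tgt q). \<forall>u. (\<forall>i<n. u i \<in> carrier (src q) \<and> mor q (u i) = a) \<longrightarrow>
       (\<exists>!w. w \<in> carrier (src r) \<and> mor r w = a \<and> (\<forall>i<n. mor (\<pi> i) w = u i)))"

lemma ball_option:
  "(\<forall>i\<in>insert None (Some ` {..<n}). P i) \<longleftrightarrow> P None \<and> (\<forall>i<(n::nat). P (Some i))"
  by auto

lemma is_fold_pullback_if_pointwise:
  assumes "pointwise_fold_pullback F n q r \<pi>"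
  shows "is_fold_pullback (algebraic_tangent F p) n q r \<pi>"
proof -
  let ?X = "algebraic_tangent F p"
  note pb = assms[unfolded pointwise_fold_pullback_def]
  have q: "q \<in> dp_homs F (src q) (tgt q)" and r: "r \<in> dp_homs F (src r) (tgt q)"
    and \<pi>: "\<And>i. i < n \<Longrightarrow> \<pi> i \<in> dp_homs F (src r) (src q)" using pb by auto
  have comm: "q \<bullet>\<^bsub>?X\<^esub> \<pi> i = r" if "i < n" for i
    by (rule dp_homs_eqI[OF comp_homs[OF \<pi>[OF that] q] r])
      (use pb that dp_homs_src[OF \<pi>[OF that]] in \<open>auto simp: compose_def\<close>)
  have univ: "\<exists>!w. w \<in> dp_homs F W (src r) \<and> r \<bullet>\<^bsub>?X\<^esub> w = s \<and> (\<forall>i<n. \<pi> i \<bullet>\<^bsub>?X\<^esub> w = u i)"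
    if W: "divided_power_algebra F W" and s: "s \<in> dp_homs F W (tgt q)"
      and u: "\<And>i. i < n \<Longrightarrow> u i \<in> dp_homs F W (src q) \<and> q \<bullet>\<^bsub>?X\<^esub> u i = s" for W s u
  proof -
    have qu: "mor q (mor (u i) x) = mor s x" if "i < n" "x \<in> carrier W" for i x
    proof -
      have "mor (q \<bullet>\<^bsub>?X\<^esub> u i) x = mor s x" using u[OF that(1)] by (simp del: tangent_simps)
      moreover have "src (u i) = W" using u[OF that(1)] dp_homs_src by blast
      ultimately show ?thesis using that(2) by (simp add: compose_def)
    qed
    have ex: "\<exists>!z. z \<in> carrier (src r) \<and> mor r z = mor s x \<and> (\<forall>i<n. mor (\<pi> i) z = mor (u i) x)"
      if "x \<in> carrier W" for x
    proof -
      have "mor s x \<in> carrier (tgt q)" by (rule dp_homs_closed[OF s that])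
      moreover have "\<forall>i<n. mor (u i) x \<in> carrier (src q) \<and> mor q (mor (u i) x) = mor s x"
        using qu[OF _ that] dp_homs_closed[OF _ that] u by blast
      ultimately show ?thesis using pb by (elim conjE) (drule bspec, assumption, erule allE[of _ "\<lambda>i. mor (u i) x"], simp)
    qed
    have P: "divided_power_algebra F (src r)" using r by (auto simp: dp_homs_iff)
    \<comment> \<open>The index \<open>None\<close> stands for the leg r and \<open>Some i\<close>
      for the i-th projection.\<close>
    let ?I = "insert None (Some ` {..<n})"
    have ex': "\<exists>!z. z \<in> carrier (src r) \<and>
        (\<forall>i\<in>?I. mor (case i of None \<Rightarrow> r | Some i \<Rightarrow> \<pi> i) z = mor (case i of None \<Rightarrow> s | Some i \<Rightarrow> u i) x)"
      if "x \<in> carrier W" for x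
      using ex[OF that] by (simp only: ball_option option.case)
    have "\<exists>!w. w \<in> dp_homs F W (src r) \<and>
        (\<forall>i\<in>?I. (case i of None \<Rightarrow> r | Some i \<Rightarrow> \<pi> i) \<bullet>\<^bsub>?X\<^esub> w = (case i of None \<Rightarrow> s | Some i \<Rightarrow> u i))"
      by (rule factor_homs[OF P W, of _ _ "\<lambda>i. case i of None \<Rightarrow> tgt q | Some _ \<Rightarrow> src q"])
        (use s u r \<pi> ex' in auto)
    then show ?thesis by (simp only: ball_option option.case)
  qed
  have q': "q \<in> Arr (Gamma_alg F)" using q by (simp add: Arr_Gamma_alg)
  have \<pi>': "\<forall>i<n. \<pi> i \<in> dp_homs F (src r) (src q) \<and> q \<bullet>\<^bsub>?X\<^esub> \<pi> i = r" using \<pi> comm by blast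
  have univ': "\<forall>W\<in>{A. divided_power_algebra F A}. \<forall>s\<in>dp_homs F W (tgt q). \<forall>u.
      (\<forall>i<n. u i \<in> dp_homs F W (src q) \<and> q \<bullet>\<^bsub>?X\<^esub> u i = s) \<longrightarrow>
      (\<exists>!w. w \<in> dp_homs F W (src r) \<and> r \<bullet>\<^bsub>?X\<^esub> w = s \<and> (\<forall>i<n. \<pi> i \<bullet>\<^bsub>?X\<^esub> w = u i))"
    using univ by (intro ballI allI impI) (simp only: mem_Collect_eq)
  show ?thesis
    unfolding is_fold_pullback_def tangent_simps(1-4) hom_set_tangent
    by (intro conjI) fact+
qed

text \<open>Induction on n: the identity of the base is the 0-fold pullback, and the fibre product
  of the leg r of the n-fold one with q is the (n+1)-fold one.\<close>

lemma pointwise_fold_pullback_exists: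
  fixes q :: "('f, 'u::infinite) dp_arrow"
  assumes q: "q \<in> dp_homs F (src q) (tgt q)"
  shows "\<exists>r \<pi>. pointwise_fold_pullback F n q r \<pi>"
proof (induction n)
  case 0
  \<comment> \<open>Identities and composites in \<open>algebraic_tangent F p\<close> are those of
    \<open>Gamma_alg F\<close> for every p; 0 is just a value to name them by.\<close>
  have "Id (algebraic_tangent F 0) (tgt q) \<in> dp_homs F (tgt q) (tgt q)"
    by (rule Id_homs[OF dp_homs_cod[OF q]])
  \<comment> \<open>There are no projections at n = 0, so \<open>undefined\<close> serves as their
    family.\<close>
  then have "pointwise_fold_pullback F 0 q (Id (algebraic_tangent F 0) (tgt q)) undefined"
    using q by (auto simp: pointwise_fold_pullback_def)
  then show ?case by blast
next
  case (Suc n)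
  then obtain r \<pi> where pb: "pointwise_fold_pullback F n q r \<pi>" by blast
  note pb' = pb[unfolded pointwise_fold_pullback_def]
  have r: "r \<in> dp_homs F (src r) (tgt q)" and \<pi>: "\<And>i. i < n \<Longrightarrow> \<pi> i \<in> dp_homs F (src r) (src q)"
    and q\<pi>: "\<And>i w. i < n \<Longrightarrow> w \<in> carrier (src r) \<Longrightarrow> mor q (mor (\<pi> i) w) = mor r w"
    and univ: "\<And>a u. \<lbrakk>a \<in> carrier (tgt q); \<forall>i<n. u i \<in> carrier (src q) \<and> mor q (u i) = a\<rbrakk> \<Longrightarrow>
       \<exists>!w. w \<in> carrier (src r) \<and> mor r w = a \<and> (\<forall>i<n. mor (\<pi> i) w = u i)"
    using pb' by simp_all
  let ?P = "fibre_product r q"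
  let ?X = "algebraic_tangent F 0"
  note P = fibre_product_homs[OF r q]
  let ?f = "fun_arrow ?P ufst (src r)" and ?g = "fun_arrow ?P usnd (src q)"
  define r' where "r' = r \<bullet>\<^bsub>?X\<^esub> ?f"
  define \<pi>' where "\<pi>' = (\<lambda>i. if i < n then \<pi> i \<bullet>\<^bsub>?X\<^esub> ?f else ?g)"
  have r': "r' \<in> dp_homs F ?P (tgt q)" unfolding r'_def by (rule comp_homs[OF P(2) r])
  have \<pi>': "\<pi>' i \<in> dp_homs F ?P (src q)" for i
    unfolding \<pi>'_def using comp_homs[OF P(2) \<pi>] P(3) by auto
  have mr': "mor r' (upair x y) = mor r x" "mor (\<pi>' i) (upair x y) = (if i < n then mor (\<pi> i) x else y)"
    if "x \<in> carrier (src r)" "y \<in> carrier (src q)" "mor r x = mor q y" for x y i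
    using that by (auto simp: r'_def \<pi>'_def compose_def)
  have "\<exists>!w. w \<in> carrier ?P \<and> mor r' w = a \<and> (\<forall>i<Suc n. mor (\<pi>' i) w = u i)"
    if a: "a \<in> carrier (tgt q)" and u: "\<forall>i<Suc n. u i \<in> carrier (src q) \<and> mor q (u i) = a" for a u
  proof -
    have "\<exists>!w. w \<in> carrier (src r) \<and> mor r w = a \<and> (\<forall>i<n. mor (\<pi> i) w = u i)"
      by (rule univ[OF a]) (use u in simp)
    then obtain z where z: "z \<in> carrier (src r)" "mor r z = a" "\<forall>i<n. mor (\<pi> i) z = u i"
      and uniq: "\<And>z'. \<lbrakk>z' \<in> carrier (src r); mor r z' = a; \<forall>i<n. mor (\<pi> i) z' = u i\<rbrakk> \<Longrightarrow> z' = z" by blast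
    show ?thesis
    proof (rule ex1I[of _ "upair z (u n)"])
      show "upair z (u n) \<in> carrier ?P \<and> mor r' (upair z (u n)) = a \<and> (\<forall>i<Suc n. mor (\<pi>' i) (upair z (u n)) = u i)"
        using z u by (auto simp: mr' less_Suc_eq)
      fix w assume w: "w \<in> carrier ?P \<and> mor r' w = a \<and> (\<forall>i<Suc n. mor (\<pi>' i) w = u i)"
      then obtain x y where xy: "w = upair x y" "x \<in> carrier (src r)" "y \<in> carrier (src q)" "mor r x = mor q y" by auto
      have "mor (\<pi>' n) w = u n" using w by blast
      then have "y = u n" using xy by (simp add: mr')
      moreover have "mor (\<pi> i) x = u i" if "i < n" for i
        using w that xy mr'(2)[OF xy(2-4), of i] by simp
      ultimately show "w = upair z (u n)" using uniq[of x] w xy by (auto simp: mr')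
    qed
  qed
  then have univ': "\<forall>a\<in>carrier (tgt q). \<forall>u. (\<forall>i<Suc n. u i \<in> carrier (src q) \<and> mor q (u i) = a) \<longrightarrow>
       (\<exists>!w. w \<in> carrier (src r') \<and> mor r' w = a \<and> (\<forall>i<Suc n. mor (\<pi>' i) w = u i))"
    unfolding dp_homs_src[OF r'] by blast
  have "mor q (mor (\<pi>' i) w) = mor r' w" if "w \<in> carrier ?P" for i w
  proof -
    from that obtain x y where "w = upair x y" "x \<in> carrier (src r)" "y \<in> carrier (src q)" "mor r x = mor q y" by auto
    then show ?thesis by (simp add: mr' q\<pi>)
  qed
  then have \<pi>'': "\<forall>i<Suc n. \<pi>' i \<in> dp_homs F (src r') (src q) \<and>
      (\<forall>w\<in>carrier (src r'). mor q (mor (\<pi>' i) w) = mor r' w)"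
    unfolding dp_homs_src[OF r'] using \<pi>' by blast
  have r'': "r' \<in> dp_homs F (src r') (tgt q)" unfolding dp_homs_src[OF r'] by fact
  have "pointwise_fold_pullback F (Suc n) q r' \<pi>'"
    unfolding pointwise_fold_pullback_def by (intro conjI) fact+
  then show ?case by blast
qed

section \<open>The tangent functor\<close>

lemma self_module_simps [simp]:
  "carrier (self_module A) = carrier A" "zero (self_module A) = zero A" "add (self_module A) = add A"
  "smult (self_module A) = smult A" "act (self_module A) = monoid.mult A"
  by (simp_all add: self_module_def Module.module.extend_def act_module.fields_def underlying_def
      Module.module.truncate_def)

lemma (in divided_power_algebra) dp_module_self: "dp_module F A (self_module A)"
proof (intro dp_module.intro divided_power_algebra_axioms nonunital_module.intro nonunital_module_axioms.intro)
  show "Module.module F (self_module A)" by (rule module_cong[OF module]) simp_all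
qed (simp_all add: mult_closed mult_distrib mult_distrib_right mult_smult mult_smult_right mult_assoc)

lemma dp_module_iff:
  "divided_power_algebra F A \<Longrightarrow> dp_module F A M \<longleftrightarrow> nonunital_module F (underlying A) M"
  by (simp add: dp_module_def)

lemma T_alg_simps [simp]:
  "carrier (T_alg F p A) = {upair a b | a b. a \<in> carrier A \<and> b \<in> carrier A}"
  "x \<otimes>\<^bsub>T_alg F p A\<^esub> y = upair (ufst x \<otimes>\<^bsub>A\<^esub> ufst y)
     ((ufst x \<otimes>\<^bsub>A\<^esub> usnd y) \<oplus>\<^bsub>A\<^esub> (ufst y \<otimes>\<^bsub>A\<^esub> usnd x))"
  "zero (T_alg F p A) = upair \<zero>\<^bsub>A\<^esub> \<zero>\<^bsub>A\<^esub>"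
  "x \<oplus>\<^bsub>T_alg F p A\<^esub> y = upair (ufst x \<oplus>\<^bsub>A\<^esub> ufst y) (usnd x \<oplus>\<^bsub>A\<^esub> usnd y)"
  "c \<odot>\<^bsub>T_alg F p A\<^esub> x = upair (c \<odot>\<^bsub>A\<^esub> ufst x) (c \<odot>\<^bsub>A\<^esub> usnd x)"
  by (simp_all add: T_alg_def)

lemma T_hom_src_tgt [simp]:
  "src (T_hom F p f) = T_alg F p (src f)" "tgt (T_hom F p f) = T_alg F p (tgt f)"
  by (simp_all add: T_hom_def)

lemma mor_T_hom [simp]:
  "\<lbrakk>a \<in> carrier (src f); b \<in> carrier (src f)\<rbrakk> \<Longrightarrow> mor (T_hom F p f) (upair a b) = upair (mor f a) (mor f b)"
  by (simp add: T_hom_def)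

context char_p_field
begin

abbreviation arrow_comp ::
    "('f, 'u::infinite) dp_arrow \<Rightarrow> ('f, 'u) dp_arrow \<Rightarrow> ('f, 'u) dp_arrow"  (infixl \<open>\<star>\<close> 70)
  where "g \<star> f \<equiv> g \<bullet>\<^bsub>algebraic_tangent F p\<^esub> f"

lemma dpow_ltimes_cases:
  fixes A :: "('f, 'u::infinite) dp_algebra"
  assumes "dp_module F A M" "1 \<le> n" "a \<in> carrier A" "x \<in> carrier M"
  shows "dpow (ltimes F p A M) n (upair a x) =
    upair (dpow A n a) (if n = 1 then x else act M (dpow A (n - 1) a) x)"
  using dpow_ltimes[OF assms] assms(2) by (simp add: dpow_act_def)

lemma divided_power_algebra_T:
  fixes A :: "('f, 'u::infinite) dp_algebra"
  assumes "divided_power_algebra F A"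
  shows "divided_power_algebra F (T_alg F p A)"
  unfolding T_alg_def
  by (rule divided_power_algebra_ltimes) (rule divided_power_algebra.dp_module_self[OF assms])

lemma dpow_T:
  fixes A :: "('f, 'u::infinite) dp_algebra"
  assumes "divided_power_algebra F A" "1 \<le> n" "a \<in> carrier A" "b \<in> carrier A"
  shows "dpow (T_alg F p A) n (upair a b) =
    upair (dpow A n a) (if n = 1 then b else dpow A (n - 1) a \<otimes>\<^bsub>A\<^esub> b)"
  using dpow_ltimes_cases[OF divided_power_algebra.dp_module_self[OF assms(1)] assms(2)] assms(3,4)
  by (simp add: T_alg_def)

text \<open>The second component a^[n-1] b of an n-th power is respected because f preserves both
  products and divided powers.\<close>

lemma T_homs:
  fixes f :: "('f, 'u::infinite) dp_arrow"
  assumes "f \<in> dp_homs F B C"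
  shows "T_hom F p f \<in> dp_homs F (T_alg F p B) (T_alg F p C)"
proof -
  interpret B: divided_power_algebra F B using assms by (rule dp_homs_dom)
  interpret C: divided_power_algebra F C using assms by (rule dp_homs_cod)
  have dpow: "upair (mor f (ufst (dpow (T_alg F p B) n x))) (mor f (usnd (dpow (T_alg F p B) n x))) =
      dpow (T_alg F p C) n (upair (mor f (ufst x)) (mor f (usnd x)))"
    if "1 \<le> n" "x \<in> carrier (T_alg F p B)" for n x
    using that dpow_T[OF B.divided_power_algebra_axioms] dpow_T[OF C.divided_power_algebra_axioms]
    by (auto simp: dp_homs_closed[OF assms] dp_homs_dpow[OF assms] dp_homs_mult[OF assms] B.dpow_closed)
  show ?thesis
    unfolding T_hom_def dp_homs_src[OF assms] dp_homs_tgt[OF assms]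
    by (rule fun_arrow_homs[OF divided_power_algebra_T divided_power_algebra_T])
      (auto simp: dpow dp_homs_closed[OF assms] dp_homs_add[OF assms] dp_homs_smult[OF assms]
        dp_homs_mult[OF assms] B.mult_closed B.divided_power_algebra_axioms
        C.divided_power_algebra_axioms simp del: One_nat_def)
qed

lemma T_hom_comp:
  fixes f g :: "('f, 'u::infinite) dp_arrow"
  assumes "f \<in> dp_homs F B C" "g \<in> dp_homs F C D"
  shows "T_hom F p (g \<star> f) =
    T_hom F p g \<star> T_hom F p f"
  by (rule dp_homs_eqI[OF T_homs[OF comp_homs[OF assms]] comp_homs[OF T_homs[OF assms(1)] T_homs[OF assms(2)]]])
    (use assms in \<open>auto simp: compose_def dp_homs_src dp_homs_closed\<close>)

lemma T_hom_Id:
  fixes B :: "('f, 'u::infinite) dp_algebra"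
  assumes "divided_power_algebra F B"
  shows "T_hom F p (Id (algebraic_tangent F p) B) = Id (algebraic_tangent F p) (T_alg F p B)"
  by (rule dp_homs_eqI[OF T_homs[OF Id_homs[OF assms]] Id_homs[OF divided_power_algebra_T[OF assms]]]) auto

text \<open>An element of T B is a pair of elements of B, and T f applies f to both; the square
  under T amounts to two independent copies of the given one.\<close>

lemma pointwise_pullback_T:
  fixes f :: "('f, 'u::infinite) dp_arrow"
  assumes "pointwise_pullback F f g h k"
  shows "pointwise_pullback F (T_hom F p f) (T_hom F p g) (T_hom F p h) (T_hom F p k)"
proof -
  note pb = assms[unfolded pointwise_pullback_def]
  have f: "f \<in> dp_homs F (src f) (tgt f)" and g: "g \<in> dp_homs F (src g) (tgt f)"
    and h: "h \<in> dp_homs F (src h) (src f)" and k: "k \<in> dp_homs F (src h) (src g)"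
    and comm: "\<And>w. w \<in> carrier (src h) \<Longrightarrow> mor f (mor h w) = mor g (mor k w)"
    and univ: "\<And>x y. \<lbrakk>x \<in> carrier (src f); y \<in> carrier (src g); mor f x = mor g y\<rbrakk> \<Longrightarrow>
       \<exists>!w. w \<in> carrier (src h) \<and> mor h w = x \<and> mor k w = y"
    using pb by simp_all
  show ?thesis
    unfolding pointwise_pullback_def T_hom_src_tgt
  proof (intro conjI ballI impI T_homs f g h k)
    show "mor (T_hom F p f) (mor (T_hom F p h) w) = mor (T_hom F p g) (mor (T_hom F p k) w)"
      if "w \<in> carrier (T_alg F p (src h))" for w
      using that dp_homs_src[OF k] by (auto simp: dp_homs_closed[OF h] dp_homs_closed[OF k] comm)
    fix x y assume "x \<in> carrier (T_alg F p (src f))" "y \<in> carrier (T_alg F p (src g))"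
      "mor (T_hom F p f) x = mor (T_hom F p g) y"
    then obtain x1 x2 y1 y2 where xy: "x = upair x1 x2" "y = upair y1 y2" "x1 \<in> carrier (src f)"
      "x2 \<in> carrier (src f)" "y1 \<in> carrier (src g)" "y2 \<in> carrier (src g)" "mor f x1 = mor g y1"
      "mor f x2 = mor g y2" by auto
    obtain w1 w2 where w: "w1 \<in> carrier (src h)" "mor h w1 = x1" "mor k w1 = y1"
      "w2 \<in> carrier (src h)" "mor h w2 = x2" "mor k w2 = y2"
      using univ[OF xy(3,5,7)] univ[OF xy(4,6,8)] by blast
    show "\<exists>!w. w \<in> carrier (T_alg F p (src h)) \<and> mor (T_hom F p h) w = x \<and> mor (T_hom F p k) w = y"
    proof (rule ex1I[of _ "upair w1 w2"])
      show "upair w1 w2 \<in> carrier (T_alg F p (src h)) \<and> mor (T_hom F p h) (upair w1 w2) = x \<and>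
        mor (T_hom F p k) (upair w1 w2) = y"
        using w xy dp_homs_src[OF k] by simp
      fix w assume "w \<in> carrier (T_alg F p (src h)) \<and> mor (T_hom F p h) w = x \<and> mor (T_hom F p k) w = y"
      then obtain v1 v2 where v: "w = upair v1 v2" "v1 \<in> carrier (src h)" "v2 \<in> carrier (src h)"
        "mor h v1 = x1" "mor h v2 = x2" "mor k v1 = y1" "mor k v2 = y2"
        using xy dp_homs_src[OF k] by auto
      then show "w = upair w1 w2"
        using univ[OF xy(3,5,7)] univ[OF xy(4,6,8)] w by blast
    qed
  qed
qed

lemma pointwise_fold_pullback_T:
  fixes q :: "('f, 'u::infinite) dp_arrow"
  assumes "pointwise_fold_pullback F n q r \<pi>"
  shows "pointwise_fold_pullback F n (T_hom F p q) (T_hom F p r) (\<lambda>i. T_hom F p (\<pi> i))"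
proof -
  note pb = assms[unfolded pointwise_fold_pullback_def]
  have q: "q \<in> dp_homs F (src q) (tgt q)" and r: "r \<in> dp_homs F (src r) (tgt q)"
    and \<pi>: "\<And>i. i < n \<Longrightarrow> \<pi> i \<in> dp_homs F (src r) (src q)"
    and comm: "\<And>i w. i < n \<Longrightarrow> w \<in> carrier (src r) \<Longrightarrow> mor q (mor (\<pi> i) w) = mor r w"
    and univ: "\<And>a u. \<lbrakk>a \<in> carrier (tgt q); \<forall>i<n. u i \<in> carrier (src q) \<and> mor q (u i) = a\<rbrakk> \<Longrightarrow>
       \<exists>!w. w \<in> carrier (src r) \<and> mor r w = a \<and> (\<forall>i<n. mor (\<pi> i) w = u i)"
    using pb by simp_all
  show ?thesis
    unfolding pointwise_fold_pullback_def T_hom_src_tgt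
  proof (intro conjI ballI impI allI T_homs q r \<pi>)
    show "mor (T_hom F p q) (mor (T_hom F p (\<pi> i)) w) = mor (T_hom F p r) w"
      if "i < n" "w \<in> carrier (T_alg F p (src r))" for w i
      using that dp_homs_src[OF \<pi>] by (auto simp: dp_homs_closed[OF \<pi>] comm)
    fix a u assume a: "a \<in> carrier (T_alg F p (tgt q))"
      and u: "\<forall>i<n. u i \<in> carrier (T_alg F p (src q)) \<and> mor (T_hom F p q) (u i) = a"
    then obtain a1 a2 where a12: "a = upair a1 a2" "a1 \<in> carrier (tgt q)" "a2 \<in> carrier (tgt q)" by auto
    have u12: "u i = upair (ufst (u i)) (usnd (u i))" "ufst (u i) \<in> carrier (src q)" "usnd (u i) \<in> carrier (src q)"
      "mor q (ufst (u i)) = a1" "mor q (usnd (u i)) = a2" if "i < n" for i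
    proof -
      from u that a12 obtain x y where "u i = upair x y" "x \<in> carrier (src q)" "y \<in> carrier (src q)"
        "mor (T_hom F p q) (upair x y) = upair a1 a2" by auto
      then show "u i = upair (ufst (u i)) (usnd (u i))" "ufst (u i) \<in> carrier (src q)" "usnd (u i) \<in> carrier (src q)"
      "mor q (ufst (u i)) = a1" "mor q (usnd (u i)) = a2" by auto
    qed
    have ex1: "\<exists>!w. w \<in> carrier (src r) \<and> mor r w = a1 \<and> (\<forall>i<n. mor (\<pi> i) w = ufst (u i))"
      by (rule univ) (use a12 u12 in auto)
    have ex2: "\<exists>!w. w \<in> carrier (src r) \<and> mor r w = a2 \<and> (\<forall>i<n. mor (\<pi> i) w = usnd (u i))"
      by (rule univ) (use a12 u12 in auto)
    from ex1 ex2 obtain w1 w2 where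
      w1: "w1 \<in> carrier (src r) \<and> mor r w1 = a1 \<and> (\<forall>i<n. mor (\<pi> i) w1 = ufst (u i))" and
      w2: "w2 \<in> carrier (src r) \<and> mor r w2 = a2 \<and> (\<forall>i<n. mor (\<pi> i) w2 = usnd (u i))"
      by blast
    show "\<exists>!w. w \<in> carrier (T_alg F p (src r)) \<and> mor (T_hom F p r) w = a \<and>
        (\<forall>i<n. mor (T_hom F p (\<pi> i)) w = u i)"
    proof (rule ex1I[of _ "upair w1 w2"], intro conjI allI impI)
      show "mor (T_hom F p (\<pi> i)) (upair w1 w2) = u i" if "i < n" for i
        using w1 w2 that u12(1)[OF that] dp_homs_src[OF \<pi>[OF that]] by simp
      fix w assume w: "w \<in> carrier (T_alg F p (src r)) \<and> mor (T_hom F p r) w = a \<and>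
        (\<forall>i<n. mor (T_hom F p (\<pi> i)) w = u i)"
      then obtain v1 v2 where v: "w = upair v1 v2" "v1 \<in> carrier (src r)" "v2 \<in> carrier (src r)"
        "mor r v1 = a1" "mor r v2 = a2"
        using a12 by auto
      moreover have "mor (\<pi> i) v1 = ufst (u i)" "mor (\<pi> i) v2 = usnd (u i)" if "i < n" for i
      proof -
        have "mor (T_hom F p (\<pi> i)) (upair v1 v2) = u i" using w that v by blast
        then have "upair (mor (\<pi> i) v1) (mor (\<pi> i) v2) = u i" using v dp_homs_src[OF \<pi>[OF that]] by simp
        then show "mor (\<pi> i) v1 = ufst (u i)" "mor (\<pi> i) v2 = usnd (u i)" using u12(1)[OF that] by (metis upair_inject)+
      qed
      ultimately show "w = upair w1 w2"
        using ex1 ex2 w1 w2 by blast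
    qed (use w1 w2 a12 in auto)
  qed
qed

lemma pointwise_pullback_T_iterate:
  fixes f :: "('f, 'u::infinite) dp_arrow"
  assumes "pointwise_pullback F f g h k"
  shows "pointwise_pullback F ((T_hom F p ^^ m) f) ((T_hom F p ^^ m) g) ((T_hom F p ^^ m) h) ((T_hom F p ^^ m) k)"
  by (induction m) (simp_all add: assms pointwise_pullback_T)

lemma pointwise_fold_pullback_T_iterate:
  fixes q :: "('f, 'u::infinite) dp_arrow"
  assumes "pointwise_fold_pullback F n q r \<pi>"
  shows "pointwise_fold_pullback F n ((T_hom F p ^^ m) q) ((T_hom F p ^^ m) r) (\<lambda>i. (T_hom F p ^^ m) (\<pi> i))"
  by (induction m) (simp_all add: assms pointwise_fold_pullback_T)

section \<open>Semidirect products as differential bundles\<close>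

text \<open>Compatibility with divided powers is where the explicit formula is needed. For the lift
  and n \<ge> 2, the product of (a, 0)^[n-1] and (0, m) is (0, a^[n-1] m), the second component of
  the lift of (a, m)^[n].\<close>

lemma
  fixes A :: "('f, 'u::infinite) dp_algebra"
  assumes M: "dp_module F A M"
  defines "E \<equiv> ltimes F p A M"
  shows ltimes_proj_homs: "fun_arrow E ufst A \<in> dp_homs F E A"
    and ltimes_zero_homs: "fun_arrow A (\<lambda>a. upair a \<zero>\<^bsub>M\<^esub>) E \<in> dp_homs F A E"
    and ltimes_lift_homs: "fun_arrow E (\<lambda>x. upair (upair (ufst x) \<zero>\<^bsub>M\<^esub>) (upair \<zero>\<^bsub>A\<^esub> (usnd x))) (T_alg F p E)
      \<in> dp_homs F E (T_alg F p E)"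
    and ltimes_add_homs: "fun_arrow (fibre_product (fun_arrow E ufst A) (fun_arrow E ufst A))
        (\<lambda>x. upair (ufst (ufst x)) (usnd (ufst x) \<oplus>\<^bsub>M\<^esub> usnd (usnd x))) E
      \<in> dp_homs F (fibre_product (fun_arrow E ufst A) (fun_arrow E ufst A)) E"
proof -
  interpret dp_module F A M by fact
  have A: "divided_power_algebra F A" by (rule divided_power_algebra_axioms)
  have E: "divided_power_algebra F E" unfolding E_def by (rule divided_power_algebra_ltimes) fact
  note E_simps = ltimes_simps[of F p A M, folded E_def]
  note E_dpow = dpow_ltimes_cases[OF M, folded E_def]
  show q: "fun_arrow E ufst A \<in> dp_homs F E A"
    by (rule fun_arrow_homs[OF E A]) (auto simp: E_simps E_dpow)
  show "fun_arrow A (\<lambda>a. upair a \<zero>\<^bsub>M\<^esub>) E \<in> dp_homs F A E"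
    by (rule fun_arrow_homs[OF A E]) (auto simp: E_simps E_dpow act_zero_right dpow_closed)
  show "fun_arrow E (\<lambda>x. upair (upair (ufst x) \<zero>\<^bsub>M\<^esub>) (upair \<zero>\<^bsub>A\<^esub> (usnd x))) (T_alg F p E)
      \<in> dp_homs F E (T_alg F p E)"
    by (rule fun_arrow_homs[OF E divided_power_algebra_T[OF E]])
      (auto simp: E_simps E_dpow dpow_T[OF E] act_zero_right act_zero_left act_closed mult_zero zero_mult
        dpow_closed)
  show "fun_arrow (fibre_product (fun_arrow E ufst A) (fun_arrow E ufst A))
        (\<lambda>x. upair (ufst (ufst x)) (usnd (ufst x) \<oplus>\<^bsub>M\<^esub> usnd (usnd x))) E
      \<in> dp_homs F (fibre_product (fun_arrow E ufst A) (fun_arrow E ufst A)) E"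
    by (rule fun_arrow_homs[OF fibre_product_homs(1)[OF q q] E])
      (auto simp: E_simps E_dpow act_add_right act_closed mult_closed N.M.a_ac N.smult_r_distr dpow_closed)
qed


text \<open>T B is the semidirect product of B with itself, so its projection and zero section are
  special cases of those for a general module.\<close>

lemma
  fixes B :: "('f, 'u::infinite) dp_algebra"
  assumes "divided_power_algebra F B"
  shows p_alg_homs: "p_alg F p B \<in> dp_homs F (T_alg F p B) B"
    and tan_z_homs: "fun_arrow B (\<lambda>a. upair a \<zero>\<^bsub>B\<^esub>) (T_alg F p B) \<in> dp_homs F B (T_alg F p B)"
  using ltimes_proj_homs[OF divided_power_algebra.dp_module_self[OF assms]]
    ltimes_zero_homs[OF divided_power_algebra.dp_module_self[OF assms]]
  by (simp_all add: p_alg_def T_alg_def)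

text \<open>Each axiom is an equality of arrows that holds on elements once the pairings are
  evaluated; the local facts \<open>plus\<close>, \<open>Tplus\<close> and \<open>T2\<close> do this
  for pairings into E_2, T E_2 and T_2 E.\<close>

lemma differential_bundle_ltimes:
  fixes A :: "('f, 'u::infinite) dp_algebra"
  assumes M: "dp_module F A M"
  defines "E \<equiv> ltimes F p A M"
  defines "q \<equiv> fun_arrow E ufst A"
  defines "E2 \<equiv> fibre_product q q"
  shows "differential_bundle (algebraic_tangent F p) A q (fun_arrow E2 ufst E) (fun_arrow E2 usnd E)
    (fun_arrow E2 (\<lambda>x. upair (ufst (ufst x)) (usnd (ufst x) \<oplus>\<^bsub>M\<^esub> usnd (usnd x))) E)
    (fun_arrow A (\<lambda>a. upair a \<zero>\<^bsub>M\<^esub>) E)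
    (fun_arrow E (\<lambda>x. upair (upair (ufst x) \<zero>\<^bsub>M\<^esub>) (upair \<zero>\<^bsub>A\<^esub> (usnd x))) (T_alg F p E))"
proof -
  interpret dp_module F A M by fact
  let ?X = "algebraic_tangent F p :: (('f, 'u) dp_algebra, ('f, 'u) dp_arrow) tangent_category"
  have A: "divided_power_algebra F A" by (rule divided_power_algebra_axioms)
  have E: "divided_power_algebra F E" unfolding E_def by (rule divided_power_algebra_ltimes) fact
  define \<pi>\<^sub>1 where "\<pi>\<^sub>1 = fun_arrow E2 ufst E"
  define \<pi>\<^sub>2 where "\<pi>\<^sub>2 = fun_arrow E2 usnd E"
  define \<sigma> where "\<sigma> = fun_arrow E2 (\<lambda>x. upair (ufst (ufst x)) (usnd (ufst x) \<oplus>\<^bsub>M\<^esub> usnd (usnd x))) E"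
  define \<zeta> where "\<zeta> = fun_arrow A (\<lambda>a. upair a \<zero>\<^bsub>M\<^esub>) E"
  define lam where "lam = fun_arrow E (\<lambda>x. upair (upair (ufst x) \<zero>\<^bsub>M\<^esub>) (upair \<zero>\<^bsub>A\<^esub> (usnd x))) (T_alg F p E)"
  define z where "z = (\<lambda>B :: ('f, 'u) dp_algebra. fun_arrow B (\<lambda>a. upair a \<zero>\<^bsub>B\<^esub>) (T_alg F p B))"
  have q: "q \<in> dp_homs F E A" and \<zeta>: "\<zeta> \<in> dp_homs F A E" and lam: "lam \<in> dp_homs F E (T_alg F p E)"
    and \<sigma>: "\<sigma> \<in> dp_homs F E2 E"
    unfolding q_def \<zeta>_def lam_def \<sigma>_def E_def E2_def
    by (rule ltimes_proj_homs ltimes_zero_homs ltimes_lift_homs ltimes_add_homs, fact)+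
  note \<pi> = fibre_product_homs[OF q q, folded E2_def, folded \<pi>\<^sub>1_def \<pi>\<^sub>2_def]
  note E2_pb = pointwise_pullback_fibre_product[OF q q, folded E2_def, folded \<pi>\<^sub>1_def \<pi>\<^sub>2_def]
  have zA: "z A \<in> dp_homs F A (T_alg F p A)" and zE: "z E \<in> dp_homs F E (T_alg F p E)"
    using tan_z_homs A E by (auto simp: z_def)
  have arrs [simp]: "src q = E" "tgt q = A" "src \<pi>\<^sub>1 = E2" "tgt \<pi>\<^sub>1 = E" "src \<pi>\<^sub>2 = E2" "tgt \<pi>\<^sub>2 = E"
    "src \<sigma> = E2" "tgt \<sigma> = E" "src \<zeta> = A" "tgt \<zeta> = E" "src lam = E" "tgt lam = T_alg F p E"
    "src (z B) = B" "tgt (z B) = T_alg F p B" for B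
    by (simp_all add: q_def \<pi>\<^sub>1_def \<pi>\<^sub>2_def \<sigma>_def \<zeta>_def lam_def z_def)
  have E_car: "x \<in> carrier E \<longleftrightarrow> (\<exists>a m. x = upair a m \<and> a \<in> carrier A \<and> m \<in> carrier M)" for x
    by (simp add: E_def)
  have E2_car: "x \<in> carrier E2 \<longleftrightarrow> (\<exists>a m n. x = upair (upair a m) (upair a n) \<and>
      a \<in> carrier A \<and> m \<in> carrier M \<and> n \<in> carrier M)" for x
    by (auto simp: E2_def q_def E_car)
  have E_zero [simp]: "\<zero>\<^bsub>E\<^esub> = upair \<zero>\<^bsub>A\<^esub> \<zero>\<^bsub>M\<^esub>" and
    E_add [simp]: "upair a m \<oplus>\<^bsub>E\<^esub> upair b n = upair (a \<oplus>\<^bsub>A\<^esub> b) (m \<oplus>\<^bsub>M\<^esub> n)" for a m b n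
    by (simp_all add: E_def)
  have [simp]: "mor \<zeta> a = upair a \<zero>\<^bsub>M\<^esub>" "mor (z A) a = upair a \<zero>\<^bsub>A\<^esub>" if "a \<in> carrier A" for a
    using that by (simp_all add: \<zeta>_def z_def)
  have [simp]: "mor q (upair a m) = a"
    "mor lam (upair a m) = upair (upair a \<zero>\<^bsub>M\<^esub>) (upair \<zero>\<^bsub>A\<^esub> m)"
    "mor (z E) (upair a m) = upair (upair a m) (upair \<zero>\<^bsub>A\<^esub> \<zero>\<^bsub>M\<^esub>)"
    if "a \<in> carrier A" "m \<in> carrier M" for a m
    using that by (simp_all add: q_def lam_def z_def E_car)
  have [simp]: "mor \<pi>\<^sub>1 (upair (upair a m) (upair a n)) = upair a m"
    "mor \<pi>\<^sub>2 (upair (upair a m) (upair a n)) = upair a n"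
    "mor \<sigma> (upair (upair a m) (upair a n)) = upair a (m \<oplus>\<^bsub>M\<^esub> n)"
    if "a \<in> carrier A" "m \<in> carrier M" "n \<in> carrier M" for a m n
    using that by (simp_all add: \<pi>\<^sub>1_def \<pi>\<^sub>2_def \<sigma>_def E2_car)
  let ?pr = "pairing ?X \<pi>\<^sub>1 \<pi>\<^sub>2"
  let ?Tpr = "pairing ?X (T_hom F p \<pi>\<^sub>1) (T_hom F p \<pi>\<^sub>2)"
  \<comment> \<open>The sum of two arrows into E. The pairing exists because u and v have the same
    first component, that is, lie over the same map to A.\<close>
  have plus: "\<sigma> \<star> ?pr u v \<in> dp_homs F W E \<and>
      (\<forall>x\<in>carrier W. mor (\<sigma> \<star> ?pr u v) x = upair (ufst (mor u x)) (usnd (mor u x) \<oplus>\<^bsub>M\<^esub> usnd (mor v x)))"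
    if u: "u \<in> dp_homs F W E" and v: "v \<in> dp_homs F W E" and
      eq: "\<forall>x\<in>carrier W. ufst (mor u x) = ufst (mor v x)" for u v W
  proof -
    have eq': "\<forall>x\<in>carrier W. mor q (mor u x) = mor q (mor v x)"
      using dp_homs_closed[OF u] dp_homs_closed[OF v] eq by (fastforce simp: E_car)
    note pr = pairing_homs[where p = p, OF E2_pb, unfolded arrs, OF u v eq']
    have "mor (\<sigma> \<star> ?pr u v) x = upair (ufst (mor u x)) (usnd (mor u x) \<oplus>\<^bsub>M\<^esub> usnd (mor v x))"
      if x: "x \<in> carrier W" for x
    proof -
      obtain a m n where w: "mor (?pr u v) x = upair (upair a m) (upair a n)"
        "a \<in> carrier A" "m \<in> carrier M" "n \<in> carrier M"
        using dp_homs_closed[OF pr(1) x] by (auto simp: E2_car)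
      then have "mor \<pi>\<^sub>1 (mor (?pr u v) x) = upair a m" "mor \<pi>\<^sub>2 (mor (?pr u v) x) = upair a n"
        by simp_all
      then have "mor u x = upair a m" "mor v x = upair a n"
        unfolding pr(2,3)[OF x] .
      then show ?thesis using x w dp_homs_src[OF pr(1)] by (simp add: compose_def)
    qed
    then show ?thesis using comp_homs[OF pr(1) \<sigma>] by blast
  qed
  \<comment> \<open>The sum under T: module parts are added in both components, and agreement over T
    A means equality of both algebra parts.\<close>
  have Tplus: "T_hom F p \<sigma> \<star> ?Tpr u v \<in> dp_homs F W (T_alg F p E) \<and>
      (\<forall>x\<in>carrier W. mor (T_hom F p \<sigma> \<star> ?Tpr u v) x =
        upair (upair (ufst (ufst (mor u x))) (usnd (ufst (mor u x)) \<oplus>\<^bsub>M\<^esub> usnd (ufst (mor v x))))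
          (upair (ufst (usnd (mor u x))) (usnd (usnd (mor u x)) \<oplus>\<^bsub>M\<^esub> usnd (usnd (mor v x)))))"
    if u: "u \<in> dp_homs F W (T_alg F p E)" and v: "v \<in> dp_homs F W (T_alg F p E)" and
      eq: "\<forall>x\<in>carrier W. ufst (ufst (mor u x)) = ufst (ufst (mor v x))"
        "\<forall>x\<in>carrier W. ufst (usnd (mor u x)) = ufst (usnd (mor v x))" for u v W
  proof -
    have eq': "\<forall>x\<in>carrier W. mor (T_hom F p q) (mor u x) = mor (T_hom F p q) (mor v x)"
      using dp_homs_closed[OF u] dp_homs_closed[OF v] eq by (fastforce simp: E_car)
    note pr = pairing_homs[where p = p, OF pointwise_pullback_T[OF E2_pb], unfolded T_hom_src_tgt arrs, OF u v eq']
    have "mor (T_hom F p \<sigma> \<star> ?Tpr u v) x =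
        upair (upair (ufst (ufst (mor u x))) (usnd (ufst (mor u x)) \<oplus>\<^bsub>M\<^esub> usnd (ufst (mor v x))))
          (upair (ufst (usnd (mor u x))) (usnd (usnd (mor u x)) \<oplus>\<^bsub>M\<^esub> usnd (usnd (mor v x))))"
      if x: "x \<in> carrier W" for x
    proof -
      obtain a m n b k l where w: "mor (?Tpr u v) x =
          upair (upair (upair a m) (upair a n)) (upair (upair b k) (upair b l))"
        "a \<in> carrier A" "m \<in> carrier M" "n \<in> carrier M" "b \<in> carrier A" "k \<in> carrier M" "l \<in> carrier M"
        using dp_homs_closed[OF pr(1) x] by (auto simp: E2_car)
      then have "mor (T_hom F p \<pi>\<^sub>1) (mor (?Tpr u v) x) = upair (upair a m) (upair b k)"
        "mor (T_hom F p \<pi>\<^sub>2) (mor (?Tpr u v) x) = upair (upair a n) (upair b l)"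
        by (simp_all add: E2_car)
      then have "mor u x = upair (upair a m) (upair b k)" "mor v x = upair (upair a n) (upair b l)"
        unfolding pr(2,3)[OF x] .
      then show ?thesis using x w dp_homs_src[OF pr(1)] by (simp add: compose_def E2_car)
    qed
    then show ?thesis using comp_homs[OF pr(1) T_homs[OF \<sigma>]] by blast
  qed
  let ?T2 = "pairing ?X (T2_fst ?X E) (T2_snd ?X E)"
  \<comment> \<open>The pairing into T_2 E requires equal base points in E, not merely in A.\<close>
  have T2: "?T2 u v \<in> dp_homs F W (T2_alg F p E) \<and>
      (\<forall>x\<in>carrier W. mor (?T2 u v) x = upair (mor u x) (mor v x))"
    if u: "u \<in> dp_homs F W (T_alg F p E)" and v: "v \<in> dp_homs F W (T_alg F p E)" and
      eq: "\<forall>x\<in>carrier W. ufst (mor u x) = ufst (mor v x)" for u v W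
  proof -
    note pE = p_alg_homs[OF E]
    note pb = pointwise_pullback_fibre_product[OF pE pE, folded T2_alg_def]
    have eq': "\<forall>x\<in>carrier W. mor (p_alg F p E) (mor u x) = mor (p_alg F p E) (mor v x)"
      using dp_homs_closed[OF u] dp_homs_closed[OF v] eq by (simp add: p_alg_def del: T_alg_simps)
    note pr = pairing_homs[where p = p, OF pb, unfolded fun_arrow_src_tgt dp_homs_src[OF pE], OF u v eq']
    have "mor (?T2 u v) x = upair (mor u x) (mor v x)"
      if x: "x \<in> carrier W" for x
    proof -
      let ?w = "mor (?T2 u v) x"
      have c: "?w \<in> carrier (T2_alg F p E)" using dp_homs_closed[OF pr(1) x] by simp
      then have "?w = upair (ufst ?w) (usnd ?w)" unfolding T2_alg_def by auto
      moreover have "ufst ?w = mor u x" "usnd ?w = mor v x"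
        using pr(2,3)[OF x] mor_fun_arrow[OF c] by simp_all
      ultimately show ?thesis by simp
    qed
    then show ?thesis using pr(1) by simp
  qed
  have z_eq: "fun_arrow B (\<lambda>a. upair a \<zero>\<^bsub>B\<^esub>) (T_alg F p B) = z B" for B
    by (simp add: z_def)
  have T2_car: "upair x y \<in> carrier (T2_alg F p E) \<longleftrightarrow> x \<in> carrier (T_alg F p E) \<and> y \<in> carrier (T_alg F p E) \<and> ufst x = ufst y" for x y
    by (auto simp: T2_alg_def p_alg_def)
  have "differential_bundle ?X A q \<pi>\<^sub>1 \<pi>\<^sub>2 \<sigma> \<zeta> lam"
  proof (rule differential_bundle.intro, unfold tangent_simps(1-4,7-13) hom_set_tangent arrs z_eq)
    show "A \<in> {A. divided_power_algebra F A}" using A by simp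
    show "is_pullback ?X q q \<pi>\<^sub>1 \<pi>\<^sub>2" by (rule is_pullback_if_pointwise[OF E2_pb])
    show "\<exists>r \<pi>. is_fold_pullback ?X n q r \<pi> \<and> (\<forall>m. is_fold_pullback ?X n ((T_hom F p ^^ m) q)
        ((T_hom F p ^^ m) r) (\<lambda>i. (T_hom F p ^^ m) (\<pi> i)))" for n
    proof -
      have "q \<in> dp_homs F (src q) (tgt q)" using q by simp
      from pointwise_fold_pullback_exists[OF this, of n]
      obtain r \<pi> where "pointwise_fold_pullback F n q r \<pi>" by blast
      then have "is_fold_pullback ?X n q r \<pi>" "is_fold_pullback ?X n ((T_hom F p ^^ m) q)
        ((T_hom F p ^^ m) r) (\<lambda>i. (T_hom F p ^^ m) (\<pi> i))" for m
        by (auto intro: is_fold_pullback_if_pointwise pointwise_fold_pullback_T_iterate)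
      then show ?thesis by blast
    qed
    show "q \<star> \<sigma> = q \<star> \<pi>\<^sub>1" by (rule comp_eqI) (auto simp: E2_car)
    show "q \<star> \<zeta> = Id ?X A"
      by (rule dp_homs_eqI[OF comp_homs[OF \<zeta> q] Id_homs[OF A]]) (simp add: compose_def)
    \<comment> \<open>The relations q \<pi>_i = r say that the three projections share the algebra
      part \<open>mor r x\<close>; associativity is then that of addition in M.\<close>
    show "\<sigma> \<star> ?pr (\<sigma> \<star> ?pr (\<pi> 0) (\<pi> 1)) (\<pi> 2) = \<sigma> \<star> ?pr (\<pi> 0) (\<sigma> \<star> ?pr (\<pi> 1) (\<pi> 2))"
      if fp: "is_fold_pullback ?X 3 q r \<pi>" for r \<pi>
    proof -
      have \<pi>: "\<pi> i \<in> dp_homs F (src r) E" and q\<pi>: "q \<star> \<pi> i = r" if "i < 3" for i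
        using fp that unfolding is_fold_pullback_def by (simp_all del: tangent_simps(6))
      have E\<pi>: "mor (\<pi> i) x \<in> carrier E" if "i < 3" "x \<in> carrier (src r)" for i x
        using dp_homs_closed[OF \<pi>[OF that(1)] that(2)] .
      have fst_\<pi>: "ufst (mor (\<pi> i) x) = mor r x" if "i < 3" "x \<in> carrier (src r)" for i x
      proof -
        have "mor (q \<star> \<pi> i) x = mor r x" by (simp only: q\<pi>[OF that(1)])
        then have "mor q (mor (\<pi> i) x) = mor r x"
          using that(2) dp_homs_src[OF \<pi>[OF that(1)]] by (simp add: compose_def)
        then show ?thesis using E\<pi>[OF that] by (auto simp: E_car)
      qed
      let ?p01 = "\<sigma> \<star> ?pr (\<pi> 0) (\<pi> 1)" and ?p12 = "\<sigma> \<star> ?pr (\<pi> 1) (\<pi> 2)"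
      have 01: "?p01 \<in> dp_homs F (src r) E"
        "\<And>x. x \<in> carrier (src r) \<Longrightarrow> mor ?p01 x =
          upair (mor r x) (usnd (mor (\<pi> 0) x) \<oplus>\<^bsub>M\<^esub> usnd (mor (\<pi> 1) x))"
        using plus[OF \<pi>[of 0] \<pi>[of 1]] fst_\<pi> by (simp_all del: tangent_simps(6))
      have 12: "?p12 \<in> dp_homs F (src r) E"
        "\<And>x. x \<in> carrier (src r) \<Longrightarrow> mor ?p12 x =
          upair (mor r x) (usnd (mor (\<pi> 1) x) \<oplus>\<^bsub>M\<^esub> usnd (mor (\<pi> 2) x))"
        using plus[OF \<pi>[of 1] \<pi>[of 2]] fst_\<pi> by (simp_all del: tangent_simps(6))
      have M\<pi>: "usnd (mor (\<pi> i) x) \<in> carrier M" if "i < 3" "x \<in> carrier (src r)" for i x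
        using E\<pi>[OF that] by (auto simp: E_car)
      have l: "\<sigma> \<star> ?pr ?p01 (\<pi> 2) \<in> dp_homs F (src r) E \<and> (\<forall>x\<in>carrier (src r).
          mor (\<sigma> \<star> ?pr ?p01 (\<pi> 2)) x = upair (ufst (mor ?p01 x))
            (usnd (mor ?p01 x) \<oplus>\<^bsub>M\<^esub> usnd (mor (\<pi> 2) x)))"
        by (rule plus[OF 01(1) \<pi>]) (simp_all add: 01(2) fst_\<pi> del: tangent_simps(6) One_nat_def)
      have r: "\<sigma> \<star> ?pr (\<pi> 0) ?p12 \<in> dp_homs F (src r) E \<and> (\<forall>x\<in>carrier (src r).
          mor (\<sigma> \<star> ?pr (\<pi> 0) ?p12) x = upair (ufst (mor (\<pi> 0) x))
            (usnd (mor (\<pi> 0) x) \<oplus>\<^bsub>M\<^esub> usnd (mor ?p12 x)))"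
        by (rule plus[OF \<pi> 12(1)]) (simp_all add: 12(2) fst_\<pi> del: tangent_simps(6) One_nat_def)
      show ?thesis
        by (rule dp_homs_eqI[OF l[THEN conjunct1] r[THEN conjunct1]])
          (simp add: l[THEN conjunct2] r[THEN conjunct2] 01(2) 12(2) fst_\<pi> M\<pi> N.M.a_assoc del: tangent_simps(6) One_nat_def)
    qed
    have \<zeta>q: "\<zeta> \<star> q \<in> dp_homs F E E" by (rule comp_homs[OF q \<zeta>])
    have IdE: "Id ?X E \<in> dp_homs F E E" by (rule Id_homs[OF E])
    have mId: "mor (Id ?X E) x = x" "mor (\<zeta> \<star> q) x = upair (ufst x) \<zero>\<^bsub>M\<^esub>" if "x \<in> carrier E" for x
      using that by (auto simp: compose_def E_car)
    have l: "\<sigma> \<star> ?pr (\<zeta> \<star> q) (Id ?X E) \<in> dp_homs F E E \<and> (\<forall>x\<in>carrier E.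
        mor (\<sigma> \<star> ?pr (\<zeta> \<star> q) (Id ?X E)) x =
        upair (ufst (mor (\<zeta> \<star> q) x)) (usnd (mor (\<zeta> \<star> q) x) \<oplus>\<^bsub>M\<^esub> usnd (mor (Id ?X E) x)))"
      by (rule plus[OF \<zeta>q IdE]) (simp add: mId del: tangent_simps(5,6))
    show "\<sigma> \<star> ?pr (\<zeta> \<star> q) (Id ?X E) = Id ?X E"
      by (rule dp_homs_eqI[OF l[THEN conjunct1] IdE])
        (auto simp: l[THEN conjunct2] mId E_car simp del: tangent_simps(5,6))
    have r: "\<sigma> \<star> ?pr (Id ?X E) (\<zeta> \<star> q) \<in> dp_homs F E E \<and> (\<forall>x\<in>carrier E.
        mor (\<sigma> \<star> ?pr (Id ?X E) (\<zeta> \<star> q)) x =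
        upair (ufst (mor (Id ?X E) x)) (usnd (mor (Id ?X E) x) \<oplus>\<^bsub>M\<^esub> usnd (mor (\<zeta> \<star> q) x)))"
      by (rule plus[OF IdE \<zeta>q]) (simp add: mId del: tangent_simps(5,6))
    show "\<sigma> \<star> ?pr (Id ?X E) (\<zeta> \<star> q) = Id ?X E"
      by (rule dp_homs_eqI[OF r[THEN conjunct1] IdE])
        (auto simp: r[THEN conjunct2] mId E_car simp del: tangent_simps(5,6))
    have c: "\<sigma> \<star> ?pr \<pi>\<^sub>2 \<pi>\<^sub>1 \<in> dp_homs F E2 E \<and> (\<forall>x\<in>carrier E2. mor (\<sigma> \<star> ?pr \<pi>\<^sub>2 \<pi>\<^sub>1) x =
        upair (ufst (mor \<pi>\<^sub>2 x)) (usnd (mor \<pi>\<^sub>2 x) \<oplus>\<^bsub>M\<^esub> usnd (mor \<pi>\<^sub>1 x)))"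
      by (rule plus[OF \<pi>(3,2)]) (auto simp: E2_car)
    show "\<sigma> \<star> ?pr \<pi>\<^sub>2 \<pi>\<^sub>1 = \<sigma>"
      by (rule dp_homs_eqI[OF c[THEN conjunct1] \<sigma>])
        (auto simp: c[THEN conjunct2] E2_car N.M.a_comm simp del: tangent_simps(6))
    show "T_hom F p q \<star> lam = z A \<star> q"
      by (rule comp_eqI) (auto simp: E_car)
    let ?u = "lam \<star> \<pi>\<^sub>1" and ?v = "lam \<star> \<pi>\<^sub>2" and ?w = "z E \<star> \<pi>\<^sub>2"
    have lam\<pi>: "?u \<in> dp_homs F E2 (T_alg F p E)" "?v \<in> dp_homs F E2 (T_alg F p E)"
      by (rule comp_homs[OF \<pi>(2) lam] comp_homs[OF \<pi>(3) lam])+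
    have z\<pi>: "?w \<in> dp_homs F E2 (T_alg F p E)" by (rule comp_homs[OF \<pi>(3) zE])
    have lam\<sigma>: "lam \<star> \<sigma> \<in> dp_homs F E2 (T_alg F p E)" by (rule comp_homs[OF \<sigma> lam])
    have comps: "mor ?u x = mor lam (mor \<pi>\<^sub>1 x)" "mor ?v x = mor lam (mor \<pi>\<^sub>2 x)"
      "mor ?w x = mor (z E) (mor \<pi>\<^sub>2 x)" "mor (lam \<star> \<sigma>) x = mor lam (mor \<sigma> x)"
      if "x \<in> carrier E2" for x
      using that by (simp_all add: compose_def)
    \<comment> \<open>The lift of (a, m) and the zero vector at (a, n) both have algebra parts a and
      0, as the pairings into T E_2 need; the lifts of (a, m) and (a, n) even share the base point
      (a, 0), as needed for T_2 E.\<close>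
    have e: "\<forall>x\<in>carrier E2. ufst (ufst (mor ?u x)) = ufst (ufst (mor ?v x))"
      "\<forall>x\<in>carrier E2. ufst (usnd (mor ?u x)) = ufst (usnd (mor ?v x))"
      "\<forall>x\<in>carrier E2. ufst (mor ?u x) = ufst (mor ?v x)"
      "\<forall>x\<in>carrier E2. ufst (ufst (mor ?u x)) = ufst (ufst (mor ?w x))"
      "\<forall>x\<in>carrier E2. ufst (usnd (mor ?u x)) = ufst (usnd (mor ?w x))"
      by (auto simp: comps E2_car simp del: tangent_simps(6))
    let ?R = "T_hom F p \<sigma> \<star> ?Tpr ?u ?v"
    have t: "?R \<in> dp_homs F E2 (T_alg F p E)"
      "\<And>x. x \<in> carrier E2 \<Longrightarrow> mor (?R) x = mor lam (mor \<sigma> x)"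
      using Tplus[OF lam\<pi> e(1,2)] by (auto simp: comps E2_car simp del: tangent_simps(6))
    show "lam \<star> \<sigma> = ?R"
      by (rule dp_homs_eqI[OF lam\<sigma> t(1)]) (simp add: t(2) comps del: tangent_simps(6))
    show "lam \<star> \<zeta> = T_hom F p \<zeta> \<star> z A"
      by (rule comp_eqI) auto
    show "p_alg F p E \<star> lam = \<zeta> \<star> q"
      by (rule comp_eqI) (auto simp: p_alg_def E_car)
    let ?s = "fun_arrow (T2_alg F p E) (\<lambda>x. upair (ufst (ufst x)) (usnd (ufst x) \<oplus>\<^bsub>E\<^esub> usnd (usnd x))) (T_alg F p E)"
    let ?T2 = "pairing ?X (fun_arrow (T2_alg F p E) ufst (T_alg F p E)) (fun_arrow (T2_alg F p E) usnd (T_alg F p E))"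
    have t2: "?T2 ?u ?v \<in> dp_homs F E2 (T2_alg F p E)"
      "\<And>x. x \<in> carrier E2 \<Longrightarrow> mor (?T2 ?u ?v) x = upair (mor lam (mor \<pi>\<^sub>1 x)) (mor lam (mor \<pi>\<^sub>2 x))"
      using T2[OF lam\<pi> e(3)] by (auto simp: comps E2_car simp del: tangent_simps(6))
    show "lam \<star> \<sigma> = ?s \<star> ?T2 ?u ?v"
    proof (rule comp_eqI)
      fix x assume "x \<in> carrier (src \<sigma>)"
      then obtain a m n where x: "x = upair (upair a m) (upair a n)" "a \<in> carrier A" "m \<in> carrier M" "n \<in> carrier M"
        by (auto simp: E2_car)
      then have xE: "x \<in> carrier E2" by (simp add: E2_car)
      show "mor lam (mor \<sigma> x) = mor ?s (mor (?T2 ?u ?v) x)"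
        unfolding t2(2)[OF xE] using x by (simp add: T2_car E_car)
    qed (simp_all add: dp_homs_src[OF t2(1)] del: tangent_simps(6))
    show "lam \<star> \<zeta> = z E \<star> \<zeta>"
      by (rule comp_eqI) auto
    show "tan_l ?X E \<star> lam = T_hom F p lam \<star> lam"
      by (rule comp_eqI) (auto simp: E_car)
    \<comment> \<open>The universal map sends ((a, m), (a, n)) to ((a, n), (0, m)): the zero vector
      contributes the base point, the lift contributes m.\<close>
    let ?L = "T_hom F p \<sigma> \<star> ?Tpr ?u ?w"
    have L: "?L \<in> dp_homs F E2 (T_alg F p E)"
      "\<And>a m n. \<lbrakk>a \<in> carrier A; m \<in> carrier M; n \<in> carrier M\<rbrakk> \<Longrightarrow>
        mor ?L (upair (upair a m) (upair a n)) = upair (upair a n) (upair \<zero>\<^bsub>A\<^esub> m)"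
      using Tplus[OF lam\<pi>(1) z\<pi> e(4,5)] by (auto simp: comps E2_car simp del: tangent_simps(6))
    have q\<pi>: "q \<star> \<pi>\<^sub>1 \<in> dp_homs F E2 A" by (rule comp_homs[OF \<pi>(2) q])
    have mq\<pi>: "mor (q \<star> \<pi>\<^sub>1) (upair (upair a m) (upair a n)) = a"
      if "a \<in> carrier A" "m \<in> carrier M" "n \<in> carrier M" for a m n
      using that by (simp add: compose_def E2_car)
    have "pointwise_pullback F (T_hom F p q) (z A) ?L (q \<star> \<pi>\<^sub>1)"
      unfolding pointwise_pullback_def T_hom_src_tgt arrs dp_homs_src[OF L(1)]
    proof (intro conjI ballI impI T_homs[OF q] zA L(1) q\<pi>)
      show "mor (T_hom F p q) (mor ?L w) = mor (z A) (mor (q \<star> \<pi>\<^sub>1) w)" if "w \<in> carrier E2" for w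
        using that by (auto simp: E2_car L(2) mq\<pi> E_car simp del: tangent_simps(6))
      fix x b assume "x \<in> carrier (T_alg F p E)" and b: "b \<in> carrier A" and "mor (T_hom F p q) x = mor (z A) b"
      \<comment> \<open>T(q) x = z(b) forces the algebra parts of x to be b and 0, so x is the image
        of ((b, m), (b, n)).\<close>
      then obtain m n where x: "x = upair (upair b n) (upair \<zero>\<^bsub>A\<^esub> m)" "m \<in> carrier M" "n \<in> carrier M"
        by (auto simp: E_car)
      show "\<exists>!w. w \<in> carrier E2 \<and> mor ?L w = x \<and> mor (q \<star> \<pi>\<^sub>1) w = b"
        by (rule ex1I[of _ "upair (upair b m) (upair b n)"])
          (use x b in \<open>auto simp: E2_car L(2) mq\<pi> simp del: tangent_simps(6)\<close>)
    qed
    then show "is_pullback ?X ((T_hom F p ^^ m) (T_hom F p q)) ((T_hom F p ^^ m) (z A))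
        ((T_hom F p ^^ m) ?L) ((T_hom F p ^^ m) (q \<star> \<pi>\<^sub>1))" for m
      by (intro is_pullback_if_pointwise pointwise_pullback_T_iterate)
  qed (fact q \<zeta> \<sigma> lam)+
  then show ?thesis unfolding \<pi>\<^sub>1_def \<pi>\<^sub>2_def \<sigma>_def \<zeta>_def lam_def .
qed

end

section \<open>The kernel of a differential bundle\<close>

lemma ker_obj_simps [simp]:
  "carrier (ker_obj B) = {e \<in> carrier (src (bun_q B)). mor (bun_q B) e = \<zero>\<^bsub>tgt (bun_q B)\<^esub>}"
  "zero (ker_obj B) = \<zero>\<^bsub>src (bun_q B)\<^esub>"
  "add (ker_obj B) = add (src (bun_q B))"
  "smult (ker_obj B) = smult (src (bun_q B))"
  "act (ker_obj B) = (\<lambda>a e. mor (bun_zeta B) a \<otimes>\<^bsub>src (bun_q B)\<^esub> e)"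
  by (simp_all add: ker_obj_def Let_def Module.module.extend_def act_module.fields_def underlying_def
      Module.module.truncate_def)

locale dp_differential_bundle = char_p_field F p +
  D: differential_bundle "algebraic_tangent F p" A q \<pi>\<^sub>1 \<pi>\<^sub>2 \<sigma> \<zeta> lam
  for F :: "'f ring" and p and A :: "('f, 'u::infinite) dp_algebra"
    and q \<pi>\<^sub>1 \<pi>\<^sub>2 \<sigma> \<zeta> lam :: "('f, 'u) dp_arrow"
begin

abbreviation "E \<equiv> src q"
abbreviation "K \<equiv> {e \<in> carrier E. mor q e = \<zero>\<^bsub>A\<^esub>}"

section \<open>The bundle axioms on elements\<close>

lemma A: "divided_power_algebra F A"
  using D.base by simp

lemma q_homs: "q \<in> dp_homs F E A" and zeta_homs: "\<zeta> \<in> dp_homs F A E"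
  and lam_homs: "lam \<in> dp_homs F E (T_alg F p E)" and sigma_homs: "\<sigma> \<in> dp_homs F (src \<pi>\<^sub>1) E"
  using D.q_hom D.zeta_hom D.lambda_hom D.sigma_hom by simp_all

sublocale A: divided_power_algebra F A by (rule A)
sublocale E: divided_power_algebra F E by (rule dp_homs_dom[OF q_homs])

lemmas q_simps = dp_homs_closed[OF q_homs] dp_homs_add[OF q_homs] dp_homs_mult[OF q_homs]
  dp_homs_smult[OF q_homs] dp_homs_dpow[OF q_homs] dp_homs_zero[OF q_homs] dp_homs_minus[OF q_homs]
lemmas zeta_simps = dp_homs_closed[OF zeta_homs] dp_homs_add[OF zeta_homs] dp_homs_mult[OF zeta_homs]
  dp_homs_smult[OF zeta_homs] dp_homs_dpow[OF zeta_homs] dp_homs_zero[OF zeta_homs] dp_homs_minus[OF zeta_homs]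

lemma arrs: "tgt q = A" "src \<zeta> = A" "tgt \<zeta> = E" "src lam = E" "tgt lam = T_alg F p E"
  using q_homs zeta_homs lam_homs unfolding dp_homs_iff by blast+

lemma q_zeta: "a \<in> carrier A \<Longrightarrow> mor q (mor \<zeta> a) = a"
proof -
  assume a: "a \<in> carrier A"
  have "mor (q \<star> \<zeta>) a = mor (Id (algebraic_tangent F p) A) a"
    by (simp only: D.zeta_over)
  then show ?thesis using a by (simp add: compose_def arrs)
qed

lemma lam_closed: "e \<in> carrier E \<Longrightarrow> usnd (mor lam e) \<in> carrier E"
  using dp_homs_closed[OF lam_homs] by fastforce

text \<open>The axiom p \<lambda> = \<zeta> q fixes the base point of the lift, so all remaining
  information lies in the second component.\<close>

lemma lam_eq: "e \<in> carrier E \<Longrightarrow> mor lam e = upair (mor \<zeta> (mor q e)) (usnd (mor lam e))"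
proof -
  assume e: "e \<in> carrier E"
  have c: "mor lam e \<in> carrier (T_alg F p E)" by (rule dp_homs_closed[OF lam_homs e])
  have "mor (p_alg F p E) (mor lam e) = mor \<zeta> (mor q e)"
    using comp_eqD[OF D.p_lambda, of e] e by (simp add: arrs)
  then have "ufst (mor lam e) = mor \<zeta> (mor q e)" using c by (simp add: p_alg_def del: T_alg_simps)
  then show ?thesis using c by auto
qed

text \<open>By T(q) \<lambda> = z q the second component of a lift is vertical, for every e and not
  just for e in the kernel.\<close>

lemma lam_ker_closed: "e \<in> carrier E \<Longrightarrow> usnd (mor lam e) \<in> K"
proof -
  assume e: "e \<in> carrier E"
  have "mor (T_hom F p q) (mor lam e) = upair (mor q e) \<zero>\<^bsub>A\<^esub>"
    using comp_eqD[OF D.T_q_lambda, of e] e q_simps(1)[OF e]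
    by (simp add: arrs)
  moreover have "mor (T_hom F p q) (mor lam e) = upair (mor q (mor \<zeta> (mor q e))) (mor q (usnd (mor lam e)))"
    using e by (subst lam_eq) (simp_all add: q_simps zeta_simps lam_closed)
  ultimately show ?thesis using lam_closed[OF e] by simp
qed

lemma lam_zeta: "a \<in> carrier A \<Longrightarrow> mor lam (mor \<zeta> a) = upair (mor \<zeta> a) \<zero>\<^bsub>E\<^esub>"
  using comp_eqD[OF D.lambda_zeta_z, of a]
  by (simp add: arrs zeta_simps)

lemma ker_zero: "\<zero>\<^bsub>E\<^esub> \<in> K"
  by (simp add: q_simps)

lemma lam_ker_fst: "k \<in> K \<Longrightarrow> mor lam k = upair \<zero>\<^bsub>E\<^esub> (usnd (mor lam k))"
  using lam_eq[of k] by (simp add: zeta_simps)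

lemma lam_lam:
  assumes "k \<in> K"
  shows "mor lam (usnd (mor lam k)) = upair \<zero>\<^bsub>E\<^esub> (usnd (mor lam k))"
proof -
  define d where "d = usnd (mor lam k)"
  have k: "k \<in> carrier E" "d \<in> carrier E" using assms lam_closed by (auto simp: d_def)
  have lk: "mor lam k = upair \<zero>\<^bsub>E\<^esub> d" unfolding d_def by (rule lam_ker_fst[OF assms])
  have "mor (tan_l (algebraic_tangent F p) E) (mor lam k) = mor (T_hom F p lam) (mor lam k)"
    using comp_eqD[OF D.l_lambda, of k] k by (simp add: arrs)
  \<comment> \<open>Both sides at k: l sends (0, d) to ((0, 0), (0, d)), while T(\<lambda>) applies
    the lift to each component of (0, d).\<close>
  then have "upair (upair \<zero>\<^bsub>E\<^esub> \<zero>\<^bsub>E\<^esub>) (upair \<zero>\<^bsub>E\<^esub> d) = upair (mor lam \<zero>\<^bsub>E\<^esub>) (mor lam d)"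
    unfolding lk using k by (simp add: arrs)
  then show ?thesis by (simp flip: d_def)
qed

text \<open>If \<open>\<lambda>(k) = 0\<close>, the elements \<open>(k, 0)\<close> and \<open>(0, 0)\<close> of \<open>E\<^sub>2\<close> have the same image under both
  projections of the pullback in the universality of the lift.\<close>

lemma lam_ker_inj:
  assumes k: "k \<in> K" and lam0: "mor lam k = upair \<zero>\<^bsub>E\<^esub> \<zero>\<^bsub>E\<^esub>"
  shows "k = \<zero>\<^bsub>E\<^esub>"
proof -
  let ?X = "algebraic_tangent F p :: (('f, 'u) dp_algebra, ('f, 'u) dp_arrow) tangent_category"
  let ?zE = "fun_arrow E (\<lambda>a. upair a \<zero>\<^bsub>E\<^esub>) (T_alg F p E)"
  let ?pr = "pairing ?X (T_hom F p \<pi>\<^sub>1) (T_hom F p \<pi>\<^sub>2) (lam \<star> \<pi>\<^sub>1) (?zE \<star> \<pi>\<^sub>2)"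
  let ?L = "T_hom F p \<sigma> \<star> ?pr"
  have pb: "pointwise_pullback F q q \<pi>\<^sub>1 \<pi>\<^sub>2" by (rule pointwise_if_is_pullback[OF D.E2_pullback])
  note pb' = pb[unfolded pointwise_pullback_def]
  let ?E2 = "src \<pi>\<^sub>1"
  have \<pi>: "\<pi>\<^sub>1 \<in> dp_homs F ?E2 E" "\<pi>\<^sub>2 \<in> dp_homs F ?E2 E" using pb' by simp_all
  have univ: "\<exists>!w. w \<in> carrier ?E2 \<and> mor \<pi>\<^sub>1 w = x \<and> mor \<pi>\<^sub>2 w = y"
    if "x \<in> carrier E" "y \<in> carrier E" "mor q x = mor q y" for x y
    using pb' that by simp
  interpret E2: divided_power_algebra F ?E2 by (rule dp_homs_dom[OF \<pi>(1)])
  have zero_unique: "w = \<zero>\<^bsub>?E2\<^esub>" if "w \<in> carrier ?E2" "mor \<pi>\<^sub>1 w = \<zero>\<^bsub>E\<^esub>" "mor \<pi>\<^sub>2 w = \<zero>\<^bsub>E\<^esub>" for w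
    using univ[of "\<zero>\<^bsub>E\<^esub>" "\<zero>\<^bsub>E\<^esub>"] that dp_homs_zero[OF \<pi>(1)] dp_homs_zero[OF \<pi>(2)] E2.M.zero_closed by auto
  have lam\<pi>: "lam \<star> \<pi>\<^sub>1 \<in> dp_homs F ?E2 (T_alg F p E)" by (rule comp_homs[OF \<pi>(1) lam_homs])
  have z\<pi>: "?zE \<star> \<pi>\<^sub>2 \<in> dp_homs F ?E2 (T_alg F p E)"
    by (rule comp_homs[OF \<pi>(2) tan_z_homs[OF E.divided_power_algebra_axioms]])
  have comps: "mor (lam \<star> \<pi>\<^sub>1) x = mor lam (mor \<pi>\<^sub>1 x)"
    "mor (?zE \<star> \<pi>\<^sub>2) x = upair (mor \<pi>\<^sub>2 x) \<zero>\<^bsub>E\<^esub>" if "x \<in> carrier ?E2" for x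
    using that dp_homs_src[OF \<pi>(2)] dp_homs_closed[OF \<pi>(2) that] by (simp_all add: compose_def)
  \<comment> \<open>Condition for the pairing to exist: the lift of the first component and the zero
    vector at the second have equal images under T(q), because both components lie over the same
    point of A.\<close>
  have eq: "\<forall>x\<in>carrier ?E2. mor (T_hom F p q) (mor (lam \<star> \<pi>\<^sub>1) x) =
      mor (T_hom F p q) (mor (?zE \<star> \<pi>\<^sub>2) x)"
  proof
    fix x assume x: "x \<in> carrier ?E2"
    have x1: "mor \<pi>\<^sub>1 x \<in> carrier E" and x2: "mor \<pi>\<^sub>2 x \<in> carrier E" and q12: "mor q (mor \<pi>\<^sub>1 x) = mor q (mor \<pi>\<^sub>2 x)"
      using pb' x dp_homs_closed[OF \<pi>(1)] dp_homs_closed[OF \<pi>(2)] by auto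
    have "mor (T_hom F p q) (mor lam (mor \<pi>\<^sub>1 x)) = upair (mor q (mor \<pi>\<^sub>1 x)) \<zero>\<^bsub>A\<^esub>"
      using x1 lam_ker_closed[OF x1] by (subst lam_eq) (simp_all add: zeta_simps q_zeta q_simps)
    then show "mor (T_hom F p q) (mor (lam \<star> \<pi>\<^sub>1) x) = mor (T_hom F p q) (mor (?zE \<star> \<pi>\<^sub>2) x)"
      unfolding comps[OF x] using x2 q12 by (simp add: q_simps)
  qed
  note pr = pairing_homs[where p = p, OF pointwise_pullback_T[OF pb], unfolded T_hom_src_tgt, OF lam\<pi> z\<pi> eq]
  have L: "?L \<in> dp_homs F ?E2 (T_alg F p E)" by (rule comp_homs[OF pr(1) T_homs[OF sigma_homs]])
  have "is_pullback ?X (T_hom F p q) (tan_z ?X A) ?L (q \<star> \<pi>\<^sub>1)"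
    using D.lift_universal[of 0] by (simp del: tangent_simps(6))
  then have Lpb: "pointwise_pullback F (T_hom F p q) (tan_z ?X A) ?L (q \<star> \<pi>\<^sub>1)"
    by (rule pointwise_if_is_pullback)
  \<comment> \<open>The pair (k, 0) in the abstract E_2, available because q(k) = 0 = q(0).\<close>
  obtain w where w: "w \<in> carrier ?E2" "mor \<pi>\<^sub>1 w = k" "mor \<pi>\<^sub>2 w = \<zero>\<^bsub>E\<^esub>"
    using univ[of k "\<zero>\<^bsub>E\<^esub>"] k by (auto simp: q_simps)
  have "mor ?pr w \<in> carrier (T_alg F p ?E2)" by (rule dp_homs_closed[OF pr(1) w(1)])
  then obtain v1 v2 where v: "mor ?pr w = upair v1 v2" "v1 \<in> carrier ?E2" "v2 \<in> carrier ?E2" by auto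
  have "mor (T_hom F p \<pi>\<^sub>1) (upair v1 v2) = upair \<zero>\<^bsub>E\<^esub> \<zero>\<^bsub>E\<^esub>" "mor (T_hom F p \<pi>\<^sub>2) (upair v1 v2) = upair \<zero>\<^bsub>E\<^esub> \<zero>\<^bsub>E\<^esub>"
    using pr(2,3)[OF w(1)] unfolding v comps[OF w(1)] w lam0 by simp_all
  \<comment> \<open>Both components of the pairing at (k, 0) have zero projections and hence vanish,
    so the universal map kills (k, 0).\<close>
  then have "v1 = \<zero>\<^bsub>?E2\<^esub>" "v2 = \<zero>\<^bsub>?E2\<^esub>"
    using v dp_homs_src[OF \<pi>(2)] by (auto intro!: zero_unique)
  then have "mor ?L w = \<zero>\<^bsub>T_alg F p E\<^esub>"
    using v w dp_homs_src[OF pr(1)] dp_homs_src[OF sigma_homs] dp_homs_zero[OF sigma_homs]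
    by (simp add: compose_def)
  then have Lw: "mor ?L w = mor ?L \<zero>\<^bsub>?E2\<^esub>" by (simp only: dp_homs_zero[OF L])
  have q\<pi>: "mor (q \<star> \<pi>\<^sub>1) w = \<zero>\<^bsub>A\<^esub>" "mor (q \<star> \<pi>\<^sub>1) \<zero>\<^bsub>?E2\<^esub> = \<zero>\<^bsub>A\<^esub>"
    using w k dp_homs_zero[OF comp_homs[OF \<pi>(1) q_homs]] by (simp_all add: compose_def)
  have "\<exists>!w'. w' \<in> carrier ?E2 \<and> mor ?L w' = \<zero>\<^bsub>T_alg F p E\<^esub> \<and> mor (q \<star> \<pi>\<^sub>1) w' = \<zero>\<^bsub>A\<^esub>"
  proof -
    have univ: "\<forall>x\<in>carrier (T_alg F p E). \<forall>y\<in>carrier A. mor (T_hom F p q) x = mor (tan_z ?X A) y \<longrightarrow>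
       (\<exists>!w. w \<in> carrier ?E2 \<and> mor ?L w = x \<and> mor (q \<star> \<pi>\<^sub>1) w = y)"
      using Lpb unfolding pointwise_pullback_def dp_homs_src[OF L] T_hom_src_tgt tangent_simps(13) fun_arrow_src_tgt
      by (elim conjE)
    show ?thesis
      by (rule univ[rule_format]) (simp_all add: q_simps)
  qed
  then have "w = \<zero>\<^bsub>?E2\<^esub>"
    using Lw q\<pi> w(1) E2.M.zero_closed dp_homs_zero[OF L] by metis
  then show ?thesis using w dp_homs_zero[OF \<pi>(1)] by simp
qed

section \<open>The kernel as an ideal with vanishing products and higher powers\<close>

lemma ker_closed:
  "\<lbrakk>k \<in> K; l \<in> K\<rbrakk> \<Longrightarrow> k \<oplus>\<^bsub>E\<^esub> l \<in> K" "k \<in> K \<Longrightarrow> \<ominus>\<^bsub>E\<^esub> k \<in> K"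
  "\<lbrakk>c \<in> carrier F; k \<in> K\<rbrakk> \<Longrightarrow> c \<odot>\<^bsub>E\<^esub> k \<in> K"
  "\<lbrakk>e \<in> carrier E; k \<in> K\<rbrakk> \<Longrightarrow> e \<otimes>\<^bsub>E\<^esub> k \<in> K" "\<lbrakk>1 \<le> n; k \<in> K\<rbrakk> \<Longrightarrow> dpow E n k \<in> K"
  by (auto simp: q_simps E.mult_closed E.dpow_closed A.mult_zero A.dpow_zero)

text \<open>The second component of \<open>\<lambda>\<close> is idempotent and injective on the kernel, hence the identity.\<close>

lemma lam_ker:
  assumes k: "k \<in> K"
  shows "mor lam k = upair \<zero>\<^bsub>E\<^esub> k"
proof -
  define d where "d = usnd (mor lam k)"
  \<comment> \<open>The defect of k from being fixed. It is sent to zero because the second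
    component of the lift is additive and fixes d.\<close>
  define m where "m = k \<oplus>\<^bsub>E\<^esub> (\<ominus>\<^bsub>E\<^esub> d)"
  have d: "d \<in> K" unfolding d_def using lam_ker_closed k by blast
  have m: "m \<in> K" unfolding m_def using k d ker_closed by blast
  have dm: "usnd (mor lam m) \<in> carrier E" using m lam_closed by simp
  have "k = m \<oplus>\<^bsub>E\<^esub> d" using k d by (simp add: m_def E.M.a_assoc E.M.l_neg)
  then have "mor lam k = mor lam m \<oplus>\<^bsub>T_alg F p E\<^esub> mor lam d"
    using m d dp_homs_add[OF lam_homs] by simp
  then have "usnd (mor lam k) = usnd (mor lam m) \<oplus>\<^bsub>E\<^esub> usnd (mor lam d)" by simp
  moreover have "usnd (mor lam d) = d" unfolding d_def lam_lam[OF k] by simp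
  ultimately have "d = usnd (mor lam m) \<oplus>\<^bsub>E\<^esub> d" by (simp flip: d_def)
  then have "usnd (mor lam m) = \<zero>\<^bsub>E\<^esub>"
    using d dm by (metis (no_types, lifting) E.M.add.r_cancel_one' mem_Collect_eq)
  then have "m = \<zero>\<^bsub>E\<^esub>" using lam_ker_inj[OF m] lam_ker_fst[OF m] by simp
  then have "k = d" using k d \<open>k = m \<oplus>\<^bsub>E\<^esub> d\<close> by simp
  then show ?thesis using lam_ker_fst[OF k] d_def by simp
qed

text \<open>The lift at kl has two values: (0, kl), since kl lies in the kernel, and the product of
  (0, k) and (0, l) in T E, which is zero.\<close>

lemma ker_mult: "\<lbrakk>k \<in> K; l \<in> K\<rbrakk> \<Longrightarrow> k \<otimes>\<^bsub>E\<^esub> l = \<zero>\<^bsub>E\<^esub>"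
proof -
  assume k: "k \<in> K" and l: "l \<in> K"
  have "mor lam (k \<otimes>\<^bsub>E\<^esub> l) = upair \<zero>\<^bsub>E\<^esub> (k \<otimes>\<^bsub>E\<^esub> l)"
    using lam_ker ker_closed(4) k l by blast
  moreover have "mor lam (k \<otimes>\<^bsub>E\<^esub> l) = mor lam k \<otimes>\<^bsub>T_alg F p E\<^esub> mor lam l"
    using dp_homs_mult[OF lam_homs] k l by simp
  ultimately show ?thesis
    unfolding lam_ker[OF k] lam_ker[OF l] using k l by (simp add: E.mult_closed E.zero_mult)
qed

text \<open>In T E the n-th power of (0, k) has second component 0^[n-1] k, which is 0 for n \<ge>
  2, while the lift of k^[n] is (0, k^[n]).\<close>

lemma ker_dpow: "\<lbrakk>2 \<le> n; k \<in> K\<rbrakk> \<Longrightarrow> dpow E n k = \<zero>\<^bsub>E\<^esub>"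
proof -
  assume n: "2 \<le> n" and k: "k \<in> K"
  have "mor lam (dpow E n k) = upair \<zero>\<^bsub>E\<^esub> (dpow E n k)"
    using lam_ker ker_closed(5)[of n k] n k by auto
  moreover have "mor lam (dpow E n k) = dpow (T_alg F p E) n (mor lam k)"
    using dp_homs_dpow[OF lam_homs, of n k] n k by simp
  ultimately show ?thesis
    unfolding lam_ker[OF k] using k n dpow_T[OF E.divided_power_algebra_axioms, of n "\<zero>\<^bsub>E\<^esub>" k]
    by (simp add: E.dpow_zero E.zero_mult)
qed

text \<open>Of the terms in the addition law only e^[n] and e^[n-1] k have degree at most 1 in k;
  the others contain a vanishing power of k. For e = \<zeta>(a) this reproduces the power formula of
  the semidirect product.\<close>

lemma dpow_add_ker:
  assumes n: "1 \<le> n" and e: "e \<in> carrier E" and k: "k \<in> K"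
  shows "dpow E n (e \<oplus>\<^bsub>E\<^esub> k) = dpow E n e \<oplus>\<^bsub>E\<^esub> (if n = 1 then k else dpow E (n - 1) e \<otimes>\<^bsub>E\<^esub> k)"
proof (cases "n = 1")
  case True
  then show ?thesis using e k E.dpow_1 by simp
next
  case False
  have kE: "k \<in> carrier E" using k by simp
  have "(\<Oplus>\<^bsub>E\<^esub>l\<in>{1..n-1}. dpow E l e \<otimes>\<^bsub>E\<^esub> dpow E (n - l) k) = dpow E (n - 1) e \<otimes>\<^bsub>E\<^esub> dpow E (n - (n - 1)) k"
  proof (rule finsum_single)
    show "dpow E l e \<otimes>\<^bsub>E\<^esub> dpow E (n - l) k = \<zero>\<^bsub>E\<^esub>" if "l \<in> {1..n-1}" "l \<noteq> n - 1" for l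
    proof -
      have "2 \<le> n - l" using that by auto
      then show ?thesis using that e ker_dpow[OF _ k] by (simp add: E.mult_zero E.dpow_closed)
    qed
  qed (use False n e kE E.abelian_monoid_axioms in \<open>auto intro!: E.mult_closed E.dpow_closed\<close>)
  moreover have "n - (n - 1) = 1" using n by simp
  ultimately show ?thesis
    using False n e kE E.dpow_1[OF kE] ker_dpow[OF _ k, of n]
    by (simp add: E.dpow_add E.dpow_closed E.mult_closed)
qed

end

text \<open>Both sides of each law for g have the same image under f and are recovered from it. Thus
  the operations have to be checked for one direction of the comparison only.\<close>

lemma inverse_homs:
  assumes f: "f \<in> dp_homs F B C"
    and g: "\<And>y. y \<in> carrier C \<Longrightarrow> g y \<in> carrier B" "\<And>y. y \<in> carrier C \<Longrightarrow> mor f (g y) = y"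
      "\<And>x. x \<in> carrier B \<Longrightarrow> g (mor f x) = x"
  shows "fun_arrow C g B \<in> dp_homs F C B"
proof -
  interpret B: divided_power_algebra F B by (rule dp_homs_dom[OF f])
  interpret C: divided_power_algebra F C by (rule dp_homs_cod[OF f])
  have eq: "g y = x" if "mor f x = y" "x \<in> carrier B" for x y using g(3)[OF that(2)] that(1) by simp
  show ?thesis
    by (rule fun_arrow_homs[OF C.divided_power_algebra_axioms B.divided_power_algebra_axioms g(1)])
      (auto intro!: eq B.mult_closed B.dpow_closed
        simp: g dp_homs_add[OF f] dp_homs_smult[OF f] dp_homs_mult[OF f] dp_homs_dpow[OF f])
qed

section \<open>From bundles to modules and back, on objects\<close>

context char_p_field
begin

abbreviation is_bundle :: "('f, 'u::infinite) dp_algebra \<Rightarrow> ('f, 'u) dp_bundle \<Rightarrow> bool" where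
  "is_bundle A B \<equiv> differential_bundle (algebraic_tangent F p) A (bun_q B) (bun_fst B) (bun_snd B)
     (bun_sigma B) (bun_zeta B) (bun_lambda B)"

lemma bundle_locale:
  assumes "is_bundle A B"
  shows "dp_differential_bundle F p A (bun_q B) (bun_fst B) (bun_snd B)
     (bun_sigma B) (bun_zeta B) (bun_lambda B)"
  by (intro dp_differential_bundle.intro char_p_field_axioms assms)

text \<open>The action is multiplication by \<zeta>(a) in E: the module laws hold because \<zeta> is
  a homomorphism, closure because the kernel of q is an ideal.\<close>

lemma dp_module_ker_obj:
  assumes "is_bundle A B"
  shows "dp_module F A (ker_obj B)"
proof -
  interpret dp_differential_bundle F p A "bun_q B" "bun_fst B" "bun_snd B"
     "bun_sigma B" "bun_zeta B" "bun_lambda B" by (rule bundle_locale) fact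
  have sub: "submodule K F E"
    by (rule E.submoduleI) (use ker_closed ker_zero in blast)+
  have "Module.module F (E\<lparr>carrier := K\<rparr>)"
    by (rule submodule.submodule_is_module[OF sub E.module])
  then have "Module.module F (ker_obj B)"
    by (rule module_cong) (simp_all add: arrs)
  then show ?thesis
    by (intro dp_module.intro A nonunital_module.intro nonunital_module_axioms.intro)
      (simp_all add: arrs zeta_simps E.mult_closed q_simps q_zeta A.mult_zero E.mult_distrib
        E.mult_distrib_right E.mult_smult E.mult_smult_right E.mult_assoc)
qed

lemma ltimes_obj_simps [simp]:
  fixes A :: "('f, 'u::infinite) dp_algebra"
  shows "bun_q (ltimes_obj F p A M) = fun_arrow (ltimes F p A M) ufst A"
    "bun_zeta (ltimes_obj F p A M) = fun_arrow A (\<lambda>a. upair a \<zero>\<^bsub>M\<^esub>) (ltimes F p A M)"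
    "bun_lambda (ltimes_obj F p A M) = fun_arrow (ltimes F p A M)
      (\<lambda>x. upair (upair (ufst x) \<zero>\<^bsub>M\<^esub>) (upair \<zero>\<^bsub>A\<^esub> (usnd x))) (T_alg F p (ltimes F p A M))"
  by (simp_all add: ltimes_obj_def Let_def)

lemma is_bundle_ltimes_obj:
  fixes A :: "('f, 'u::infinite) dp_algebra"
  assumes "dp_module F A M"
  shows "is_bundle A (ltimes_obj F p A M)"
  using differential_bundle_ltimes[OF assms] by (simp add: ltimes_obj_def Let_def)

end

section \<open>The two categories\<close>

context char_p_field
begin

abbreviation DB :: "('f, 'u::infinite) dp_algebra \<Rightarrow>
    (('f, 'u) dp_bundle, (('f, 'u) dp_bundle, ('f, 'u) dp_arrow) arrow) category" where
  "DB A \<equiv> DBun (algebraic_tangent F p) A"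

lemma DBun_simps [simp]:
  "Obj (DB A) = {B. is_bundle A B}" "Dom (DB A) = src" "Cod (DB A) = tgt"
  "Id (DB A) B = Arrow B (Id (algebraic_tangent F p) (src (bun_q B))) B"
  "g \<bullet>\<^bsub>DB A\<^esub> f = Arrow (src f) (mor g \<star> mor f) (tgt g)"
  by (simp_all add: DBun_def Let_def)

lemma
  assumes "is_bundle A B"
  shows bundle_q_homs: "bun_q B \<in> dp_homs F (src (bun_q B)) A"
    and bundle_lambda_homs: "bun_lambda B \<in> dp_homs F (src (bun_q B)) (T_alg F p (src (bun_q B)))"
  using dp_differential_bundle.q_homs[OF bundle_locale[OF assms]]
    dp_differential_bundle.lam_homs[OF bundle_locale[OF assms]] .

lemma DBun_hom_set:
  "f \<in> hom_set (DB A) B C \<longleftrightarrow> src f = B \<and> tgt f = C \<and> is_bundle A B \<and> is_bundle A C \<and>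
     mor f \<in> dp_homs F (src (bun_q B)) (src (bun_q C)) \<and>
     (\<forall>e\<in>carrier (src (bun_q B)). mor (bun_q C) (mor (mor f) e) = mor (bun_q B) e) \<and>
     (\<forall>e\<in>carrier (src (bun_q B)).
       mor (T_hom F p (mor f)) (mor (bun_lambda B) e) = mor (bun_lambda C) (mor (mor f) e))"
  (is "?l \<longleftrightarrow> ?r")
proof -
  let ?X = "algebraic_tangent F p :: (('f, 'u::infinite) dp_algebra, ('f, 'u) dp_arrow) tangent_category"
  have 1: "?l \<longleftrightarrow> src f = B \<and> tgt f = C \<and> is_bundle A B \<and> is_bundle A C \<and>
     mor f \<in> dp_homs F (src (bun_q B)) (src (bun_q C)) \<and>
     bun_q C \<star> mor f = bun_q B \<and> T_hom F p (mor f) \<star> bun_lambda B = bun_lambda C \<star> mor f"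
    by (cases f) (auto simp: hom_set_def DBun_def Let_def simp del: tangent_simps(6))
  have "bun_q C \<star> mor f = bun_q B \<longleftrightarrow>
      (\<forall>e\<in>carrier (src (bun_q B)). mor (bun_q C) (mor (mor f) e) = mor (bun_q B) e)"
    if "is_bundle A B" "is_bundle A C" and f: "mor f \<in> dp_homs F (src (bun_q B)) (src (bun_q C))"
  proof
    assume eq: "bun_q C \<star> mor f = bun_q B"
    show "\<forall>e\<in>carrier (src (bun_q B)). mor (bun_q C) (mor (mor f) e) = mor (bun_q B) e"
      unfolding eq[symmetric] using dp_homs_src[OF f] by (simp add: compose_def)
  next
    assume "\<forall>e\<in>carrier (src (bun_q B)). mor (bun_q C) (mor (mor f) e) = mor (bun_q B) e"
    then show "bun_q C \<star> mor f = bun_q B"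
      by (intro dp_homs_eqI[OF comp_homs[OF f bundle_q_homs[OF that(2)]] bundle_q_homs[OF that(1)]])
        (simp add: compose_def dp_homs_src[OF f])
  qed
  moreover have "T_hom F p (mor f) \<star> bun_lambda B = bun_lambda C \<star> mor f \<longleftrightarrow>
      (\<forall>e\<in>carrier (src (bun_q B)).
       mor (T_hom F p (mor f)) (mor (bun_lambda B) e) = mor (bun_lambda C) (mor (mor f) e))"
    if "is_bundle A B" "is_bundle A C" and f: "mor f \<in> dp_homs F (src (bun_q B)) (src (bun_q C))"
  proof
    assume "T_hom F p (mor f) \<star> bun_lambda B = bun_lambda C \<star> mor f"
    from comp_eqD[OF this] show "\<forall>e\<in>carrier (src (bun_q B)).
       mor (T_hom F p (mor f)) (mor (bun_lambda B) e) = mor (bun_lambda C) (mor (mor f) e)"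
      by (simp add: dp_homs_src[OF bundle_lambda_homs[OF that(1)]])
  next
    assume "\<forall>e\<in>carrier (src (bun_q B)).
       mor (T_hom F p (mor f)) (mor (bun_lambda B) e) = mor (bun_lambda C) (mor (mor f) e)"
    then show "T_hom F p (mor f) \<star> bun_lambda B = bun_lambda C \<star> mor f"
      by (intro comp_eqI) (simp_all add: dp_homs_src[OF bundle_lambda_homs[OF that(1)]] dp_homs_src[OF f]
          dp_homs_tgt[OF bundle_lambda_homs[OF that(2)]] dp_homs_tgt[OF f])
  qed
  ultimately show ?thesis unfolding 1 by blast
qed

lemma DBun_Arr: "f \<in> Arr (DB A) \<longleftrightarrow> f \<in> hom_set (DB A) (src f) (tgt f)"
  by (simp add: hom_set_def)

lemma DBun_homI:
  assumes "is_bundle A B" "is_bundle A C" "f \<in> dp_homs F (src (bun_q B)) (src (bun_q C))"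
    and "\<And>e. e \<in> carrier (src (bun_q B)) \<Longrightarrow> mor (bun_q C) (mor f e) = mor (bun_q B) e"
    and "\<And>e. e \<in> carrier (src (bun_q B)) \<Longrightarrow>
       mor (T_hom F p f) (mor (bun_lambda B) e) = mor (bun_lambda C) (mor f e)"
  shows "Arrow B f C \<in> hom_set (DB A) B C"
  using assms by (simp add: DBun_hom_set)

lemma
  assumes "f \<in> hom_set (DB A) B C"
  shows DBun_hom_src: "src f = B" and DBun_hom_tgt: "tgt f = C"
    and DBun_hom_dom: "is_bundle A B" and DBun_hom_cod: "is_bundle A C"
    and DBun_hom_mor: "mor f \<in> dp_homs F (src (bun_q B)) (src (bun_q C))"
    and DBun_hom_q: "\<And>e. e \<in> carrier (src (bun_q B)) \<Longrightarrow> mor (bun_q C) (mor (mor f) e) = mor (bun_q B) e"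
    and DBun_hom_lambda: "\<And>e. e \<in> carrier (src (bun_q B)) \<Longrightarrow>
       mor (T_hom F p (mor f)) (mor (bun_lambda B) e) = mor (bun_lambda C) (mor (mor f) e)"
  using assms unfolding DBun_hom_set by simp_all

text \<open>Put e = \<zeta>(a). The first component of T(f) \<lambda>(e) is f(e), and that of
  \<lambda>'(f(e)) is \<zeta>'(q'(f(e))) = \<zeta>'(q(e)) = \<zeta>'(a); commuting with the lifts
  makes them equal.\<close>

lemma DBun_hom_zeta:
  assumes f: "f \<in> hom_set (DB A) B C" and a: "a \<in> carrier A"
  shows "mor (mor f) (mor (bun_zeta B) a) = mor (bun_zeta C) a"
proof -
  interpret B: dp_differential_bundle F p A "bun_q B" "bun_fst B" "bun_snd B"
     "bun_sigma B" "bun_zeta B" "bun_lambda B" by (rule bundle_locale[OF DBun_hom_dom[OF f]])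
  interpret C: dp_differential_bundle F p A "bun_q C" "bun_fst C" "bun_snd C"
     "bun_sigma C" "bun_zeta C" "bun_lambda C" by (rule bundle_locale[OF DBun_hom_cod[OF f]])
  note m = DBun_hom_mor[OF f]
  define e where "e = mor (bun_zeta B) a"
  have e: "e \<in> carrier B.E" unfolding e_def using a by (rule B.zeta_simps)
  have fe: "mor (mor f) e \<in> carrier C.E" by (rule dp_homs_closed[OF m e])
  have "mor (T_hom F p (mor f)) (mor (bun_lambda B) e) = upair (mor (mor f) e) \<zero>\<^bsub>C.E\<^esub>"
    using B.lam_zeta[OF a] e by (simp add: dp_homs_src[OF m] dp_homs_zero[OF m] flip: e_def)
  moreover have "mor (bun_lambda C) (mor (mor f) e) =
      upair (mor (bun_zeta C) (mor (bun_q B) e)) (usnd (mor (bun_lambda C) (mor (mor f) e)))"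
    using C.lam_eq[OF fe] by (simp only: DBun_hom_q[OF f e])
  ultimately have "mor (mor f) e = mor (bun_zeta C) (mor (bun_q B) e)"
    using DBun_hom_lambda[OF f e] by (metis upair_inject)
  then show ?thesis using B.q_zeta[OF a] by (simp add: e_def)
qed

lemma category_DBun: "category (DB A)"
proof (rule category.intro)
  let ?X = "algebraic_tangent F p :: (('f, 'u::infinite) dp_algebra, ('f, 'u) dp_arrow) tangent_category"
  note cat = category_algebraic_tangent[of F p]
  show "Dom (DB A) f \<in> Obj (DB A)" "Cod (DB A) f \<in> Obj (DB A)" if "f \<in> Arr (DB A)" for f
    using that unfolding DBun_Arr by (simp_all add: DBun_hom_set)
  show "Id (DB A) B \<in> hom_set (DB A) B B" if "B \<in> Obj (DB A)" for B
  proof -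
    have B: "is_bundle A B" using that by simp
    have E: "divided_power_algebra F (src (bun_q B))" by (rule dp_homs_dom[OF bundle_q_homs[OF B]])
    show ?thesis unfolding DBun_simps(4)
    proof (rule DBun_homI[OF B B Id_homs[OF E]])
      fix e assume e: "e \<in> carrier (src (bun_q B))"
      then show "mor (bun_q B) (mor (Id ?X (src (bun_q B))) e) = mor (bun_q B) e" by simp
      show "mor (T_hom F p (Id ?X (src (bun_q B)))) (mor (bun_lambda B) e) =
        mor (bun_lambda B) (mor (Id ?X (src (bun_q B))) e)"
        unfolding T_hom_Id[OF E] using e dp_homs_closed[OF bundle_lambda_homs[OF B] e] by simp
    qed
  qed
  show "g \<bullet>\<^bsub>DB A\<^esub> f \<in> hom_set (DB A) B D" if f: "f \<in> hom_set (DB A) B C" and g: "g \<in> hom_set (DB A) C D"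
    for f g B C D
    unfolding DBun_simps(5) DBun_hom_src[OF f] DBun_hom_tgt[OF g]
  proof (rule DBun_homI[OF DBun_hom_dom[OF f] DBun_hom_cod[OF g] comp_homs[OF DBun_hom_mor[OF f] DBun_hom_mor[OF g]]])
    fix e assume e: "e \<in> carrier (src (bun_q B))"
    have fe: "mor (mor f) e \<in> carrier (src (bun_q C))" by (rule dp_homs_closed[OF DBun_hom_mor[OF f] e])
    have gf: "mor (mor g \<star> mor f) e = mor (mor g) (mor (mor f) e)"
      using e by (simp add: compose_def dp_homs_src[OF DBun_hom_mor[OF f]])
    show "mor (bun_q D) (mor (mor g \<star> mor f) e) = mor (bun_q B) e"
      unfolding gf DBun_hom_q[OF g fe] DBun_hom_q[OF f e] ..
    have "mor (T_hom F p (mor g) \<star> T_hom F p (mor f)) (mor (bun_lambda B) e) =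
        mor (T_hom F p (mor g)) (mor (T_hom F p (mor f)) (mor (bun_lambda B) e))"
      using dp_homs_closed[OF bundle_lambda_homs[OF DBun_hom_dom[OF f]] e]
      by (simp add: compose_def dp_homs_src[OF DBun_hom_mor[OF f]])
    then show "mor (T_hom F p (mor g \<star> mor f)) (mor (bun_lambda B) e) =
        mor (bun_lambda D) (mor (mor g \<star> mor f) e)"
      unfolding T_hom_comp[OF DBun_hom_mor[OF f] DBun_hom_mor[OF g]] gf DBun_hom_lambda[OF f e]
        DBun_hom_lambda[OF g fe] .
  qed
  show "f \<bullet>\<^bsub>DB A\<^esub> Id (DB A) B = f" if f: "f \<in> hom_set (DB A) B C" for f B C
    using category.Comp_Id[OF cat, unfolded hom_set_tangent, OF DBun_hom_mor[OF f]]
      DBun_hom_src[OF f]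
    unfolding DBun_simps(4,5) by (intro arrow_eqI) (simp_all del: tangent_simps(5,6))
  show "Id (DB A) C \<bullet>\<^bsub>DB A\<^esub> f = f" if f: "f \<in> hom_set (DB A) B C" for f B C
    using category.Id_Comp[OF cat, unfolded hom_set_tangent, OF DBun_hom_mor[OF f]]
      DBun_hom_tgt[OF f]
    unfolding DBun_simps(4,5) by (intro arrow_eqI) (simp_all del: tangent_simps(5,6))
  show "h \<bullet>\<^bsub>DB A\<^esub> (g \<bullet>\<^bsub>DB A\<^esub> f) = h \<bullet>\<^bsub>DB A\<^esub> g \<bullet>\<^bsub>DB A\<^esub> f"
    if "f \<in> hom_set (DB A) B C" "g \<in> hom_set (DB A) C D" "h \<in> hom_set (DB A) D G" for f g h B C D G
    using category.Comp_assoc[OF cat, unfolded hom_set_tangent, OF that[THEN DBun_hom_mor]]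
    unfolding DBun_simps(5) by (intro arrow_eqI) (simp_all del: tangent_simps(5,6))
qed

lemma Mod_cat_hom_set:
  "f \<in> hom_set (Mod_cat F A) M N \<longleftrightarrow> src f = M \<and> tgt f = N \<and> nonunital_module F A M \<and>
     nonunital_module F A N \<and> mor f \<in> carrier M \<rightarrow>\<^sub>E carrier N \<and> linear_hom F M N (mor f) \<and>
     (\<forall>a\<in>carrier A. \<forall>x\<in>carrier M. mor f (act M a x) = act N a (mor f x))"
  by (simp add: Mod_cat_def concrete_category_hom_set)

lemma Mod_cat_simps [simp]:
  "Obj (Mod_cat F A) = {M. nonunital_module F A M}" "Dom (Mod_cat F A) = src" "Cod (Mod_cat F A) = tgt"
  "Id (Mod_cat F A) M = Arrow M (\<lambda>x\<in>carrier M. x) M"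
  "g \<bullet>\<^bsub>Mod_cat F A\<^esub> f = Arrow (src f) (compose (carrier (src f)) (mor g) (mor f)) (tgt g)"
  by (simp_all add: Mod_cat_def)

lemma Mod_cat_Arr: "f \<in> Arr (Mod_cat F A) \<longleftrightarrow> f \<in> hom_set (Mod_cat F A) (src f) (tgt f)"
  by (simp add: hom_set_def)

lemma category_Mod_cat: "category (Mod_cat F A)"
  unfolding Mod_cat_def
proof (rule category_concrete_category)
  fix L M N and f g
  assume "L \<in> {M. nonunital_module F A M}"
  then interpret L: nonunital_module F A L by simp
  show "linear_hom F L L (\<lambda>x\<in>carrier L. x) \<and>
      (\<forall>a\<in>carrier A. \<forall>x\<in>carrier L. (\<lambda>x\<in>carrier L. x) (act L a x) = act L a ((\<lambda>x\<in>carrier L. x) x))"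
    by (simp add: linear_hom_def L.act_closed)
  show "linear_hom F L N (compose (carrier L) g f) \<and>
      (\<forall>a\<in>carrier A. \<forall>x\<in>carrier L. compose (carrier L) g f (act L a x) = act N a (compose (carrier L) g f x))"
    if "f \<in> carrier L \<rightarrow> carrier M"
      "linear_hom F L M f \<and> (\<forall>a\<in>carrier A. \<forall>x\<in>carrier L. f (act L a x) = act M a (f x))"
      "linear_hom F M N g \<and> (\<forall>a\<in>carrier A. \<forall>x\<in>carrier M. g (act M a x) = act N a (g x))"
    using that by (simp add: linear_hom_def L.act_closed compose_def Pi_iff)
qed

end

section \<open>The equivalence\<close>

context char_p_field
begin

text \<open>The base is written \<open>tgt (bun_q B)\<close> so that the arrow depends on the bundle
  alone; it is A for a bundle over A.\<close>

abbreviation unit_inverse :: "('f, 'u::infinite) dp_bundle \<Rightarrow> ('f, 'u) dp_arrow" where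
  "unit_inverse B \<equiv> fun_arrow (ltimes F p (tgt (bun_q B)) (ker_obj B))
     (\<lambda>x. mor (bun_zeta B) (ufst x) \<oplus>\<^bsub>src (bun_q B)\<^esub> usnd x) (src (bun_q B))"

text \<open>Splits e into its base point and the remainder e - \<zeta>(q(e)), which lies in the
  kernel because q \<zeta> = id.\<close>

abbreviation unit_arrow :: "('f, 'u::infinite) dp_bundle \<Rightarrow> ('f, 'u) dp_arrow" where
  "unit_arrow B \<equiv> fun_arrow (src (bun_q B))
     (\<lambda>e. upair (mor (bun_q B) e) (e \<ominus>\<^bsub>src (bun_q B)\<^esub> mor (bun_zeta B) (mor (bun_q B) e)))
     (ltimes F p (tgt (bun_q B)) (ker_obj B))"

text \<open>The operations are checked for the map from pairs to E, where the vanishing of products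
  and powers on the kernel applies directly; the map from E inherits them as its inverse.\<close>

lemma
  fixes A :: "('f, 'u::infinite) dp_algebra"
  assumes B: "is_bundle A B"
  shows unit_inverse_hom: "Arrow (ltimes_obj F p A (ker_obj B)) (unit_inverse B) B
      \<in> hom_set (DB A) (ltimes_obj F p A (ker_obj B)) B"
    and unit_arrow_hom: "Arrow B (unit_arrow B) (ltimes_obj F p A (ker_obj B))
      \<in> hom_set (DB A) B (ltimes_obj F p A (ker_obj B))"
    and unit_inverse_unit: "\<And>e. e \<in> carrier (src (bun_q B)) \<Longrightarrow>
      mor (unit_inverse B) (mor (unit_arrow B) e) = e"
    and unit_unit_inverse: "\<And>x. x \<in> carrier (ltimes F p A (ker_obj B)) \<Longrightarrow>
      mor (unit_arrow B) (mor (unit_inverse B) x) = x"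
proof -
  interpret dp_differential_bundle F p A "bun_q B" "bun_fst B" "bun_snd B"
     "bun_sigma B" "bun_zeta B" "bun_lambda B" by (rule bundle_locale[OF B])
  let ?q = "bun_q B" and ?z = "bun_zeta B" and ?l = "bun_lambda B" and ?L = "ltimes_obj F p A (ker_obj B)"
  have M: "dp_module F A (ker_obj B)" by (rule dp_module_ker_obj[OF B])
  have L: "is_bundle A ?L" by (rule is_bundle_ltimes_obj[OF M])
  let ?P = "ltimes F p A (ker_obj B)"
  have P: "divided_power_algebra F ?P" by (rule divided_power_algebra_ltimes[OF M])
  have P_car: "x \<in> carrier ?P \<longleftrightarrow> (\<exists>a k. x = upair a k \<and> a \<in> carrier A \<and> k \<in> K)" for x
    by (auto simp: arrs)
  have th: "mor (unit_inverse B) (upair a k) = mor ?z a \<oplus>\<^bsub>E\<^esub> k" if "a \<in> carrier A" "k \<in> K" for a k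
    using that by (simp add: arrs)
  have et: "mor (unit_arrow B) e = upair (mor ?q e) (e \<ominus>\<^bsub>E\<^esub> mor ?z (mor ?q e))" if "e \<in> carrier E" for e
    using that by simp
  have diff: "e \<ominus>\<^bsub>E\<^esub> mor ?z (mor ?q e) \<in> K" if "e \<in> carrier E" for e
    using that by (simp add: a_minus_def q_simps zeta_simps q_zeta A.M.r_neg)
  have q_add: "mor ?q (mor ?z a \<oplus>\<^bsub>E\<^esub> k) = a" if "a \<in> carrier A" "k \<in> K" for a k
    using that by (simp add: q_simps zeta_simps q_zeta)
  show inv1: "mor (unit_inverse B) (mor (unit_arrow B) e) = e" if e: "e \<in> carrier E" for e
  proof -
    have "mor (unit_inverse B) (mor (unit_arrow B) e) = mor ?z (mor ?q e) \<oplus>\<^bsub>E\<^esub> (e \<ominus>\<^bsub>E\<^esub> mor ?z (mor ?q e))"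
      unfolding et[OF e] by (rule th[OF q_simps(1)[OF e] diff[OF e]])
    also have "\<dots> = e"
      using e by (simp add: a_minus_def q_simps zeta_simps E.M.a_lcomm[of "mor ?z (mor ?q e)"] E.M.r_neg)
    finally show ?thesis .
  qed
  show inv2: "mor (unit_arrow B) (mor (unit_inverse B) x) = x" if x: "x \<in> carrier ?P" for x
  proof -
    obtain a k where ak: "x = upair a k" "a \<in> carrier A" "k \<in> K" using x P_car by blast
    have "mor ?z a \<oplus>\<^bsub>E\<^esub> k \<in> carrier E" using ak by (simp add: zeta_simps)
    then have "mor (unit_arrow B) (mor (unit_inverse B) x) =
        upair a ((mor ?z a \<oplus>\<^bsub>E\<^esub> k) \<ominus>\<^bsub>E\<^esub> mor ?z a)"
      unfolding ak(1) th[OF ak(2,3)] by (simp add: et q_add[OF ak(2,3)])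
    also have "(mor ?z a \<oplus>\<^bsub>E\<^esub> k) \<ominus>\<^bsub>E\<^esub> mor ?z a = k"
      using ak by (simp add: a_minus_def zeta_simps E.M.a_comm[of "mor ?z a"] E.M.a_assoc E.M.r_neg)
    finally show ?thesis using ak(1) by simp
  qed
  have zk: "mor ?z a \<otimes>\<^bsub>E\<^esub> k \<in> K" if "a \<in> carrier A" "k \<in> K" for a k
    using ker_closed(4) zeta_simps(1) that by blast
  have th_mult: "mor (unit_inverse B) (x \<otimes>\<^bsub>?P\<^esub> y) = mor (unit_inverse B) x \<otimes>\<^bsub>E\<^esub> mor (unit_inverse B) y"
    if xy: "x \<in> carrier ?P" "y \<in> carrier ?P" for x y
  proof -
    obtain a k where ak: "x = upair a k" "a \<in> carrier A" "k \<in> K" using xy P_car by blast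
    obtain b l where bl: "y = upair b l" "b \<in> carrier A" "l \<in> K" using xy P_car by blast
    have "mor (unit_inverse B) (x \<otimes>\<^bsub>?P\<^esub> y) =
        mor ?z (a \<otimes>\<^bsub>A\<^esub> b) \<oplus>\<^bsub>E\<^esub> ((mor ?z a \<otimes>\<^bsub>E\<^esub> l) \<oplus>\<^bsub>E\<^esub> (mor ?z b \<otimes>\<^bsub>E\<^esub> k))"
      using th[OF A.mult_closed[OF ak(2) bl(2)] ker_closed(1)[OF zk[OF ak(2) bl(3)] zk[OF bl(2) ak(3)]]]
      by (simp add: ak bl)
    \<comment> \<open>When the product is expanded, the only term without counterpart in the
      semidirect product is kl, and it vanishes.\<close>
    also have "\<dots> = (mor ?z a \<oplus>\<^bsub>E\<^esub> k) \<otimes>\<^bsub>E\<^esub> (mor ?z b \<oplus>\<^bsub>E\<^esub> l)"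
      using ak bl ker_mult[OF ak(3) bl(3)]
      by (simp add: zeta_simps E.mult_distrib E.mult_distrib_right E.mult_closed E.M.a_ac
          E.mult_comm[of k "mor ?z b"])
    finally show ?thesis using th[OF ak(2,3)] th[OF bl(2,3)] ak bl by simp
  qed
  have th_dpow: "mor (unit_inverse B) (dpow ?P n x) = dpow E n (mor (unit_inverse B) x)"
    if n: "1 \<le> n" and x: "x \<in> carrier ?P" for n x
  proof -
    obtain a k where ak: "x = upair a k" "a \<in> carrier A" "k \<in> K" using x P_car by blast
    \<comment> \<open>The module part of (a, k)^[n], with the action written out as multiplication
      by \<zeta> of a divided power; n = 1 is the convention at index 0.\<close>
    let ?m = "if n = 1 then k else mor ?z (dpow A (n - 1) a) \<otimes>\<^bsub>E\<^esub> k"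
    have m: "?m \<in> K"
      using ak n zk[of "dpow A (n - 1) a" k] A.dpow_closed[of "n - 1" a] by (cases "n = 1") auto
    have "dpow ?P n x = upair (dpow A n a) ?m"
      unfolding ak(1) by (subst dpow_ltimes_cases[OF M n ak(2)]) (use ak(3) in \<open>simp_all add: arrs\<close>)
    then have "mor (unit_inverse B) (dpow ?P n x) = mor ?z (dpow A n a) \<oplus>\<^bsub>E\<^esub> ?m"
      using th[OF A.dpow_closed[OF n ak(2)] m] by simp
    also have "\<dots> = dpow E n (mor ?z a \<oplus>\<^bsub>E\<^esub> k)"
      using dpow_add_ker[OF n zeta_simps(1)[OF ak(2)] ak(3)] ak n by (simp add: zeta_simps)
    finally show ?thesis using th[OF ak(2,3)] ak(1) by simp
  qed
  have car: "mor (unit_inverse B) x \<in> carrier E" if "x \<in> carrier ?P" for x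
    using that by (auto simp: arrs zeta_simps)
  have theta: "unit_inverse B \<in> dp_homs F ?P E"
    unfolding arrs
  proof (rule fun_arrow_homs[OF P E.divided_power_algebra_axioms])
    \<comment> \<open>On the carrier the bare formula agrees with the restricted arrow, so the facts
      proved for the arrow can be reused.\<close>
    have eq: "mor ?z (ufst x) \<oplus>\<^bsub>E\<^esub> usnd x = mor (unit_inverse B) x" if "x \<in> carrier ?P" for x
      using that by (simp add: arrs)
    interpret P: divided_power_algebra F ?P by (rule P)
    fix x assume x: "x \<in> carrier ?P"
    show "mor ?z (ufst x) \<oplus>\<^bsub>E\<^esub> usnd x \<in> carrier E" unfolding eq[OF x] by (rule car[OF x])
    show "mor ?z (ufst (c \<odot>\<^bsub>?P\<^esub> x)) \<oplus>\<^bsub>E\<^esub> usnd (c \<odot>\<^bsub>?P\<^esub> x) = c \<odot>\<^bsub>E\<^esub> (mor ?z (ufst x) \<oplus>\<^bsub>E\<^esub> usnd x)"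
      if "c \<in> carrier F" for c
      using x that by (auto simp: arrs zeta_simps E.smult_r_distr)
    show "mor ?z (ufst (dpow ?P n x)) \<oplus>\<^bsub>E\<^esub> usnd (dpow ?P n x) = dpow E n (mor ?z (ufst x) \<oplus>\<^bsub>E\<^esub> usnd x)"
      if "1 \<le> n" for n
      unfolding eq[OF x] eq[OF P.dpow_closed[OF that x]] by (rule th_dpow[OF that x])
    fix y assume y: "y \<in> carrier ?P"
    show "mor ?z (ufst (x \<oplus>\<^bsub>?P\<^esub> y)) \<oplus>\<^bsub>E\<^esub> usnd (x \<oplus>\<^bsub>?P\<^esub> y) =
        (mor ?z (ufst x) \<oplus>\<^bsub>E\<^esub> usnd x) \<oplus>\<^bsub>E\<^esub> (mor ?z (ufst y) \<oplus>\<^bsub>E\<^esub> usnd y)"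
      using x y by (auto simp: arrs zeta_simps E.M.a_ac)
    show "mor ?z (ufst (x \<otimes>\<^bsub>?P\<^esub> y)) \<oplus>\<^bsub>E\<^esub> usnd (x \<otimes>\<^bsub>?P\<^esub> y) =
        (mor ?z (ufst x) \<oplus>\<^bsub>E\<^esub> usnd x) \<otimes>\<^bsub>E\<^esub> (mor ?z (ufst y) \<oplus>\<^bsub>E\<^esub> usnd y)"
      unfolding eq[OF x] eq[OF y] eq[OF P.mult_closed[OF x y]] by (rule th_mult[OF x y])
  qed
  have eta: "unit_arrow B \<in> dp_homs F E ?P"
    unfolding arrs(1)
  proof (rule inverse_homs[OF theta])
    fix e assume e: "e \<in> carrier E"
    have eq: "mor (unit_arrow B) e = upair (mor ?q e) (e \<ominus>\<^bsub>E\<^esub> mor ?z (mor ?q e))" by (rule et[OF e])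
    show "upair (mor ?q e) (e \<ominus>\<^bsub>E\<^esub> mor ?z (mor ?q e)) \<in> carrier ?P"
      unfolding P_car using q_simps(1)[OF e] diff[OF e] by blast
    show "mor (unit_inverse B) (upair (mor ?q e) (e \<ominus>\<^bsub>E\<^esub> mor ?z (mor ?q e))) = e"
      unfolding eq[symmetric] by (rule inv1[OF e])
  next
    fix x assume x: "x \<in> carrier ?P"
    show "upair (mor ?q (mor (unit_inverse B) x)) (mor (unit_inverse B) x \<ominus>\<^bsub>E\<^esub>
        mor ?z (mor ?q (mor (unit_inverse B) x))) = x"
      unfolding et[OF car[OF x], symmetric] by (rule inv2[OF x])
  qed
  have th_ker: "mor (unit_inverse B) (upair a \<zero>\<^bsub>E\<^esub>) = mor ?z a" if "a \<in> carrier A" for a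
    using th[OF that ker_zero] that by (simp add: zeta_simps)
  have th_ker': "mor (unit_inverse B) (upair \<zero>\<^bsub>A\<^esub> k) = k" if "k \<in> K" for k
    using th[OF A.M.zero_closed that] that by (simp add: zeta_simps)
  have lam_th: "mor ?l (mor ?z a \<oplus>\<^bsub>E\<^esub> k) = upair (mor ?z a) k" if "a \<in> carrier A" "k \<in> K" for a k
  proof -
    have "mor ?l (mor ?z a \<oplus>\<^bsub>E\<^esub> k) = mor ?l (mor ?z a) \<oplus>\<^bsub>T_alg F p E\<^esub> mor ?l k"
      using that by (intro dp_homs_add[OF lam_homs]) (simp_all add: zeta_simps)
    then show ?thesis unfolding lam_zeta[OF that(1)] lam_ker[OF that(2)]
      using that by (simp add: zeta_simps)
  qed
  let ?lP = "bun_lambda ?L"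
  have lP: "mor ?lP (upair a k) = upair (upair a \<zero>\<^bsub>E\<^esub>) (upair \<zero>\<^bsub>A\<^esub> k)" if "a \<in> carrier A" "k \<in> K" for a k
    using that by (simp add: arrs)
  \<comment> \<open>T applies the map to (a, 0) and (0, k) separately, with values \<zeta>(a) and
    k.\<close>
  have T_theta: "mor (T_hom F p (unit_inverse B)) (mor ?lP (upair a k)) = upair (mor ?z a) k"
    if "a \<in> carrier A" "k \<in> K" for a k
  proof -
    have "upair a \<zero>\<^bsub>E\<^esub> \<in> carrier ?P" "upair \<zero>\<^bsub>A\<^esub> k \<in> carrier ?P"
      unfolding P_car using that ker_zero A.M.zero_closed by blast+
    then show ?thesis unfolding lP[OF that]
      using th_ker[OF that(1)] th_ker'[OF that(2)] dp_homs_src[OF theta]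
      by (simp del: mor_fun_arrow ltimes_simps)
  qed
  show "Arrow ?L (unit_inverse B) B
      \<in> hom_set (DB A) ?L B"
  proof (rule DBun_homI[OF L B])
    show "unit_inverse B \<in> dp_homs F (src (bun_q ?L)) E"
      using theta by simp
    fix x assume "x \<in> carrier (src (bun_q ?L))"
    then have x: "x \<in> carrier ?P" by simp
    then obtain a k where ak: "x = upair a k" "a \<in> carrier A" "k \<in> K" using P_car by blast
    show "mor ?q (mor (unit_inverse B) x) = mor (bun_q ?L) x"
      unfolding ak(1) th[OF ak(2,3)] q_add[OF ak(2,3)] using ak by (simp add: arrs)
    show "mor (T_hom F p (unit_inverse B)) (mor ?lP x) = mor ?l (mor (unit_inverse B) x)"
      unfolding ak(1) th[OF ak(2,3)] lam_th[OF ak(2,3)] by (rule T_theta[OF ak(2,3)])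
  qed
  show "Arrow B (unit_arrow B) ?L
      \<in> hom_set (DB A) B ?L"
  proof (rule DBun_homI[OF B L])
    show "unit_arrow B \<in> dp_homs F E (src (bun_q ?L))"
      using eta by simp
    fix e assume e: "e \<in> carrier E"
    let ?a = "mor ?q e" and ?k = "e \<ominus>\<^bsub>E\<^esub> mor ?z (mor ?q e)"
    have a: "?a \<in> carrier A" by (rule q_simps(1)[OF e])
    note k = diff[OF e]
    have e_eq: "mor ?z ?a \<oplus>\<^bsub>E\<^esub> ?k = e" using inv1[OF e] unfolding et[OF e] th[OF a k] .
    have "upair ?a ?k \<in> carrier ?P" unfolding P_car using a k by blast
    then show "mor (bun_q ?L) (mor (unit_arrow B) e) = mor ?q e"
      unfolding et[OF e] by simp
    have "mor ?l e = upair (mor ?z ?a) ?k" using lam_th[OF a k] unfolding e_eq .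
    \<comment> \<open>The values at the two components of the lift are read off from the inverse law
      at (a, 0) and at (0, k).\<close>
    moreover have "mor (unit_arrow B) (mor ?z ?a) = upair ?a \<zero>\<^bsub>E\<^esub>"
    proof -
      have "upair ?a \<zero>\<^bsub>E\<^esub> \<in> carrier ?P" unfolding P_car using a ker_zero by blast
      from inv2[OF this] show ?thesis unfolding th_ker[OF a] .
    qed
    moreover have "mor (unit_arrow B) ?k = upair \<zero>\<^bsub>A\<^esub> ?k"
    proof -
      have "upair \<zero>\<^bsub>A\<^esub> ?k \<in> carrier ?P" unfolding P_car using k A.M.zero_closed by blast
      from inv2[OF this] show ?thesis unfolding th_ker'[OF k] .
    qed
    moreover have "mor ?z ?a \<in> carrier E" "?k \<in> carrier E" using a k zeta_simps by auto
    ultimately show "mor (T_hom F p (unit_arrow B)) (mor ?l e) = mor ?lP (mor (unit_arrow B) e)"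
      unfolding et[OF e] lP[OF a k] by (simp del: mor_fun_arrow)
  qed
qed

lemma cat_functor_ker:
  fixes A :: "('f, 'u::infinite) dp_algebra"
  shows "cat_functor (DB A) (Mod_cat F (underlying A)) ker_obj ker_arr"
proof (intro cat_functor.intro category_DBun category_Mod_cat cat_functor_axioms.intro)
  show "ker_obj B \<in> Obj (Mod_cat F (underlying A))" if "B \<in> Obj (DB A)" for B
    using dp_module_ker_obj[of A B] that by (simp add: dp_module_def)
  fix f B C assume f: "f \<in> hom_set (DB A) B C"
  interpret B: dp_differential_bundle F p A "bun_q B" "bun_fst B" "bun_snd B"
     "bun_sigma B" "bun_zeta B" "bun_lambda B" by (rule bundle_locale[OF DBun_hom_dom[OF f]])
  interpret C: dp_differential_bundle F p A "bun_q C" "bun_fst C" "bun_snd C"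
     "bun_sigma C" "bun_zeta C" "bun_lambda C" by (rule bundle_locale[OF DBun_hom_cod[OF f]])
  note m = DBun_hom_mor[OF f]
  have K: "mor (mor f) k \<in> C.K" if "k \<in> B.K" for k
    using that dp_homs_closed[OF m] DBun_hom_q[OF f] by simp
  show "ker_arr f \<in> hom_set (Mod_cat F (underlying A)) (ker_obj B) (ker_obj C)"
    unfolding Mod_cat_hom_set
  proof (intro conjI)
    show "nonunital_module F (underlying A) (ker_obj B)" "nonunital_module F (underlying A) (ker_obj C)"
      using dp_module_ker_obj[OF DBun_hom_dom[OF f]] dp_module_ker_obj[OF DBun_hom_cod[OF f]]
      by (simp_all add: dp_module_def)
    show "mor (ker_arr f) \<in> carrier (ker_obj B) \<rightarrow>\<^sub>E carrier (ker_obj C)"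
      using K by (auto simp: ker_arr_def DBun_hom_src[OF f] B.arrs C.arrs)
    show "linear_hom F (ker_obj B) (ker_obj C) (mor (ker_arr f))"
      using B.ker_closed
      by (simp add: linear_hom_def ker_arr_def DBun_hom_src[OF f] B.arrs dp_homs_add[OF m] dp_homs_smult[OF m])
    \<comment> \<open>Linearity over A uses that bundle morphisms respect the zero section: f maps
      the product of \<zeta>(a) and e to that of \<zeta>'(a) and f(e).\<close>
    show "\<forall>a\<in>carrier (underlying A). \<forall>x\<in>carrier (ker_obj B).
      mor (ker_arr f) (act (ker_obj B) a x) = act (ker_obj C) a (mor (ker_arr f) x)"
      using B.ker_closed(4) B.zeta_simps(1) DBun_hom_zeta[OF f]
      by (simp add: ker_arr_def DBun_hom_src[OF f] B.arrs dp_homs_mult[OF m])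
  qed (simp_all add: ker_arr_def DBun_hom_src[OF f] DBun_hom_tgt[OF f])
next
  show "ker_arr (Id (DB A) B) = Id (Mod_cat F (underlying A)) (ker_obj B)" for B
    by (auto simp: ker_arr_def fun_eq_iff)
  fix f g B C D assume f: "f \<in> hom_set (DB A) B C" and g: "g \<in> hom_set (DB A) C D"
  \<comment> \<open>Thus f carries the kernel of one projection into that of the other, and
    restriction to kernels commutes with composition.\<close>
  have "mor (bun_q C) (mor (mor f) e) = mor (bun_q B) e" "mor (mor f) e \<in> carrier (src (bun_q C))"
    if "e \<in> carrier (src (bun_q B))" for e
    using that DBun_hom_q[OF f] dp_homs_closed[OF DBun_hom_mor[OF f]] by auto
  moreover have "tgt (bun_q B) = A" "tgt (bun_q C) = A"
    using dp_homs_tgt[OF bundle_q_homs[OF DBun_hom_dom[OF f]]] dp_homs_tgt[OF bundle_q_homs[OF DBun_hom_cod[OF f]]] .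
  ultimately show "ker_arr (g \<bullet>\<^bsub>DB A\<^esub> f) = ker_arr g \<bullet>\<^bsub>Mod_cat F (underlying A)\<^esub> ker_arr f"
    by (auto simp: ker_arr_def fun_eq_iff compose_def DBun_hom_src[OF f] DBun_hom_src[OF g]
        dp_homs_src[OF DBun_hom_mor[OF f]])
qed

text \<open>For n \<ge> 2 the module part of (a, m)^[n] is a^[n-1] m, and A-linearity moves g past
  the action.\<close>

lemma ltimes_arr_homs:
  fixes A :: "('f, 'u::infinite) dp_algebra"
  assumes A: "divided_power_algebra F A" and g: "g \<in> hom_set (Mod_cat F (underlying A)) M N"
  shows "fun_arrow (ltimes F p A M) (\<lambda>x. upair (ufst x) (mor g (usnd x))) (ltimes F p A N)
    \<in> dp_homs F (ltimes F p A M) (ltimes F p A N)"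
proof -
  note g' = g[unfolded Mod_cat_hom_set linear_hom_def PiE_iff]
  have M: "dp_module F A M" and N: "dp_module F A N" using g' A by (simp_all add: dp_module_iff)
  interpret M: dp_module F A M by (rule M)
  interpret N: dp_module F A N by (rule N)
  have gs: "\<And>x. x \<in> carrier M \<Longrightarrow> mor g x \<in> carrier N"
    "\<And>x y. \<lbrakk>x \<in> carrier M; y \<in> carrier M\<rbrakk> \<Longrightarrow> mor g (x \<oplus>\<^bsub>M\<^esub> y) = mor g x \<oplus>\<^bsub>N\<^esub> mor g y"
    "\<And>c x. \<lbrakk>c \<in> carrier F; x \<in> carrier M\<rbrakk> \<Longrightarrow> mor g (c \<odot>\<^bsub>M\<^esub> x) = c \<odot>\<^bsub>N\<^esub> mor g x"
    "\<And>a x. \<lbrakk>a \<in> carrier A; x \<in> carrier M\<rbrakk> \<Longrightarrow> mor g (act M a x) = act N a (mor g x)"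
    using g' by simp_all
  show ?thesis
    by (rule fun_arrow_homs[OF divided_power_algebra_ltimes[OF M] divided_power_algebra_ltimes[OF N]])
      (auto simp: gs dpow_ltimes_cases[OF M] dpow_ltimes_cases[OF N] M.act_closed M.dpow_closed)
qed

lemma cat_functor_ltimes:
  fixes A :: "('f, 'u::infinite) dp_algebra"
  assumes A: "divided_power_algebra F A"
  shows "cat_functor (Mod_cat F (underlying A)) (DB A) (ltimes_obj F p A) (ltimes_arr F p A)"
proof (intro cat_functor.intro category_DBun category_Mod_cat cat_functor_axioms.intro)
  have is_bdl: "is_bundle A (ltimes_obj F p A M)" if "nonunital_module F (underlying A) M" for M
    using that by (intro is_bundle_ltimes_obj) (simp add: dp_module_iff[OF A])
  show "ltimes_obj F p A M \<in> Obj (DB A)" if "M \<in> Obj (Mod_cat F (underlying A))" for M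
    using that is_bdl by simp
  interpret A: divided_power_algebra F A by (rule A)
  fix g M N assume g: "g \<in> hom_set (Mod_cat F (underlying A)) M N"
  note g' = g[unfolded Mod_cat_hom_set PiE_iff]
  have M: "nonunital_module F (underlying A) M" and N: "nonunital_module F (underlying A) N"
    and st: "src g = M" "tgt g = N" and gc: "\<And>x. x \<in> carrier M \<Longrightarrow> mor g x \<in> carrier N"
    using g' by simp_all
  interpret M: nonunital_module F "underlying A" M by (rule M)
  interpret N: nonunital_module F "underlying A" N by (rule N)
  \<comment> \<open>The lift of (a, m) has base point (a, 0), so compatibility with the lifts
    requires g(0) = 0.\<close>
  have g0: "mor g \<zero>\<^bsub>M\<^esub> = \<zero>\<^bsub>N\<^esub>"
    by (rule linear_hom_zero[OF _ _ M.module_axioms N.module_axioms]) (use g' in auto)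
  show "ltimes_arr F p A g \<in> hom_set (DB A) (ltimes_obj F p A M) (ltimes_obj F p A N)"
    unfolding ltimes_arr_def st
  proof (rule DBun_homI[OF is_bdl[OF M] is_bdl[OF N]])
    show "fun_arrow (ltimes F p A M) (\<lambda>x. upair (ufst x) (mor g (usnd x))) (ltimes F p A N)
      \<in> dp_homs F (src (bun_q (ltimes_obj F p A M))) (src (bun_q (ltimes_obj F p A N)))"
      using ltimes_arr_homs[OF A g] by simp
  qed (auto simp: gc g0)
next
  fix M assume "M \<in> Obj (Mod_cat F (underlying A))"
  show "ltimes_arr F p A (Id (Mod_cat F (underlying A)) M) = Id (DB A) (ltimes_obj F p A M)"
    by (auto simp: ltimes_arr_def fun_arrow_def fun_eq_iff)
next
  fix f g L M N assume f: "f \<in> hom_set (Mod_cat F (underlying A)) L M" and g: "g \<in> hom_set (Mod_cat F (underlying A)) M N"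
  have "mor f x \<in> carrier M" if "x \<in> carrier L" for x
    using f that by (auto simp: Mod_cat_hom_set)
  moreover have "src f = L" "tgt f = M" "src g = M" "tgt g = N" using f g by (auto simp: Mod_cat_hom_set)
  ultimately show "ltimes_arr F p A (g \<bullet>\<^bsub>Mod_cat F (underlying A)\<^esub> f) = ltimes_arr F p A g \<bullet>\<^bsub>DB A\<^esub> ltimes_arr F p A f"
    by (auto simp: ltimes_arr_def fun_arrow_def fun_eq_iff compose_def)
qed

lemma unit_natural_iso:
  fixes A :: "('f, 'u::infinite) dp_algebra"
  assumes A: "divided_power_algebra F A"
  shows "natural_iso (DB A) (DB A) id id (ltimes_obj F p A \<circ> ker_obj) (ltimes_arr F p A \<circ> ker_arr)
    (\<lambda>B. Arrow B (unit_arrow B) (ltimes_obj F p A (ker_obj B)))"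
  unfolding natural_iso_def
proof (intro conjI ballI)
  let ?\<eta> = "\<lambda>B. Arrow B (unit_arrow B) (ltimes_obj F p A (ker_obj B))"
  let ?\<theta> = "\<lambda>B. Arrow (ltimes_obj F p A (ker_obj B)) (unit_inverse B) B"
  fix B assume "B \<in> Obj (DB A)"
  then have B: "is_bundle A B" by simp
  show \<eta>: "?\<eta> B \<in> hom_set (DB A) (id B) ((ltimes_obj F p A \<circ> ker_obj) B)"
    using unit_arrow_hom[OF B] by simp
  let ?X = "algebraic_tangent F p :: (('f, 'u) dp_algebra, ('f, 'u) dp_arrow) tangent_category"
  let ?P = "ltimes F p A (ker_obj B)" and ?E = "src (bun_q B)"
  have t: "tgt (bun_q B) = A" by (rule dp_homs_tgt[OF bundle_q_homs[OF B]])
  note homs = unit_arrow_hom[OF B, THEN DBun_hom_mor, unfolded arrow.sel ltimes_obj_simps fun_arrow_src_tgt]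
    unit_inverse_hom[OF B, THEN DBun_hom_mor, unfolded arrow.sel ltimes_obj_simps fun_arrow_src_tgt]
  have "unit_inverse B \<star> unit_arrow B = Id ?X ?E"
  proof (rule dp_homs_eqI[OF comp_homs[OF homs] Id_homs[OF dp_homs_dom[OF homs(1)]]])
    show "mor (unit_inverse B \<star> unit_arrow B) e = mor (Id ?X ?E) e" if "e \<in> carrier ?E" for e
      using unit_inverse_unit[OF B that] that by (simp add: compose_def del: mor_fun_arrow)
  qed
  then have 1: "?\<theta> B \<bullet>\<^bsub>DB A\<^esub> ?\<eta> B = Id (DB A) B"
    by (simp only: DBun_simps(4,5) arrow.sel)
  have "unit_arrow B \<star> unit_inverse B = Id ?X ?P"
  proof (rule dp_homs_eqI[OF comp_homs[OF homs(2,1)] Id_homs[OF dp_homs_dom[OF homs(2)]]])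
    show "mor (unit_arrow B \<star> unit_inverse B) x = mor (Id ?X ?P) x" if "x \<in> carrier ?P" for x
      using unit_unit_inverse[OF B that] that
      by (simp add: compose_def t del: mor_fun_arrow ltimes_simps ker_obj_simps)
  qed
  then have 2: "?\<eta> B \<bullet>\<^bsub>DB A\<^esub> ?\<theta> B = Id (DB A) (ltimes_obj F p A (ker_obj B))"
    by (simp only: DBun_simps(4,5) arrow.sel ltimes_obj_simps fun_arrow_src_tgt)
  show "is_iso (DB A) (?\<eta> B)"
    unfolding is_iso_def DBun_Arr DBun_simps(2,3) arrow.sel
    using unit_arrow_hom[OF B] unit_inverse_hom[OF B] 1 2 by blast
next
  let ?\<eta> = "\<lambda>B. Arrow B (unit_arrow B) (ltimes_obj F p A (ker_obj B))"
  fix f assume "f \<in> Arr (DB A)"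
  define B where "B = src f"
  define C where "C = tgt f"
  have f: "f \<in> hom_set (DB A) B C" using \<open>f \<in> Arr (DB A)\<close> by (simp add: DBun_Arr B_def C_def)
  note cF = cat_functor_ker[of A] and cG = cat_functor_ltimes[OF A]
  have GFf: "ltimes_arr F p A (ker_arr f) \<in> hom_set (DB A) (ltimes_obj F p A (ker_obj B)) (ltimes_obj F p A (ker_obj C))"
    by (rule cat_functor.Fa_hom[OF cG cat_functor.Fa_hom[OF cF f]])
  interpret B: dp_differential_bundle F p A "bun_q B" "bun_fst B" "bun_snd B"
     "bun_sigma B" "bun_zeta B" "bun_lambda B" by (rule bundle_locale[OF DBun_hom_dom[OF f]])
  interpret C: dp_differential_bundle F p A "bun_q C" "bun_fst C" "bun_snd C"
     "bun_sigma C" "bun_zeta C" "bun_lambda C" by (rule bundle_locale[OF DBun_hom_cod[OF f]])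
  note m = DBun_hom_mor[OF f]
  note \<eta>B = unit_arrow_hom[OF DBun_hom_dom[OF f], THEN DBun_hom_mor, unfolded arrow.sel]
    and \<eta>C = unit_arrow_hom[OF DBun_hom_cod[OF f], THEN DBun_hom_mor, unfolded arrow.sel]
  have "unit_arrow C \<star> mor f =
      mor (ltimes_arr F p A (ker_arr f)) \<star> unit_arrow B"
  proof (rule dp_homs_eqI[OF comp_homs[OF m \<eta>C] comp_homs[OF \<eta>B DBun_hom_mor[OF GFf]]])
    fix e assume e: "e \<in> carrier B.E"
    have fe: "mor (mor f) e \<in> carrier C.E" by (rule dp_homs_closed[OF m e])
    have qe: "mor (bun_q B) e \<in> carrier A" by (rule B.q_simps(1)[OF e])
    have \<zeta>e: "mor (bun_zeta B) (mor (bun_q B) e) \<in> carrier B.E" by (rule B.zeta_simps(1)[OF qe])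
    let ?k = "e \<ominus>\<^bsub>B.E\<^esub> mor (bun_zeta B) (mor (bun_q B) e)"
    have k: "?k \<in> B.K"
      using e qe \<zeta>e by (simp add: a_minus_def B.q_simps B.q_zeta B.A.M.r_neg)
    \<comment> \<open>Naturality in the second component: f respects differences and the zero
      section, and q'(f(e)) = q(e).\<close>
    have "mor (mor f) ?k = mor (mor f) e \<ominus>\<^bsub>C.E\<^esub> mor (bun_zeta C) (mor (bun_q B) e)"
      using e \<zeta>e by (simp add: a_minus_def dp_homs_add[OF m] dp_homs_minus[OF m] DBun_hom_zeta[OF f qe])
    then show "mor (unit_arrow C \<star> mor f) e =
        mor (mor (ltimes_arr F p A (ker_arr f)) \<star> unit_arrow B) e"
      using e fe qe k
      by (simp add: compose_def dp_homs_src[OF m] ltimes_arr_def ker_arr_def DBun_hom_src[OF f]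
          DBun_hom_q[OF f] B.arrs)
  qed
  then show "?\<eta> (Cod (DB A) f) \<bullet>\<^bsub>DB A\<^esub> id f = (ltimes_arr F p A \<circ> ker_arr) f \<bullet>\<^bsub>DB A\<^esub> ?\<eta> (Dom (DB A) f)"
    using DBun_hom_src[OF f] DBun_hom_tgt[OF f] DBun_hom_tgt[OF GFf]
    by (simp del: tangent_simps(6))
qed

text \<open>The kernel of the projection consists of the pairs (0, m), and (a, 0) times (0, m) is
  (0, am); forgetting the first coordinate is therefore A-linear and bijective.\<close>

lemma counit_natural_iso:
  fixes A :: "('f, 'u::infinite) dp_algebra"
  assumes A: "divided_power_algebra F A"
  shows "natural_iso (Mod_cat F (underlying A)) (Mod_cat F (underlying A))
    (ker_obj \<circ> ltimes_obj F p A) (ker_arr \<circ> ltimes_arr F p A) id id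
    (\<lambda>M. Arrow (ker_obj (ltimes_obj F p A M)) (restrict usnd (carrier (ker_obj (ltimes_obj F p A M)))) M)"
  (is "natural_iso ?D ?D _ _ _ _ ?\<epsilon>")
  unfolding natural_iso_def
proof (intro conjI ballI)
  interpret A: divided_power_algebra F A by (rule A)
  have car: "x \<in> carrier (ker_obj (ltimes_obj F p A M)) \<longleftrightarrow> (\<exists>m. x = upair \<zero>\<^bsub>A\<^esub> m \<and> m \<in> carrier M)" for x and M :: "('f, 'u) act_module"
    by auto
  fix M assume "M \<in> Obj ?D"
  then have M: "nonunital_module F (underlying A) M" by simp
  then have M': "dp_module F A M" by (simp add: dp_module_iff[OF A])
  interpret M: dp_module F A M by (rule M')
  let ?KM = "ker_obj (ltimes_obj F p A M)"
  have KM: "nonunital_module F (underlying A) ?KM"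
    using dp_module_ker_obj[OF is_bundle_ltimes_obj[OF M']] by (simp add: dp_module_iff[OF A])
  have ops: "upair \<zero>\<^bsub>A\<^esub> m \<oplus>\<^bsub>?KM\<^esub> upair \<zero>\<^bsub>A\<^esub> n = upair \<zero>\<^bsub>A\<^esub> (m \<oplus>\<^bsub>M\<^esub> n)"
    "c \<in> carrier F \<Longrightarrow> c \<odot>\<^bsub>?KM\<^esub> upair \<zero>\<^bsub>A\<^esub> m = upair \<zero>\<^bsub>A\<^esub> (c \<odot>\<^bsub>M\<^esub> m)"
    "a \<in> carrier A \<Longrightarrow> m \<in> carrier M \<Longrightarrow> act ?KM a (upair \<zero>\<^bsub>A\<^esub> m) = upair \<zero>\<^bsub>A\<^esub> (act M a m)" for m n c a
    by (simp_all add: M.act_zero_left M.act_closed A.mult_zero)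
  have \<epsilon>: "?\<epsilon> M \<in> hom_set ?D ?KM M"
    unfolding Mod_cat_hom_set
    by (intro conjI KM M)
      (auto simp: car ops linear_hom_def M.act_closed simp del: ker_obj_simps)
  then show "?\<epsilon> M \<in> hom_set ?D ((ker_obj \<circ> ltimes_obj F p A) M) (id M)" by simp
  let ?i = "Arrow M (\<lambda>m\<in>carrier M. upair \<zero>\<^bsub>A\<^esub> m) ?KM"
  have i: "?i \<in> hom_set ?D M ?KM"
    unfolding Mod_cat_hom_set
    by (intro conjI KM M)
      (auto simp: car ops linear_hom_def M.act_closed simp del: ker_obj_simps)
  have "?i \<bullet>\<^bsub>?D\<^esub> ?\<epsilon> M = Id ?D ?KM" "?\<epsilon> M \<bullet>\<^bsub>?D\<^esub> ?i = Id ?D M"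
    by (auto simp: compose_def fun_eq_iff car simp del: ker_obj_simps)
  then show "is_iso ?D (?\<epsilon> M)"
    unfolding is_iso_def Mod_cat_Arr using \<epsilon> i
    by (simp only: Mod_cat_simps(2,3) arrow.sel) blast
next
  fix g assume "g \<in> Arr ?D"
  then have g: "g \<in> hom_set ?D (src g) (tgt g)" by (simp only: Mod_cat_Arr)
  have gc: "mor g m \<in> carrier (tgt g)" if "m \<in> carrier (src g)" for m
    using g that by (auto simp: Mod_cat_hom_set)
  show "?\<epsilon> (Cod ?D g) \<bullet>\<^bsub>?D\<^esub> (ker_arr \<circ> ltimes_arr F p A) g = id g \<bullet>\<^bsub>?D\<^esub> ?\<epsilon> (Dom ?D g)"
    by (auto simp: compose_def fun_eq_iff gc ker_arr_def ltimes_arr_def)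
qed

end

theorem theorem4:
  fixes F :: "'f ring" and p :: nat and A :: "('f, 'u::infinite) dp_algebra"
  assumes "field F" and "is_characteristic F p" and "p > 0"
    and "divided_power_algebra F A"
  shows "equivalence_of_categories
    (DBun (algebraic_tangent F p) A) (Mod_cat F (underlying A))
    ker_obj ker_arr
    (ltimes_obj F p A) (ltimes_arr F p A)"
proof -
  interpret char_p_field F p
    using assms by (simp add: char_p_field_def char_p_field_axioms_def)
  show ?thesis
    by (intro equivalence_of_categories.intro equivalence_of_categories_axioms.intro
        cat_functor_ker cat_functor_ltimes assms(4) exI)
      (rule unit_natural_iso[OF assms(4)] counit_natural_iso[OF assms(4)])+
qed

end
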